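(* Let $f:\mathcal E\to\mathcal F$ and $f':\mathcal E'\to\mathcal F$ be two relative toposes over $\mathcal F$. There is an equivalence of categories $$\mathbf{OpfibWeak}(S_{f'},S_f)\simeq\mathbf{LaxWmor}([f],[f']).$$
   Context: Topos means Grothendieck topos; a relative topos over $\mathcal F$ is a geometric morphism with codomain $\mathcal F$. A weak geometric morphism (weak morphism of toposes) $a:\mathcal E\to\mathcal E'$ is just an adjoint pair $a^*\dashv a_*$ with $a^*:\mathcal E'\to\mathcal E$ (the left adjoint $a^*$ is not required to preserve finite limits). $\mathbf{LaxWmor}([f],[f'])$ is the category of pairs $(a,\phi)$ with $a:\mathcal E\to\mathcal E'$ a weak morphism of toposes and $\phi:a^*f'^*\Rightarrow f^*$ a natural transformation. A morphism $(a,\phi)\to(b,\psi)$ is a natural transformation $\theta:a^*\Rightarrow b^*$ with $\psi\circ(\theta f'^* )=\phi$. For $f:\mathcal E\to\mathcal F$, $S_f$ denotes its canonical stack, with fibers $\mathcal E/f^*(F)$ for $F\in\mathcal F$. It is both a fibration over $\mathcal F$ (by pullback along $f^*(g)$) and an opfibration, where an arrow $g:F\to F'$ of $\mathcal F$ acts by the functor $\Sigma_g:\mathcal E/f^*F\to\mathcal E/f^*F'$ of postcomposition with $f^*(g)$. $\mathbf{OpfibWeak}(S_{f'},S_f)$ is the category of fiberwise weak geometric morphisms whose left adjoints form a morphism of opfibrations: families of adjoint pairs $(a_F)^*\dashv(a_F)_*$, with $(a_F)^*:\mathcal E'/f'^*(F)\to\mathcal E/f^*(F)$ for $F\in\mathcal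 F$, such that the $(a_F)^*$ are the components of a morphism of opfibrations over $\mathcal F$ from $S_{f'}$ to $S_f$ (i.e. commute, up to coherent isomorphism, with the functors $\Sigma_g$). No indexedness (commutation with pullbacks) of the left adjoints is assumed. Morphisms are the vertical natural transformations between the functors of total categories given by the left adjoints. *)

theory Defs
  imports "HOL-Library.FuncSet" "HOL-Library.Equipollence"
begin

section \<open>Categories, functors, natural transformations\<close>

record ('o, 'a) cat =
  Obj :: "'o set"
  Arr :: "'a set"
  Dom :: "'a \<Rightarrow> 'o"
  Cod :: "'a \<Rightarrow> 'o"
  Idn :: "'o \<Rightarrow> 'a"
  Comp :: "'a \<Rightarrow> 'a \<Rightarrow> 'a"  \<comment> \<open>\<open>Comp C g f\<close> is \<open>g\<close> after \<open>f\<close>\<close>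

definition hom :: "('o, 'a) cat \<Rightarrow> 'o \<Rightarrow> 'o \<Rightarrow> 'a set" where
  "hom C x y = {f \<in> Arr C. Dom C f = x \<and> Cod C f = y}"

locale category =
  fixes C :: "('o, 'a) cat"
  assumes Dom_Obj: "f \<in> Arr C \<Longrightarrow> Dom C f \<in> Obj C"
    and Cod_Obj: "f \<in> Arr C \<Longrightarrow> Cod C f \<in> Obj C"
    and Idn_hom: "x \<in> Obj C \<Longrightarrow> Idn C x \<in> hom C x x"
    and Comp_hom: "f \<in> hom C x y \<Longrightarrow> g \<in> hom C y z \<Longrightarrow> Comp C g f \<in> hom C x z"
    and Comp_Idn_right: "f \<in> hom C x y \<Longrightarrow> Comp C f (Idn C x) = f"
    and Comp_Idn_left: "f \<in> hom C x y \<Longrightarrow> Comp C (Idn C y) f = f"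
    and Comp_assoc: "f \<in> hom C w x \<Longrightarrow> g \<in> hom C x y \<Longrightarrow> h \<in> hom C y z \<Longrightarrow>
      Comp C h (Comp C g f) = Comp C (Comp C h g) f"

definition is_iso :: "('o, 'a) cat \<Rightarrow> 'a \<Rightarrow> bool" where
  "is_iso C f \<longleftrightarrow> f \<in> Arr C \<and>
     (\<exists>g \<in> hom C (Cod C f) (Dom C f).
        Comp C g f = Idn C (Dom C f) \<and> Comp C f g = Idn C (Cod C f))"

definition op_cat :: "('o, 'a) cat \<Rightarrow> ('o, 'a) cat" where
  "op_cat C = \<lparr>Obj = Obj C, Arr = Arr C, Dom = Cod C, Cod = Dom C, Idn = Idn C,
     Comp = (\<lambda>g f. Comp C f g)\<rparr>"

definition full_subcat :: "('o, 'a) cat \<Rightarrow> 'o set \<Rightarrow> ('o, 'a) cat" where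
  "full_subcat C S = \<lparr>Obj = Obj C \<inter> S, Arr = {f \<in> Arr C. Dom C f \<in> S \<and> Cod C f \<in> S},
     Dom = Dom C, Cod = Cod C, Idn = Idn C, Comp = Comp C\<rparr>"

text \<open>
  Functors and natural transformations are extensional (they take the value \<open>undefined\<close>
  outside the source category), so that HOL equality is the mathematical equality of
  functors and of natural transformations.
\<close>

record ('o, 'a, 'p, 'b) ftr =
  FOb :: "'o \<Rightarrow> 'p"
  FAr :: "'a \<Rightarrow> 'b"

locale cat_functor = source: category C + target: category D
  for C :: "('o, 'a) cat" and D :: "('p, 'b) cat" +
  fixes F :: "('o, 'a, 'p, 'b) ftr"
  assumes FOb_ext: "FOb F \<in> extensional (Obj C)"
    and FAr_ext: "FAr F \<in> extensional (Arr C)"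
    and FOb_Obj: "x \<in> Obj C \<Longrightarrow> FOb F x \<in> Obj D"
    and FAr_hom: "f \<in> hom C x y \<Longrightarrow> FAr F f \<in> hom D (FOb F x) (FOb F y)"
    and FAr_Idn: "x \<in> Obj C \<Longrightarrow> FAr F (Idn C x) = Idn D (FOb F x)"
    and FAr_Comp: "f \<in> hom C x y \<Longrightarrow> g \<in> hom C y z \<Longrightarrow>
      FAr F (Comp C g f) = Comp D (FAr F g) (FAr F f)"

definition id_ftr :: "('o, 'a) cat \<Rightarrow> ('o, 'a, 'o, 'a) ftr" where
  "id_ftr C = \<lparr>FOb = (\<lambda>x\<in>Obj C. x), FAr = (\<lambda>f\<in>Arr C. f)\<rparr>"

text \<open>\<open>comp_ftr C G F\<close> is \<open>G\<close> after \<open>F\<close>, where \<open>C\<close> is the source of \<open>F\<close>.\<close>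

definition comp_ftr ::
  "('o, 'a) cat \<Rightarrow> ('p, 'b, 'q, 'c) ftr \<Rightarrow> ('o, 'a, 'p, 'b) ftr \<Rightarrow> ('o, 'a, 'q, 'c) ftr" where
  "comp_ftr C G F = \<lparr>FOb = (\<lambda>x\<in>Obj C. FOb G (FOb F x)), FAr = (\<lambda>f\<in>Arr C. FAr G (FAr F f))\<rparr>"

locale nat_trans = F: cat_functor C D F + G: cat_functor C D G
  for C :: "('o, 'a) cat" and D :: "('p, 'b) cat"
    and F G :: "('o, 'a, 'p, 'b) ftr" +
  fixes \<theta> :: "'o \<Rightarrow> 'b"
  assumes ext: "\<theta> \<in> extensional (Obj C)"
    and component: "x \<in> Obj C \<Longrightarrow> \<theta> x \<in> hom D (FOb F x) (FOb G x)"
    and naturality: "f \<in> hom C x y \<Longrightarrow> Comp D (\<theta> y) (FAr F f) = Comp D (FAr G f) (\<theta> x)"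

definition id_nat :: "('o, 'a) cat \<Rightarrow> ('p, 'b) cat \<Rightarrow> ('o, 'a, 'p, 'b) ftr \<Rightarrow> 'o \<Rightarrow> 'b" where
  "id_nat C D F = (\<lambda>x\<in>Obj C. Idn D (FOb F x))"

definition comp_nat ::
  "('o, 'a) cat \<Rightarrow> ('p, 'b) cat \<Rightarrow> ('o \<Rightarrow> 'b) \<Rightarrow> ('o \<Rightarrow> 'b) \<Rightarrow> 'o \<Rightarrow> 'b" where
  "comp_nat C D \<tau> \<sigma> = (\<lambda>x\<in>Obj C. Comp D (\<tau> x) (\<sigma> x))"

definition functor_cat :: "('o, 'a) cat \<Rightarrow> ('p, 'b) cat \<Rightarrow>
    (('o, 'a, 'p, 'b) ftr,
     ('o, 'a, 'p, 'b) ftr \<times> ('o, 'a, 'p, 'b) ftr \<times> ('o \<Rightarrow> 'b)) cat" where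
  "functor_cat C D =
     \<lparr>Obj = {F. cat_functor C D F},
      Arr = {(F, G, \<theta>). nat_trans C D F G \<theta>},
      Dom = (\<lambda>(F, G, \<theta>). F),
      Cod = (\<lambda>(F, G, \<theta>). G),
      Idn = (\<lambda>F. (F, F, id_nat C D F)),
      Comp = (\<lambda>(G, H, \<tau>) (F, G', \<sigma>). (F, H, comp_nat C D \<tau> \<sigma>))\<rparr>"

definition nat_isomorphic ::
  "('o, 'a) cat \<Rightarrow> ('p, 'b) cat \<Rightarrow> ('o, 'a, 'p, 'b) ftr \<Rightarrow> ('o, 'a, 'p, 'b) ftr \<Rightarrow> bool" where
  "nat_isomorphic C D F G \<longleftrightarrow>
     (\<exists>\<theta>. nat_trans C D F G \<theta> \<and> (\<forall>x\<in>Obj C. is_iso D (\<theta> x)))"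

definition equivalent_categories :: "('o, 'a) cat \<Rightarrow> ('p, 'b) cat \<Rightarrow> bool" where
  "equivalent_categories C D \<longleftrightarrow>
     (\<exists>F G. cat_functor C D F \<and> cat_functor D C G \<and>
        nat_isomorphic C C (comp_ftr C G F) (id_ftr C) \<and>
        nat_isomorphic D D (comp_ftr D F G) (id_ftr D))"


section \<open>Finite limits\<close>

definition is_cone ::
  "('i, 'k) cat \<Rightarrow> ('o, 'a) cat \<Rightarrow> ('i, 'k, 'o, 'a) ftr \<Rightarrow> 'o \<Rightarrow> ('i \<Rightarrow> 'a) \<Rightarrow> bool" where
  "is_cone I C D x p \<longleftrightarrow> x \<in> Obj C \<and> p \<in> extensional (Obj I) \<and>
     (\<forall>i\<in>Obj I. p i \<in> hom C x (FOb D i)) \<and>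
     (\<forall>u\<in>Arr I. Comp C (FAr D u) (p (Dom I u)) = p (Cod I u))"

definition is_limit_cone ::
  "('i, 'k) cat \<Rightarrow> ('o, 'a) cat \<Rightarrow> ('i, 'k, 'o, 'a) ftr \<Rightarrow> 'o \<Rightarrow> ('i \<Rightarrow> 'a) \<Rightarrow> bool" where
  "is_limit_cone I C D x p \<longleftrightarrow> is_cone I C D x p \<and>
     (\<forall>y q. is_cone I C D y q \<longrightarrow> (\<exists>!h. h \<in> hom C y x \<and> (\<forall>i\<in>Obj I. Comp C (p i) h = q i)))"

text \<open>Every finite category is isomorphic to one whose objects and arrows are natural numbers.\<close>

definition preserves_finite_limits ::
  "('o, 'a) cat \<Rightarrow> ('p, 'b) cat \<Rightarrow> ('o, 'a, 'p, 'b) ftr \<Rightarrow> bool" where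
  "preserves_finite_limits C D F \<longleftrightarrow>
     (\<forall>(I :: (nat, nat) cat) K x p.
        category I \<and> finite (Obj I) \<and> finite (Arr I) \<and> cat_functor I C K \<and>
        is_limit_cone I C K x p \<longrightarrow>
        is_limit_cone I D (comp_ftr I F K) (FOb F x) (\<lambda>i\<in>Obj I. FAr F (p i)))"


section \<open>Small sets and Grothendieck toposes\<close>

text \<open>
  A type \<open>'u\<close> plays the role of a Grothendieck universe: small sets are, up to bijection,
  the subsets of \<open>'u\<close> of cardinality strictly less than that of \<open>'u\<close>. As in SGA 4, the
  countable universe is not excluded.
\<close>

definition small :: "'u set \<Rightarrow> bool" where
  "small A \<longleftrightarrow> A \<prec> (UNIV :: 'u set)"

definition universe :: "'u itself \<Rightarrow> bool" where
  "universe (_ :: 'u itself) \<longleftrightarrow>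
     infinite (UNIV :: 'u set) \<and>
     (\<forall>A :: 'u set. small A \<longrightarrow> Pow A \<prec> (UNIV :: 'u set)) \<and>
     (\<forall>(I :: 'u set) (A :: 'u \<Rightarrow> 'u set).
        small I \<and> (\<forall>i\<in>I. small (A i)) \<longrightarrow> small (\<Union>i\<in>I. A i))"

definition Set_cat :: "('u set, 'u set \<times> 'u set \<times> ('u \<Rightarrow> 'u)) cat" where
  "Set_cat =
     \<lparr>Obj = {A. small A},
      Arr = {(A, B, f). small A \<and> small B \<and> f \<in> A \<rightarrow>\<^sub>E B},
      Dom = (\<lambda>(A, B, f). A),
      Cod = (\<lambda>(A, B, f). B),
      Idn = (\<lambda>A. (A, A, \<lambda>a\<in>A. a)),
      Comp = (\<lambda>(B, D, g) (A, B', f). (A, D, \<lambda>a\<in>A. g (f a)))\<rparr>"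

definition is_sieve :: "('o, 'a) cat \<Rightarrow> 'o \<Rightarrow> 'a set \<Rightarrow> bool" where
  "is_sieve C c S \<longleftrightarrow> S \<subseteq> {f \<in> Arr C. Cod C f = c} \<and>
     (\<forall>f\<in>S. \<forall>g\<in>Arr C. Cod C g = Dom C f \<longrightarrow> Comp C f g \<in> S)"

definition pullback_sieve :: "('o, 'a) cat \<Rightarrow> 'a \<Rightarrow> 'a set \<Rightarrow> 'a set" where
  "pullback_sieve C h S = {g \<in> Arr C. Cod C g = Dom C h \<and> Comp C h g \<in> S}"

definition grothendieck_topology :: "('o, 'a) cat \<Rightarrow> ('o \<Rightarrow> 'a set set) \<Rightarrow> bool" where
  "grothendieck_topology C J \<longleftrightarrow>
     (\<forall>c\<in>Obj C. \<forall>S\<in>J c. is_sieve C c S) \<and>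
     (\<forall>c\<in>Obj C. {f \<in> Arr C. Cod C f = c} \<in> J c) \<and>
     (\<forall>h\<in>Arr C. \<forall>S\<in>J (Cod C h). pullback_sieve C h S \<in> J (Dom C h)) \<and>
     (\<forall>c\<in>Obj C. \<forall>S\<in>J c. \<forall>R. is_sieve C c R \<and> (\<forall>h\<in>S. pullback_sieve C h R \<in> J (Dom C h))
        \<longrightarrow> R \<in> J c)"

definition small_site :: "('u, 'u) cat \<Rightarrow> ('u \<Rightarrow> 'u set set) \<Rightarrow> bool" where
  "small_site C J \<longleftrightarrow>
     category C \<and> small (Obj C) \<and> small (Arr C) \<and> grothendieck_topology C J"

text \<open>The action \<open>P(f) : P(c) \<rightarrow> P(d)\<close> of a presheaf on an arrow \<open>f : d \<rightarrow> c\<close>.\<close>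

definition restr ::
  "('u, 'u, 'u set, 'u set \<times> 'u set \<times> ('u \<Rightarrow> 'u)) ftr \<Rightarrow> 'u \<Rightarrow> 'u \<Rightarrow> 'u" where
  "restr P f = snd (snd (FAr P f))"

definition is_sheaf :: "('u, 'u) cat \<Rightarrow> ('u \<Rightarrow> 'u set set) \<Rightarrow>
    ('u, 'u, 'u set, 'u set \<times> 'u set \<times> ('u \<Rightarrow> 'u)) ftr \<Rightarrow> bool" where
  "is_sheaf C J P \<longleftrightarrow> cat_functor (op_cat C) Set_cat P \<and>
     (\<forall>c\<in>Obj C. \<forall>S\<in>J c. \<forall>x :: 'u \<Rightarrow> 'u.
        (\<forall>f\<in>S. x f \<in> FOb P (Dom C f)) \<and>
        (\<forall>f\<in>S. \<forall>g\<in>Arr C. Cod C g = Dom C f \<longrightarrow> restr P g (x f) = x (Comp C f g)) \<longrightarrow>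
        (\<exists>!y. y \<in> FOb P c \<and> (\<forall>f\<in>S. restr P f y = x f)))"

definition sheaf_cat :: "('u, 'u) cat \<Rightarrow> ('u \<Rightarrow> 'u set set) \<Rightarrow>
    (('u, 'u, 'u set, 'u set \<times> 'u set \<times> ('u \<Rightarrow> 'u)) ftr,
     ('u, 'u, 'u set, 'u set \<times> 'u set \<times> ('u \<Rightarrow> 'u)) ftr \<times>
     ('u, 'u, 'u set, 'u set \<times> 'u set \<times> ('u \<Rightarrow> 'u)) ftr \<times>
     ('u \<Rightarrow> 'u set \<times> 'u set \<times> ('u \<Rightarrow> 'u))) cat" where
  "sheaf_cat C J = full_subcat (functor_cat (op_cat C) Set_cat) {P. is_sheaf C J P}"

definition grothendieck_topos :: "'u itself \<Rightarrow> ('o, 'a) cat \<Rightarrow> bool" where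
  "grothendieck_topos (_ :: 'u itself) E \<longleftrightarrow> category E \<and>
     (\<exists>(C :: ('u, 'u) cat) J. small_site C J \<and> equivalent_categories E (sheaf_cat C J))"


section \<open>Weak geometric morphisms\<close>

text \<open>
  A weak morphism \<open>a : E \<rightarrow> E'\<close> is an adjunction \<open>inv_im a \<stileturn> dir_im a\<close>, given by its unit
  and counit, with \<open>inv_im a : E' \<rightarrow> E\<close> and \<open>dir_im a : E \<rightarrow> E'\<close>.
\<close>

record ('o, 'a, 'p, 'b) wgm =
  inv_im :: "('p, 'b, 'o, 'a) ftr"
  dir_im :: "('o, 'a, 'p, 'b) ftr"
  adj_unit :: "'p \<Rightarrow> 'b"
  adj_counit :: "'o \<Rightarrow> 'a"

definition weak_geometric_morphism ::
  "('o, 'a) cat \<Rightarrow> ('p, 'b) cat \<Rightarrow> ('o, 'a, 'p, 'b) wgm \<Rightarrow> bool" where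
  "weak_geometric_morphism E E' a \<longleftrightarrow>
     cat_functor E' E (inv_im a) \<and> cat_functor E E' (dir_im a) \<and>
     nat_trans E' E' (id_ftr E') (comp_ftr E' (dir_im a) (inv_im a)) (adj_unit a) \<and>
     nat_trans E E (comp_ftr E (inv_im a) (dir_im a)) (id_ftr E) (adj_counit a) \<and>
     (\<forall>x\<in>Obj E'. Comp E (adj_counit a (FOb (inv_im a) x)) (FAr (inv_im a) (adj_unit a x))
        = Idn E (FOb (inv_im a) x)) \<and>
     (\<forall>y\<in>Obj E. Comp E' (FAr (dir_im a) (adj_counit a y)) (adj_unit a (FOb (dir_im a) y))
        = Idn E' (FOb (dir_im a) y))"

definition geometric_morphism ::
  "('o, 'a) cat \<Rightarrow> ('p, 'b) cat \<Rightarrow> ('o, 'a, 'p, 'b) wgm \<Rightarrow> bool" where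
  "geometric_morphism E F f \<longleftrightarrow>
     weak_geometric_morphism E F f \<and> preserves_finite_limits F E (inv_im f)"

text \<open>
  \<open>LaxWmor E E' F f f'\<close> is the category \<open>LaxWmor([f],[f'])\<close> for \<open>f : E \<rightarrow> F\<close> and
  \<open>f' : E' \<rightarrow> F\<close>. Its arrows carry their source and target.
\<close>

type_synonym ('o, 'a, 'p, 'b, 'q) lax_obj = "('o, 'a, 'p, 'b) wgm \<times> ('q \<Rightarrow> 'a)"

definition lax_wmor_obj ::
  "('o, 'a) cat \<Rightarrow> ('p, 'b) cat \<Rightarrow> ('q, 'c) cat \<Rightarrow>
   ('o, 'a, 'q, 'c) wgm \<Rightarrow> ('p, 'b, 'q, 'c) wgm \<Rightarrow> ('o, 'a, 'p, 'b, 'q) lax_obj \<Rightarrow> bool" where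
  "lax_wmor_obj E E' F f f' = (\<lambda>(a, \<phi>).
     weak_geometric_morphism E E' a \<and>
     nat_trans F E (comp_ftr F (inv_im a) (inv_im f')) (inv_im f) \<phi>)"

definition LaxWmor ::
  "('o, 'a) cat \<Rightarrow> ('p, 'b) cat \<Rightarrow> ('q, 'c) cat \<Rightarrow>
   ('o, 'a, 'q, 'c) wgm \<Rightarrow> ('p, 'b, 'q, 'c) wgm \<Rightarrow>
   (('o, 'a, 'p, 'b, 'q) lax_obj,
    ('o, 'a, 'p, 'b, 'q) lax_obj \<times> ('o, 'a, 'p, 'b, 'q) lax_obj \<times> ('p \<Rightarrow> 'a)) cat" where
  "LaxWmor E E' F f f' =
     \<lparr>Obj = {u. lax_wmor_obj E E' F f f' u},
      Arr = {((a, \<phi>), (b, \<psi>), \<theta>).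
        lax_wmor_obj E E' F f f' (a, \<phi>) \<and> lax_wmor_obj E E' F f f' (b, \<psi>) \<and>
        nat_trans E' E (inv_im a) (inv_im b) \<theta> \<and>
        (\<forall>X\<in>Obj F. Comp E (\<psi> X) (\<theta> (FOb (inv_im f') X)) = \<phi> X)},
      Dom = (\<lambda>(u, v, \<theta>). u),
      Cod = (\<lambda>(u, v, \<theta>). v),
      Idn = (\<lambda>u. (u, u, id_nat E' E (inv_im (fst u)))),
      Comp = (\<lambda>(v, w, \<tau>) (u, v', \<sigma>). (u, w, comp_nat E' E \<tau> \<sigma>))\<rparr>"


section \<open>The canonical stack and morphisms of opfibrations\<close>

text \<open>An arrow \<open>(x, y, h)\<close> of the slice \<open>E/X\<close> is \<open>h\<close> with \<open>y \<circ> h = x\<close>.\<close>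

definition slice_cat :: "('o, 'a) cat \<Rightarrow> 'o \<Rightarrow> ('a, 'a \<times> 'a \<times> 'a) cat" where
  "slice_cat E X =
     \<lparr>Obj = {x \<in> Arr E. Cod E x = X},
      Arr = {(x, y, h). x \<in> Arr E \<and> Cod E x = X \<and> y \<in> Arr E \<and> Cod E y = X \<and>
        h \<in> hom E (Dom E x) (Dom E y) \<and> Comp E y h = x},
      Dom = (\<lambda>(x, y, h). x),
      Cod = (\<lambda>(x, y, h). y),
      Idn = (\<lambda>x. (x, x, Idn E (Dom E x))),
      Comp = (\<lambda>(y, z, k) (x, y', h). (x, z, Comp E k h))\<rparr>"

text \<open>
  The total category of \<open>S\<^sub>f\<close>: an arrow \<open>(A, x) \<rightarrow> (B, y)\<close> over \<open>g : A \<rightarrow> B\<close> is an arrow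
  \<open>\<Sigma>\<^sub>g x \<rightarrow> y\<close> of \<open>E/f\<^sup>*B\<close>, where \<open>\<Sigma>\<^sub>g x = f\<^sup>*g \<circ> x\<close>; equivalently, an arrow from \<open>x\<close> to the
  pullback of \<open>y\<close> along \<open>f\<^sup>*g\<close> in \<open>E/f\<^sup>*A\<close>.
\<close>

type_synonym ('q, 'a) stack_obj = "'q \<times> 'a"
type_synonym ('q, 'a, 'c) stack_arr =
  "('q, 'a) stack_obj \<times> ('q, 'a) stack_obj \<times> ('c \<times> 'a)"

definition stack_objs ::
  "('o, 'a) cat \<Rightarrow> ('q, 'c) cat \<Rightarrow> ('o, 'a, 'q, 'c) wgm \<Rightarrow> ('q, 'a) stack_obj set" where
  "stack_objs E F f = {(A, x). A \<in> Obj F \<and> x \<in> Arr E \<and> Cod E x = FOb (inv_im f) A}"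

definition canonical_stack ::
  "('o, 'a) cat \<Rightarrow> ('q, 'c) cat \<Rightarrow> ('o, 'a, 'q, 'c) wgm \<Rightarrow>
   (('q, 'a) stack_obj, ('q, 'a, 'c) stack_arr) cat" where
  "canonical_stack E F f =
     \<lparr>Obj = stack_objs E F f,
      Arr = {((A, x), (B, y), (g, h)).
        (A, x) \<in> stack_objs E F f \<and> (B, y) \<in> stack_objs E F f \<and>
        g \<in> hom F A B \<and> h \<in> hom E (Dom E x) (Dom E y) \<and>
        Comp E y h = Comp E (FAr (inv_im f) g) x},
      Dom = (\<lambda>(u, v, gh). u),
      Cod = (\<lambda>(u, v, gh). v),
      Idn = (\<lambda>(A, x). ((A, x), (A, x), (Idn F A, Idn E (Dom E x)))),
      Comp = (\<lambda>(v, w, (g', h')) (u, v', (g, h)). (u, w, (Comp F g' g, Comp E h' h)))\<rparr>"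

definition stack_proj ::
  "('o, 'a) cat \<Rightarrow> ('q, 'c) cat \<Rightarrow> ('o, 'a, 'q, 'c) wgm \<Rightarrow>
   (('q, 'a) stack_obj, ('q, 'a, 'c) stack_arr, 'q, 'c) ftr" where
  "stack_proj E F f =
     \<lparr>FOb = (\<lambda>u\<in>Obj (canonical_stack E F f). fst u),
      FAr = (\<lambda>(u, v, (g, h))\<in>Arr (canonical_stack E F f). g)\<rparr>"

definition cocartesian ::
  "('o, 'a) cat \<Rightarrow> ('q, 'c) cat \<Rightarrow> ('o, 'a, 'q, 'c) ftr \<Rightarrow> 'a \<Rightarrow> bool" where
  "cocartesian P B p u \<longleftrightarrow> u \<in> Arr P \<and>
     (\<forall>w\<in>Arr P. \<forall>k\<in>Arr B. Dom P w = Dom P u \<and>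
        k \<in> hom B (FOb p (Cod P u)) (FOb p (Cod P w)) \<and>
        Comp B k (FAr p u) = FAr p w \<longrightarrow>
        (\<exists>!v. v \<in> hom P (Cod P u) (Cod P w) \<and> FAr p v = k \<and> Comp P v u = w))"

definition opfibration_morphism ::
  "('o, 'a) cat \<Rightarrow> ('p, 'b) cat \<Rightarrow> ('q, 'c) cat \<Rightarrow>
   ('o, 'a, 'q, 'c) ftr \<Rightarrow> ('p, 'b, 'q, 'c) ftr \<Rightarrow> ('o, 'a, 'p, 'b) ftr \<Rightarrow> bool" where
  "opfibration_morphism P Q B p q T \<longleftrightarrow>
     cat_functor P Q T \<and> comp_ftr P q T = p \<and>
     (\<forall>u. cocartesian P B p u \<longrightarrow> cocartesian Q B q (FAr T u))"

text \<open>
  The component \<open>E'/f'\<^sup>*A \<rightarrow> E/f\<^sup>*A\<close> at \<open>A\<close> of a functor \<open>T : S\<^bsub>f'\<^esub> \<rightarrow> S\<^sub>f\<close> over \<open>F\<close>.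
\<close>

definition fibre_component ::
  "('p, 'b) cat \<Rightarrow> ('q, 'c) cat \<Rightarrow> ('p, 'b, 'q, 'c) wgm \<Rightarrow>
   (('q, 'b) stack_obj, ('q, 'b, 'c) stack_arr,
    ('q, 'a) stack_obj, ('q, 'a, 'c) stack_arr) ftr \<Rightarrow> 'q \<Rightarrow>
   ('b, 'b \<times> 'b \<times> 'b, 'a, 'a \<times> 'a \<times> 'a) ftr" where
  "fibre_component E' F f' T A =
     \<lparr>FOb = (\<lambda>x\<in>Obj (slice_cat E' (FOb (inv_im f') A)). snd (FOb T (A, x))),
      FAr = (\<lambda>(x, y, h)\<in>Arr (slice_cat E' (FOb (inv_im f') A)).
        (snd (FOb T (A, x)), snd (FOb T (A, y)),
         snd (snd (snd (FAr T ((A, x), (A, y), (Idn F A, h)))))))\<rparr>"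

text \<open>
  An object of \<open>OpfibWeak(S\<^bsub>f'\<^esub>, S\<^sub>f)\<close> is a pair \<open>(a, T)\<close>: \<open>a\<close> is the family of adjunctions
  between the slices, and \<open>T\<close> is the morphism of opfibrations whose components are the left
  adjoints.
\<close>

type_synonym ('a, 'b, 'q, 'c) opfib_obj =
  "('q \<Rightarrow> ('a, 'a \<times> 'a \<times> 'a, 'b, 'b \<times> 'b \<times> 'b) wgm) \<times>
   (('q, 'b) stack_obj, ('q, 'b, 'c) stack_arr,
    ('q, 'a) stack_obj, ('q, 'a, 'c) stack_arr) ftr"

definition opfib_weak_obj ::
  "('o, 'a) cat \<Rightarrow> ('p, 'b) cat \<Rightarrow> ('q, 'c) cat \<Rightarrow>
   ('o, 'a, 'q, 'c) wgm \<Rightarrow> ('p, 'b, 'q, 'c) wgm \<Rightarrow> ('a, 'b, 'q, 'c) opfib_obj \<Rightarrow> bool" where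
  "opfib_weak_obj E E' F f f' = (\<lambda>(a, T).
     opfibration_morphism (canonical_stack E' F f') (canonical_stack E F f) F
       (stack_proj E' F f') (stack_proj E F f) T \<and>
     a \<in> extensional (Obj F) \<and>
     (\<forall>A\<in>Obj F.
        weak_geometric_morphism (slice_cat E (FOb (inv_im f) A))
          (slice_cat E' (FOb (inv_im f') A)) (a A) \<and>
        inv_im (a A) = fibre_component E' F f' T A))"

definition OpfibWeak ::
  "('o, 'a) cat \<Rightarrow> ('p, 'b) cat \<Rightarrow> ('q, 'c) cat \<Rightarrow>
   ('o, 'a, 'q, 'c) wgm \<Rightarrow> ('p, 'b, 'q, 'c) wgm \<Rightarrow>
   (('a, 'b, 'q, 'c) opfib_obj,
    ('a, 'b, 'q, 'c) opfib_obj \<times> ('a, 'b, 'q, 'c) opfib_obj \<times>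
    (('q, 'b) stack_obj \<Rightarrow> ('q, 'a, 'c) stack_arr)) cat" where
  "OpfibWeak E E' F f f' =
     \<lparr>Obj = {u. opfib_weak_obj E E' F f f' u},
      Arr = {((a, T), (b, U), \<theta>).
        opfib_weak_obj E E' F f f' (a, T) \<and> opfib_weak_obj E E' F f f' (b, U) \<and>
        nat_trans (canonical_stack E' F f') (canonical_stack E F f) T U \<theta> \<and>
        (\<forall>s\<in>Obj (canonical_stack E' F f').
           FAr (stack_proj E F f) (\<theta> s) = Idn F (FOb (stack_proj E' F f') s))},
      Dom = (\<lambda>(u, v, \<theta>). u),
      Cod = (\<lambda>(u, v, \<theta>). v),
      Idn = (\<lambda>u. (u, u, id_nat (canonical_stack E' F f') (canonical_stack E F f) (snd u))),
      Comp = (\<lambda>(v, w, \<tau>) (u, v', \<sigma>).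
        (u, w, comp_nat (canonical_stack E' F f') (canonical_stack E F f) \<tau> \<sigma>))\<rparr>"

end

theory Submission
  imports Defs
begin

text \<open>
  Fix a terminal object \<open>1\<close> of \<open>F\<close>. A pair \<open>(a, \<phi>)\<close> acts on the total categories by
  \<open>T(A, x : X \<rightarrow> f'\<^sup>*A) = (A, \<phi>\<^sub>A \<circ> a\<^sup>*x)\<close> and \<open>T(g, h) = (g, a\<^sup>*h)\<close>, and a transformation
  \<open>\<theta>\<close> of the inverse images acts by \<open>(id, \<theta>\<^sub>X)\<close>. This is a functor from \<open>LaxWmor\<close> to
  \<open>OpfibWeak\<close>, and the theorem holds because it is full, faithful and essentially surjective.

  The key fact is that an arrow \<open>(g, h)\<close> of a canonical stack is cocartesian exactly when \<open>h\<close> is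
  invertible (\<open>cocartesian_iff_is_iso\<close>). Hence \<open>T\<close> is a morphism of opfibrations. Its component
  over \<open>A\<close> has a right adjoint, which sends \<open>y : Y \<rightarrow> f\<^sup>*A\<close> to the pullback of \<open>a\<^sub>*y\<close> along the
  transpose \<open>f'\<^sup>*A \<rightarrow> a\<^sub>*f\<^sup>*A\<close> of \<open>\<phi>\<^sub>A\<close> (\<open>fibre_component_T_couniversal\<close>).

  Conversely, the fibres over \<open>1\<close> are \<open>E'\<close> and \<open>E\<close> themselves, since inverse images preserve the
  terminal object, and every object \<open>(A, x)\<close> has the cocartesian arrow \<open>(!, id)\<close> to \<open>(1, X \<rightarrow> 1)\<close>.
  So everything is determined over \<open>1\<close>. A vertical transformation is determined by its components
  there (\<open>lax_to_opfib_full\<close>). A morphism of opfibrations \<open>T\<close> restricts there to a functor \<open>a\<^sup>*\<close>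
  with a right adjoint, and gives isomorphisms from the domain of \<open>T(A, x)\<close> to \<open>a\<^sup>*X\<close>; carrying
  \<open>T(A, id)\<close> along them yields \<open>\<phi>\<^sub>A : a\<^sup>*f'\<^sup>*A \<rightarrow> f\<^sup>*A\<close>. Applying \<open>T\<close> to the arrow
  \<open>(id, x) : (A, x) \<rightarrow> (A, id)\<close> shows that \<open>T\<close> is isomorphic to the functor made from \<open>(a, \<phi>)\<close>
  (\<open>lax_to_opfib_essentially_surjective\<close>).

  Pullbacks and terminal objects of a topos are computed pointwise in sheaves and carried along the
  equivalence with the sheaf category (\<open>topos_finite_limits\<close>). Adjunctions are handled as families
  of couniversal arrows, which makes them easy to build and to restrict.
\<close>

section \<open>Categories and functors\<close>

lemma hom_iff: "f \<in> hom C x y \<longleftrightarrow> f \<in> Arr C \<and> Dom C f = x \<and> Cod C f = y"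
  by (simp add: hom_def)

context category
begin

lemma Dom_in_Obj [simp]: "f \<in> Arr C \<Longrightarrow> Dom C f \<in> Obj C"
  by (rule Dom_Obj)

lemma Cod_in_Obj [simp]: "f \<in> Arr C \<Longrightarrow> Cod C f \<in> Obj C"
  by (rule Cod_Obj)

lemma Idn_simps [simp]:
  assumes "x \<in> Obj C"
  shows "Idn C x \<in> Arr C" "Dom C (Idn C x) = x" "Cod C (Idn C x) = x"
  using Idn_hom[OF assms] by (auto simp: hom_iff)

lemma Comp_simps [simp]:
  assumes "f \<in> Arr C" "g \<in> Arr C" "Dom C g = Cod C f"
  shows "Comp C g f \<in> Arr C" "Dom C (Comp C g f) = Dom C f" "Cod C (Comp C g f) = Cod C g"
  using Comp_hom[of f "Dom C f" "Cod C f" g "Cod C g"] assms by (auto simp: hom_iff)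

lemma Comp_Idn_simps [simp]:
  "f \<in> Arr C \<Longrightarrow> Dom C f = x \<Longrightarrow> Comp C f (Idn C x) = f"
  "f \<in> Arr C \<Longrightarrow> Cod C f = x \<Longrightarrow> Comp C (Idn C x) f = f"
  using Comp_Idn_right[of f x "Cod C f"] Comp_Idn_left[of f "Dom C f" x] by (auto simp: hom_iff)

lemma assoc [simp]:
  assumes "f \<in> Arr C" "g \<in> Arr C" "h \<in> Arr C" "Dom C g = Cod C f" "Dom C h = Cod C g"
  shows "Comp C (Comp C h g) f = Comp C h (Comp C g f)"
  using Comp_assoc[of f "Dom C f" "Cod C f" g "Cod C g" h "Cod C h"] assms by (auto simp: hom_iff)

text \<open>Simplification nests composites to the right, so an equation between composites of two
  arrows no longer matches at the left end of a longer composite; this rule applies it there.\<close>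

lemma Comp_eq_whisker:
  assumes "Comp C g f = Comp C g' f'" "f \<in> Arr C" "g \<in> Arr C" "Dom C g = Cod C f"
    "f' \<in> Arr C" "g' \<in> Arr C" "Dom C g' = Cod C f'" "k \<in> Arr C"
    "Cod C k = Dom C f" "Cod C k = Dom C f'"
  shows "Comp C g (Comp C f k) = Comp C g' (Comp C f' k)"
  using assms by (metis assoc)

end

lemma categoryI:
  assumes "\<And>f. f \<in> Arr C \<Longrightarrow> Dom C f \<in> Obj C \<and> Cod C f \<in> Obj C"
    and "\<And>x. x \<in> Obj C \<Longrightarrow> Idn C x \<in> Arr C \<and> Dom C (Idn C x) = x \<and> Cod C (Idn C x) = x"
    and "\<And>f g. f \<in> Arr C \<Longrightarrow> g \<in> Arr C \<Longrightarrow> Dom C g = Cod C f \<Longrightarrow>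
      Comp C g f \<in> Arr C \<and> Dom C (Comp C g f) = Dom C f \<and> Cod C (Comp C g f) = Cod C g"
    and "\<And>f. f \<in> Arr C \<Longrightarrow>
      Comp C f (Idn C (Dom C f)) = f \<and> Comp C (Idn C (Cod C f)) f = f"
    and "\<And>f g h. f \<in> Arr C \<Longrightarrow> g \<in> Arr C \<Longrightarrow> h \<in> Arr C \<Longrightarrow> Dom C g = Cod C f \<Longrightarrow>
      Dom C h = Cod C g \<Longrightarrow> Comp C h (Comp C g f) = Comp C (Comp C h g) f"
  shows "category C"
  by unfold_locales (use assms in \<open>auto simp: hom_iff\<close>)

context cat_functor
begin

lemma FOb_in_Obj [simp]: "x \<in> Obj C \<Longrightarrow> FOb F x \<in> Obj D"
  by (rule FOb_Obj)

lemma FAr_simps [simp]: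
  assumes "f \<in> Arr C"
  shows "FAr F f \<in> Arr D" "Dom D (FAr F f) = FOb F (Dom C f)" "Cod D (FAr F f) = FOb F (Cod C f)"
  using FAr_hom[of f "Dom C f" "Cod C f"] assms by (auto simp: hom_iff)

lemma FAr_Idn_simp [simp]: "x \<in> Obj C \<Longrightarrow> FAr F (Idn C x) = Idn D (FOb F x)"
  by (rule FAr_Idn)

lemma FAr_Comp_simp:
  "f \<in> Arr C \<Longrightarrow> g \<in> Arr C \<Longrightarrow> Dom C g = Cod C f \<Longrightarrow>
    FAr F (Comp C g f) = Comp D (FAr F g) (FAr F f)"
  using FAr_Comp[of f "Dom C f" "Cod C f" g "Cod C g"] by (auto simp: hom_iff)

end

lemma cat_functorI:
  assumes "category C" "category D"
    and "FOb F \<in> extensional (Obj C)" "FAr F \<in> extensional (Arr C)"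
    and "\<And>x. x \<in> Obj C \<Longrightarrow> FOb F x \<in> Obj D"
    and "\<And>f. f \<in> Arr C \<Longrightarrow> FAr F f \<in> Arr D \<and> Dom D (FAr F f) = FOb F (Dom C f) \<and>
      Cod D (FAr F f) = FOb F (Cod C f)"
    and "\<And>x. x \<in> Obj C \<Longrightarrow> FAr F (Idn C x) = Idn D (FOb F x)"
    and "\<And>f g. f \<in> Arr C \<Longrightarrow> g \<in> Arr C \<Longrightarrow> Dom C g = Cod C f \<Longrightarrow>
      FAr F (Comp C g f) = Comp D (FAr F g) (FAr F f)"
  shows "cat_functor C D F"
  using assms by (auto simp: cat_functor_def cat_functor_axioms_def hom_iff)

context nat_trans
begin

lemma component_simps [simp]:
  assumes "x \<in> Obj C"
  shows "\<theta> x \<in> Arr D" "Dom D (\<theta> x) = FOb F x" "Cod D (\<theta> x) = FOb G x"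
  using component[OF assms] by (auto simp: hom_iff)

lemma naturality_Arr:
  "f \<in> Arr C \<Longrightarrow> Comp D (\<theta> (Cod C f)) (FAr F f) = Comp D (FAr G f) (\<theta> (Dom C f))"
  using naturality[of f "Dom C f" "Cod C f"] by (simp add: hom_iff)

end

lemma nat_transI:
  assumes "cat_functor C D F" "cat_functor C D G" "\<theta> \<in> extensional (Obj C)"
    and "\<And>x. x \<in> Obj C \<Longrightarrow> \<theta> x \<in> Arr D \<and> Dom D (\<theta> x) = FOb F x \<and> Cod D (\<theta> x) = FOb G x"
    and "\<And>f. f \<in> Arr C \<Longrightarrow>
      Comp D (\<theta> (Cod C f)) (FAr F f) = Comp D (FAr G f) (\<theta> (Dom C f))"
  shows "nat_trans C D F G \<theta>"
  using assms by (auto simp: nat_trans_def nat_trans_axioms_def hom_iff)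

lemma id_ftr_functor: "category C \<Longrightarrow> cat_functor C C (id_ftr C)"
  by (rule cat_functorI) (auto simp: id_ftr_def category.Comp_simps category.Idn_simps
      category.Dom_in_Obj category.Cod_in_Obj)

lemma id_ftr_simps [simp]:
  "x \<in> Obj C \<Longrightarrow> FOb (id_ftr C) x = x" "f \<in> Arr C \<Longrightarrow> FAr (id_ftr C) f = f"
  by (auto simp: id_ftr_def)

lemma comp_ftr_simps [simp]:
  "x \<in> Obj C \<Longrightarrow> FOb (comp_ftr C G F) x = FOb G (FOb F x)"
  "f \<in> Arr C \<Longrightarrow> FAr (comp_ftr C G F) f = FAr G (FAr F f)"
  by (auto simp: comp_ftr_def)

lemma comp_ftr_functor:
  assumes "cat_functor C D F" "cat_functor D B G"
  shows "cat_functor C B (comp_ftr C G F)"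
proof -
  interpret F: cat_functor C D F by fact
  interpret G: cat_functor D B G by fact
  show ?thesis
    by (rule cat_functorI)
      (auto simp: F.source.category_axioms G.target.category_axioms comp_ftr_def
        F.FAr_Comp_simp G.FAr_Comp_simp)
qed

lemma id_nat_trans: "cat_functor C D F \<Longrightarrow> nat_trans C D F F (id_nat C D F)"
proof -
  assume F: "cat_functor C D F"
  then interpret cat_functor C D F .
  show ?thesis by (rule nat_transI) (auto simp: F id_nat_def)
qed

lemma comp_nat_trans:
  assumes "nat_trans C D F G \<sigma>" "nat_trans C D G H \<tau>"
  shows "nat_trans C D F H (comp_nat C D \<tau> \<sigma>)"
proof -
  interpret s: nat_trans C D F G \<sigma> by fact
  interpret t: nat_trans C D G H \<tau> by fact
  show ?thesis
  proof (rule nat_transI)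
    fix f assume f: "f \<in> Arr C"
    have "Comp D (Comp D (\<tau> (Cod C f)) (\<sigma> (Cod C f))) (FAr F f)
        = Comp D (\<tau> (Cod C f)) (Comp D (FAr G f) (\<sigma> (Dom C f)))"
      using f s.naturality_Arr[OF f] by simp
    also have "\<dots> = Comp D (FAr H f) (Comp D (\<tau> (Dom C f)) (\<sigma> (Dom C f)))"
      using f t.naturality_Arr[OF f] by (auto intro: s.F.target.Comp_eq_whisker)
    finally show "Comp D (comp_nat C D \<tau> \<sigma> (Cod C f)) (FAr F f)
        = Comp D (FAr H f) (comp_nat C D \<tau> \<sigma> (Dom C f))"
      using f by (simp add: comp_nat_def)
  qed (auto simp: comp_nat_def s.F.cat_functor_axioms t.G.cat_functor_axioms)
qed

lemma comp_nat_units: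
  assumes "nat_trans C D F G \<theta>"
  shows "comp_nat C D \<theta> (id_nat C D F) = \<theta>" "comp_nat C D (id_nat C D G) \<theta> = \<theta>"
proof -
  interpret nat_trans C D F G \<theta> by fact
  show "comp_nat C D \<theta> (id_nat C D F) = \<theta>" "comp_nat C D (id_nat C D G) \<theta> = \<theta>"
    by (rule extensionalityI[OF _ ext]; simp add: comp_nat_def id_nat_def)+
qed

lemma comp_nat_assoc:
  assumes "nat_trans C D F G \<rho>" "nat_trans C D G H \<sigma>" "nat_trans C D H K \<tau>"
  shows "comp_nat C D \<tau> (comp_nat C D \<sigma> \<rho>) = comp_nat C D (comp_nat C D \<tau> \<sigma>) \<rho>"
proof -
  interpret r: nat_trans C D F G \<rho> by fact
  interpret s: nat_trans C D G H \<sigma> by fact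
  interpret t: nat_trans C D H K \<tau> by fact
  show ?thesis by (auto simp: comp_nat_def fun_eq_iff restrict_def)
qed


section \<open>Isomorphisms and equivalences of categories\<close>

context category
begin

definition "inverse_arr f =
  (SOME g. g \<in> hom C (Cod C f) (Dom C f) \<and> Comp C g f = Idn C (Dom C f) \<and>
     Comp C f g = Idn C (Cod C f))"

lemma inverse_arr:
  assumes "is_iso C f"
  shows "inverse_arr f \<in> Arr C" "Dom C (inverse_arr f) = Cod C f"
    "Cod C (inverse_arr f) = Dom C f" "Comp C (inverse_arr f) f = Idn C (Dom C f)"
    "Comp C f (inverse_arr f) = Idn C (Cod C f)"
proof -
  have "\<exists>g. g \<in> hom C (Cod C f) (Dom C f) \<and> Comp C g f = Idn C (Dom C f) \<and>
     Comp C f g = Idn C (Cod C f)"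
    using assms by (auto simp: is_iso_def)
  from someI_ex[OF this] show "inverse_arr f \<in> Arr C" "Dom C (inverse_arr f) = Cod C f"
    "Cod C (inverse_arr f) = Dom C f" "Comp C (inverse_arr f) f = Idn C (Dom C f)"
    "Comp C f (inverse_arr f) = Idn C (Cod C f)"
    unfolding inverse_arr_def[symmetric] by (simp_all add: hom_iff)
qed

lemma is_iso_Arr: "is_iso C f \<Longrightarrow> f \<in> Arr C"
  by (simp add: is_iso_def)

lemma is_isoI:
  "f \<in> Arr C \<Longrightarrow> g \<in> Arr C \<Longrightarrow> Dom C g = Cod C f \<Longrightarrow> Cod C g = Dom C f \<Longrightarrow>
    Comp C g f = Idn C (Dom C f) \<Longrightarrow> Comp C f g = Idn C (Cod C f) \<Longrightarrow> is_iso C f"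
  by (auto simp: is_iso_def hom_iff)

lemma is_iso_Idn: "x \<in> Obj C \<Longrightarrow> is_iso C (Idn C x)"
  by (rule is_isoI[where g = "Idn C x"]) auto

lemma inverse_arr_is_iso: "is_iso C f \<Longrightarrow> is_iso C (inverse_arr f)"
  by (rule is_isoI[where g = f]) (auto simp: inverse_arr is_iso_Arr)

lemma inverse_arr_cancel:
  assumes "is_iso C f"
  shows "k \<in> Arr C \<Longrightarrow> Cod C k = Dom C f \<Longrightarrow> Comp C (inverse_arr f) (Comp C f k) = k"
    "k \<in> Arr C \<Longrightarrow> Cod C k = Cod C f \<Longrightarrow> Comp C f (Comp C (inverse_arr f) k) = k"
proof -
  note i = inverse_arr[OF assms] is_iso_Arr[OF assms]
  show "Comp C (inverse_arr f) (Comp C f k) = k" if "k \<in> Arr C" "Cod C k = Dom C f"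
    using assoc[of k f "inverse_arr f"] i that by (simp del: assoc)
  show "Comp C f (Comp C (inverse_arr f) k) = k" if "k \<in> Arr C" "Cod C k = Cod C f"
    using assoc[of k "inverse_arr f" f] i that by (simp del: assoc)
qed

lemma iso_cancel_left:
  assumes "is_iso C f" "Comp C f g = Comp C f h" "g \<in> Arr C" "h \<in> Arr C"
    "Cod C g = Dom C f" "Cod C h = Dom C f"
  shows "g = h"
  using assms by (metis inverse_arr_cancel(1))

lemma iso_cancel_right:
  assumes "is_iso C f" "Comp C g f = Comp C h f" "g \<in> Arr C" "h \<in> Arr C"
    "Dom C g = Cod C f" "Dom C h = Cod C f"
  shows "g = h"
proof -
  note i = inverse_arr[OF assms(1)] is_iso_Arr[OF assms(1)]
  have "Comp C g (Comp C f (inverse_arr f)) = Comp C h (Comp C f (inverse_arr f))"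
    by (rule Comp_eq_whisker[OF assms(2)]) (use assms(3-) i in auto)
  then show ?thesis using assms(3-) i by simp
qed

end

lemma (in cat_functor) preserves_iso: "is_iso C f \<Longrightarrow> is_iso D (FAr F f)"
proof -
  assume f: "is_iso C f"
  note g = source.inverse_arr[OF f] source.is_iso_Arr[OF f]
  show ?thesis
    by (rule target.is_isoI[where g = "FAr F (source.inverse_arr f)"])
      (use g in \<open>auto simp flip: FAr_Comp_simp\<close>)
qed

lemma nat_trans_inverse:
  assumes "nat_trans C D F G \<theta>" and iso: "\<And>x. x \<in> Obj C \<Longrightarrow> is_iso D (\<theta> x)"
  shows "nat_trans C D G F (\<lambda>x\<in>Obj C. category.inverse_arr D (\<theta> x))"
proof -
  interpret nat_trans C D F G \<theta> by fact
  note i = F.target.inverse_arr[OF iso]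
  show ?thesis
  proof (rule nat_transI)
    fix f assume f: "f \<in> Arr C"
    let ?i = "F.target.inverse_arr"
    have "Comp D (?i (\<theta> (Cod C f))) (FAr G f)
      = Comp D (?i (\<theta> (Cod C f))) (Comp D (FAr G f) (Comp D (\<theta> (Dom C f)) (?i (\<theta> (Dom C f)))))"
      using f by (simp add: i)
    also have "\<dots> = Comp D (?i (\<theta> (Cod C f))) (Comp D (\<theta> (Cod C f)) (Comp D (FAr F f) (?i (\<theta> (Dom C f)))))"
      using f naturality_Arr[OF f]
      by (intro arg_cong[where f = "Comp D _"] F.target.Comp_eq_whisker) (auto simp: i)
    also have "\<dots> = Comp D (FAr F f) (?i (\<theta> (Dom C f)))"
      using f by (intro F.target.inverse_arr_cancel iso) (auto simp: i)
    finally show "Comp D ((\<lambda>x\<in>Obj C. ?i (\<theta> x)) (Cod C f)) (FAr G f)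
      = Comp D (FAr F f) ((\<lambda>x\<in>Obj C. ?i (\<theta> x)) (Dom C f))"
      using f by simp
  qed (auto simp: i F.cat_functor_axioms G.cat_functor_axioms)
qed

definition full_functor ::
  "('o, 'a) cat \<Rightarrow> ('p, 'b) cat \<Rightarrow> ('o, 'a, 'p, 'b) ftr \<Rightarrow> bool" where
  "full_functor C D F \<longleftrightarrow> (\<forall>x\<in>Obj C. \<forall>y\<in>Obj C. \<forall>h\<in>hom D (FOb F x) (FOb F y).
     \<exists>k\<in>hom C x y. FAr F k = h)"

definition faithful_functor ::
  "('o, 'a) cat \<Rightarrow> ('p, 'b) cat \<Rightarrow> ('o, 'a, 'p, 'b) ftr \<Rightarrow> bool" where
  "faithful_functor C D F \<longleftrightarrow> (\<forall>k\<in>Arr C. \<forall>l\<in>Arr C. Dom C k = Dom C l \<and> Cod C k = Cod C l \<and>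
     FAr F k = FAr F l \<longrightarrow> k = l)"

definition essentially_surjective ::
  "('o, 'a) cat \<Rightarrow> ('p, 'b) cat \<Rightarrow> ('o, 'a, 'p, 'b) ftr \<Rightarrow> bool" where
  "essentially_surjective C D F \<longleftrightarrow>
     (\<forall>y\<in>Obj D. \<exists>x\<in>Obj C. \<exists>e\<in>hom D (FOb F x) y. is_iso D e)"

lemma full_functorE:
  assumes "full_functor C D F" "x \<in> Obj C" "y \<in> Obj C" "h \<in> Arr D" "Dom D h = FOb F x"
    "Cod D h = FOb F y"
  obtains k where "k \<in> Arr C" "Dom C k = x" "Cod C k = y" "FAr F k = h"
proof -
  have "h \<in> hom D (FOb F x) (FOb F y)" using assms by (simp add: hom_iff)
  then obtain k where "k \<in> hom C x y" "FAr F k = h"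
    using assms(1-3) unfolding full_functor_def by blast
  then show thesis using that by (auto simp: hom_iff)
qed

lemma faithful_functorD:
  "faithful_functor C D F \<Longrightarrow> FAr F k = FAr F l \<Longrightarrow> k \<in> Arr C \<Longrightarrow> l \<in> Arr C \<Longrightarrow>
    Dom C k = Dom C l \<Longrightarrow> Cod C k = Cod C l \<Longrightarrow> k = l"
  unfolding faithful_functor_def by blast

lemma essentially_surjectiveE:
  assumes "essentially_surjective C D F" "y \<in> Obj D"
  obtains x e where "x \<in> Obj C" "e \<in> Arr D" "Dom D e = FOb F x" "Cod D e = y" "is_iso D e"
  using assms unfolding essentially_surjective_def by (metis (no_types, lifting) hom_iff)

lemma equivalent_categories_sym: "equivalent_categories C D \<Longrightarrow> equivalent_categories D C"
  by (auto simp: equivalent_categories_def)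

text \<open>By naturality \<open>k\<close> is recovered from \<open>G (F k)\<close> by conjugating with the isomorphism
  \<open>G F \<cong> id\<close>.\<close>

lemma faithful_if_retraction:
  assumes "cat_functor C D F" "cat_functor D C G" "nat_isomorphic C C (comp_ftr C G F) (id_ftr C)"
  shows "faithful_functor C D F"
proof -
  interpret F: cat_functor C D F by fact
  interpret G: cat_functor D C G by fact
  obtain \<eta> where "nat_trans C C (comp_ftr C G F) (id_ftr C) \<eta>"
    and iso: "\<And>x. x \<in> Obj C \<Longrightarrow> is_iso C (\<eta> x)"
    using assms(3) by (auto simp: nat_isomorphic_def)
  then interpret \<eta>: nat_trans C C "comp_ftr C G F" "id_ftr C" \<eta> by simp
  show ?thesis
    unfolding faithful_functor_def
  proof (intro ballI impI)
    fix k l assume kl: "k \<in> Arr C" "l \<in> Arr C"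
      "Dom C k = Dom C l \<and> Cod C k = Cod C l \<and> FAr F k = FAr F l"
    then have "Comp C k (\<eta> (Dom C l)) = Comp C l (\<eta> (Dom C l))"
      using \<eta>.naturality_Arr[of k] \<eta>.naturality_Arr[of l] by simp
    then show "k = l"
      using kl by (auto intro: F.source.iso_cancel_right[OF iso[of "Dom C l"]])
  qed
qed

text \<open>A preimage of \<open>h : F x \<rightarrow> F y\<close> is \<open>\<eta>\<^sub>y \<circ> G h \<circ> \<eta>\<^sub>x\<^bsup>-1\<^esup>\<close>, for \<open>\<eta> : G F \<cong> id\<close>: both have the same
  image under \<open>G\<close>, and \<open>G\<close> is faithful too.\<close>

lemma equivalence_is_fully_faithful:
  assumes "equivalent_categories C D"
  obtains F where "cat_functor C D F" "full_functor C D F" "faithful_functor C D F"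
    "essentially_surjective C D F"
proof -
  obtain F G where F: "cat_functor C D F" and G: "cat_functor D C G"
    and GF: "nat_isomorphic C C (comp_ftr C G F) (id_ftr C)"
    and FG: "nat_isomorphic D D (comp_ftr D F G) (id_ftr D)"
    using assms by (auto simp: equivalent_categories_def)
  interpret F: cat_functor C D F by fact
  interpret G: cat_functor D C G by fact
  obtain \<eta> where "nat_trans C C (comp_ftr C G F) (id_ftr C) \<eta>"
    and iso: "\<And>x. x \<in> Obj C \<Longrightarrow> is_iso C (\<eta> x)"
    using GF by (auto simp: nat_isomorphic_def)
  then interpret \<eta>: nat_trans C C "comp_ftr C G F" "id_ftr C" \<eta> by simp
  obtain \<epsilon> where "nat_trans D D (comp_ftr D F G) (id_ftr D) \<epsilon>"
    and iso': "\<And>y. y \<in> Obj D \<Longrightarrow> is_iso D (\<epsilon> y)"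
    using FG by (auto simp: nat_isomorphic_def)
  then interpret \<epsilon>: nat_trans D D "comp_ftr D F G" "id_ftr D" \<epsilon> by simp
  have faithG: "faithful_functor D C G"
    using G F FG by (rule faithful_if_retraction)
  have "full_functor C D F"
    unfolding full_functor_def
  proof (intro ballI)
    fix x y h assume x: "x \<in> Obj C" and y: "y \<in> Obj C" and "h \<in> hom D (FOb F x) (FOb F y)"
    then have h: "h \<in> Arr D" "Dom D h = FOb F x" "Cod D h = FOb F y" by (auto simp: hom_iff)
    note i = F.source.inverse_arr[OF iso[OF x]]
    define k where "k = Comp C (\<eta> y) (Comp C (FAr G h) (F.source.inverse_arr (\<eta> x)))"
    have k: "k \<in> Arr C" "Dom C k = x" "Cod C k = y"
      using x y h i by (auto simp: k_def)
    have "Comp C (\<eta> y) (FAr G (FAr F k)) = Comp C k (\<eta> x)"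
      using \<eta>.naturality_Arr[of k] k by simp
    also have "\<dots> = Comp C (\<eta> y) (FAr G h)"
      using x y h i by (simp add: k_def)
    finally have eq: "Comp C (\<eta> y) (FAr G (FAr F k)) = Comp C (\<eta> y) (FAr G h)" .
    have "FAr G (FAr F k) = FAr G h"
      by (rule F.source.iso_cancel_left[OF iso[OF y] eq]) (use x y h k in simp_all)
    then have "FAr F k = h"
      using faithG k h unfolding faithful_functor_def by simp
    then show "\<exists>k\<in>hom C x y. FAr F k = h"
      using k by (auto simp: hom_iff)
  qed
  moreover have "essentially_surjective C D F"
    unfolding essentially_surjective_def
  proof
    fix y assume y: "y \<in> Obj D"
    then show "\<exists>x\<in>Obj C. \<exists>e\<in>hom D (FOb F x) y. is_iso D e"
      using iso'[OF y] by (intro bexI[of _ "FOb G y"] bexI[of _ "\<epsilon> y"]) (auto simp: hom_iff)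
  qed
  ultimately show thesis
    using that F faithful_if_retraction[OF F G GF] by blast
qed

text \<open>A quasi-inverse sends \<open>y\<close> to a chosen \<open>g y\<close> with an isomorphism \<open>e y : F (g y) \<rightarrow> y\<close>; on
  arrows it is forced by the wish that \<open>e\<close> be natural, and the unit is the preimage under \<open>F\<close> of
  \<open>e\<close> at \<open>F x\<close>.\<close>

lemma equivalent_categories_if_fully_faithful:
  assumes F: "cat_functor C D F" and full: "full_functor C D F"
    and faith: "faithful_functor C D F" and ess: "essentially_surjective C D F"
  shows "equivalent_categories C D"
proof -
  interpret F: cat_functor C D F by fact
  from ess have "\<forall>y\<in>Obj D. \<exists>xe. fst xe \<in> Obj C \<and> snd xe \<in> hom D (FOb F (fst xe)) y \<and> is_iso D (snd xe)"
    unfolding essentially_surjective_def by fastforce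
  then obtain ge where ge: "\<And>y. y \<in> Obj D \<Longrightarrow>
    fst (ge y) \<in> Obj C \<and> snd (ge y) \<in> hom D (FOb F (fst (ge y))) y \<and> is_iso D (snd (ge y))"
    by metis
  define g where "g y = fst (ge y)" for y
  define e where "e y = snd (ge y)" for y
  have g [simp]: "g y \<in> Obj C" and e [simp]: "e y \<in> Arr D" "Dom D (e y) = FOb F (g y)"
    "Cod D (e y) = y" and e_iso: "is_iso D (e y)" if "y \<in> Obj D" for y
    using ge[OF that] by (auto simp: g_def e_def hom_iff)
  let ?inv = "F.target.inverse_arr"
  have inv [simp]: "?inv (e y) \<in> Arr D" "Dom D (?inv (e y)) = y" "Cod D (?inv (e y)) = FOb F (g y)"
    if "y \<in> Obj D" for y
    using F.target.inverse_arr[OF e_iso[OF that]] that by auto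
  have "\<forall>h. \<exists>k. h \<in> Arr D \<longrightarrow> k \<in> hom C (g (Dom D h)) (g (Cod D h)) \<and>
    FAr F k = Comp D (?inv (e (Cod D h))) (Comp D h (e (Dom D h)))"
  proof
    fix h
    show "\<exists>k. h \<in> Arr D \<longrightarrow> k \<in> hom C (g (Dom D h)) (g (Cod D h)) \<and>
      FAr F k = Comp D (?inv (e (Cod D h))) (Comp D h (e (Dom D h)))"
    proof (cases "h \<in> Arr D")
      case True
      then have "Comp D (?inv (e (Cod D h))) (Comp D h (e (Dom D h)))
        \<in> hom D (FOb F (g (Dom D h))) (FOb F (g (Cod D h)))"
        by (simp add: hom_iff)
      then show ?thesis
        using full[unfolded full_functor_def] True g by (metis F.target.Cod_in_Obj F.target.Dom_in_Obj)
    qed simp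
  qed
  then obtain m where m': "\<And>h. h \<in> Arr D \<Longrightarrow> m h \<in> hom C (g (Dom D h)) (g (Cod D h)) \<and>
    FAr F (m h) = Comp D (?inv (e (Cod D h))) (Comp D h (e (Dom D h)))"
    by metis
  have m [simp]: "m h \<in> Arr C" "Dom C (m h) = g (Dom D h)" "Cod C (m h) = g (Cod D h)"
    and Fm: "FAr F (m h) = Comp D (?inv (e (Cod D h))) (Comp D h (e (Dom D h)))"
    if "h \<in> Arr D" for h
    using m'[OF that] by (auto simp: hom_iff)
  note faithD = faithful_functorD[OF faith]
  define G where "G = \<lparr>FOb = (\<lambda>y\<in>Obj D. g y), FAr = (\<lambda>h\<in>Arr D. m h)\<rparr>"
  have G_simps [simp]: "\<And>y. y \<in> Obj D \<Longrightarrow> FOb G y = g y" "\<And>h. h \<in> Arr D \<Longrightarrow> FAr G h = m h"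
    by (simp_all add: G_def)
  have G: "cat_functor D C G"
  proof (rule cat_functorI)
    fix y assume y: "y \<in> Obj D"
    show "FAr G (Idn D y) = Idn C (FOb G y)"
      using y by (auto simp: Fm F.target.inverse_arr[OF e_iso[OF y]] intro!: faithD)
  next
    fix h k assume hk: "h \<in> Arr D" "k \<in> Arr D" "Dom D k = Cod D h"
    then have "FAr F (m (Comp D k h)) = FAr F (Comp C (m k) (m h))"
      by (simp add: Fm F.FAr_Comp_simp F.target.inverse_arr_cancel[OF e_iso])
    then show "FAr G (Comp D k h) = Comp C (FAr G k) (FAr G h)"
      using hk by (auto intro!: faithD)
  qed (auto simp: F.source.category_axioms F.target.category_axioms, auto simp: G_def)
  interpret G: cat_functor D C G by (rule G)
  have "nat_isomorphic D D (comp_ftr D F G) (id_ftr D)"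
    unfolding nat_isomorphic_def
  proof (intro exI conjI ballI)
    show "nat_trans D D (comp_ftr D F G) (id_ftr D) (\<lambda>y\<in>Obj D. e y)"
      by (rule nat_transI)
        (auto simp: comp_ftr_functor[OF G F] id_ftr_functor[OF F.target.category_axioms] Fm
            F.target.inverse_arr_cancel[OF e_iso])
  qed (simp add: e_iso)
  moreover have "nat_isomorphic C C (comp_ftr C G F) (id_ftr C)"
  proof -
    have "\<forall>x. \<exists>k. x \<in> Obj C \<longrightarrow> k \<in> hom C (g (FOb F x)) x \<and> FAr F k = e (FOb F x)"
    proof
      fix x
      show "\<exists>k. x \<in> Obj C \<longrightarrow> k \<in> hom C (g (FOb F x)) x \<and> FAr F k = e (FOb F x)"
      proof (cases "x \<in> Obj C")
        case True
        then have "e (FOb F x) \<in> hom D (FOb F (g (FOb F x))) (FOb F x)" by (simp add: hom_iff)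
        then show ?thesis
          using full True unfolding full_functor_def by (metis F.FOb_in_Obj g)
      qed simp
    qed
    then obtain n where n': "\<And>x. x \<in> Obj C \<Longrightarrow> n x \<in> hom C (g (FOb F x)) x \<and> FAr F (n x) = e (FOb F x)"
      by metis
    have n [simp]: "n x \<in> Arr C" "Dom C (n x) = g (FOb F x)" "Cod C (n x) = x"
      "FAr F (n x) = e (FOb F x)" if "x \<in> Obj C" for x
      using n'[OF that] by (auto simp: hom_iff)
    have n_iso: "is_iso C (n x)" if x: "x \<in> Obj C" for x
    proof -
      have "?inv (e (FOb F x)) \<in> hom D (FOb F x) (FOb F (g (FOb F x)))"
        using x by (simp add: hom_iff)
      then obtain l where l: "l \<in> Arr C" "Dom C l = x" "Cod C l = g (FOb F x)"
        "FAr F l = ?inv (e (FOb F x))"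
        using full x g unfolding full_functor_def by (metis F.FOb_in_Obj hom_iff)
      show ?thesis
        by (rule F.source.is_isoI[where g = l])
          (use l x in \<open>auto intro!: faithD simp: F.FAr_Comp_simp F.target.inverse_arr[OF e_iso]\<close>)
    qed
    show ?thesis
      unfolding nat_isomorphic_def
    proof (intro exI conjI ballI)
      show "nat_trans C C (comp_ftr C G F) (id_ftr C) (\<lambda>x\<in>Obj C. n x)"
      proof (rule nat_transI)
        fix k assume k: "k \<in> Arr C"
        have "FAr F (Comp C (n (Cod C k)) (m (FAr F k))) = FAr F (Comp C k (n (Dom C k)))"
          using k by (simp add: F.FAr_Comp_simp Fm F.target.inverse_arr_cancel[OF e_iso])
        then have "Comp C (n (Cod C k)) (m (FAr F k)) = Comp C k (n (Dom C k))"
          using k by (auto intro!: faithD)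
        then show "Comp C ((\<lambda>x\<in>Obj C. n x) (Cod C k)) (FAr (comp_ftr C G F) k)
          = Comp C (FAr (id_ftr C) k) ((\<lambda>x\<in>Obj C. n x) (Dom C k))"
          using k by simp
      qed (auto simp: comp_ftr_functor[OF F G] id_ftr_functor[OF F.source.category_axioms])
    qed (simp add: n_iso)
  qed
  ultimately show ?thesis
    unfolding equivalent_categories_def using F G by blast
qed


section \<open>Adjunctions as universal arrows\<close>

text \<open>The counit at \<open>y\<close> of an adjunction with left adjoint \<open>L\<close>: composition with \<open>e\<close> identifies the
  arrows \<open>x \<rightarrow> r\<close> with the arrows \<open>L x \<rightarrow> y\<close>.\<close>

definition couniversal_arrow :: "('p, 'b) cat \<Rightarrow> ('o, 'a) cat \<Rightarrow> ('p, 'b, 'o, 'a) ftr \<Rightarrow>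
    'p \<Rightarrow> 'o \<Rightarrow> 'a \<Rightarrow> bool" where
  "couniversal_arrow D C L r y e \<longleftrightarrow> r \<in> Obj D \<and> e \<in> hom C (FOb L r) y \<and>
     (\<forall>x\<in>Obj D. \<forall>h\<in>hom C (FOb L x) y. \<exists>!k. k \<in> hom D x r \<and> Comp C e (FAr L k) = h)"

definition has_couniversal_arrows ::
  "('p, 'b) cat \<Rightarrow> ('o, 'a) cat \<Rightarrow> ('p, 'b, 'o, 'a) ftr \<Rightarrow> bool" where
  "has_couniversal_arrows D C L \<longleftrightarrow> (\<forall>y\<in>Obj C. \<exists>r e. couniversal_arrow D C L r y e)"

text \<open>The counit is couniversal: the factorisation of \<open>h\<close> is its transpose \<open>R h \<circ> \<eta>\<close>.\<close>

lemma weak_geometric_morphism_has_couniversal_arrows: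
  assumes "weak_geometric_morphism C D a"
  shows "has_couniversal_arrows D C (inv_im a)"
  unfolding has_couniversal_arrows_def
proof
  let ?L = "inv_im a" and ?R = "dir_im a" and ?\<eta> = "adj_unit a" and ?\<epsilon> = "adj_counit a"
  interpret L: cat_functor D C "?L" using assms by (simp add: weak_geometric_morphism_def)
  interpret R: cat_functor C D "?R" using assms by (simp add: weak_geometric_morphism_def)
  interpret \<eta>: nat_trans D D "id_ftr D" "comp_ftr D ?R ?L" "?\<eta>"
    using assms by (simp add: weak_geometric_morphism_def)
  interpret \<epsilon>: nat_trans C C "comp_ftr C ?L ?R" "id_ftr C" "?\<epsilon>"
    using assms by (simp add: weak_geometric_morphism_def)
  fix y assume y: "y \<in> Obj C"
  have tri1: "Comp C (?\<epsilon> (FOb ?L x)) (FAr ?L (?\<eta> x)) = Idn C (FOb ?L x)" if "x \<in> Obj D" for x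
    using assms that by (simp add: weak_geometric_morphism_def)
  have tri2: "Comp D (FAr ?R (?\<epsilon> y)) (?\<eta> (FOb ?R y)) = Idn D (FOb ?R y)"
    using assms y by (simp add: weak_geometric_morphism_def)
  have "couniversal_arrow D C ?L (FOb ?R y) y (?\<epsilon> y)"
    unfolding couniversal_arrow_def
  proof (intro conjI ballI)
    fix x h assume x: "x \<in> Obj D" and "h \<in> hom C (FOb ?L x) y"
    then have h: "h \<in> Arr C" "Dom C h = FOb ?L x" "Cod C h = y" by (auto simp: hom_iff)
    show "\<exists>!k. k \<in> hom D x (FOb ?R y) \<and> Comp C (?\<epsilon> y) (FAr ?L k) = h"
    proof (rule ex1I)
      have "Comp C (?\<epsilon> y) (Comp C (FAr ?L (FAr ?R h)) (FAr ?L (?\<eta> x)))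
          = Comp C h (Comp C (?\<epsilon> (FOb ?L x)) (FAr ?L (?\<eta> x)))"
        using \<epsilon>.naturality_Arr[of h] h x y by (intro L.target.Comp_eq_whisker) auto
      then show "Comp D (FAr ?R h) (?\<eta> x) \<in> hom D x (FOb ?R y) \<and>
        Comp C (?\<epsilon> y) (FAr ?L (Comp D (FAr ?R h) (?\<eta> x))) = h"
        using h x y by (simp add: hom_iff L.FAr_Comp_simp tri1)
    next
      fix k assume "k \<in> hom D x (FOb ?R y) \<and> Comp C (?\<epsilon> y) (FAr ?L k) = h"
      then have k: "k \<in> Arr D" "Dom D k = x" "Cod D k = FOb ?R y"
        and e: "h = Comp C (?\<epsilon> y) (FAr ?L k)" by (auto simp: hom_iff)
      have "Comp D (FAr ?R h) (?\<eta> x)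
          = Comp D (FAr ?R (?\<epsilon> y)) (Comp D (FAr ?R (FAr ?L k)) (?\<eta> x))"
        using k x y by (simp add: e R.FAr_Comp_simp)
      also have "\<dots> = Comp D (FAr ?R (?\<epsilon> y)) (Comp D (?\<eta> (FOb ?R y)) k)"
        using \<eta>.naturality_Arr[of k] k x y by simp
      also have "\<dots> = Comp D (Comp D (FAr ?R (?\<epsilon> y)) (?\<eta> (FOb ?R y))) k"
        using k y by simp
      finally show "k = Comp D (FAr ?R h) (?\<eta> x)"
        unfolding tri2 using k y by simp
    qed
  qed (use y in \<open>auto simp: hom_iff\<close>)
  then show "\<exists>r e. couniversal_arrow D C ?L r y e" by blast
qed

text \<open>Once couniversal arrows are chosen, the action of the right adjoint on arrows, the unit and
  all equations between them follow from unique factorisation.\<close>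

lemma couniversal_arrows_give_weak_geometric_morphism:
  assumes L: "cat_functor D C L" and univ: "has_couniversal_arrows D C L"
  shows "\<exists>a. weak_geometric_morphism C D a \<and> inv_im a = L"
proof -
  interpret L: cat_functor D C L by fact
  obtain r e where re: "\<And>y. y \<in> Obj C \<Longrightarrow> couniversal_arrow D C L (r y) y (e y)"
    using univ unfolding has_couniversal_arrows_def by metis
  have re_simps [simp]: "r y \<in> Obj D" "e y \<in> Arr C" "Dom C (e y) = FOb L (r y)" "Cod C (e y) = y"
    if "y \<in> Obj C" for y
    using re[OF that] by (auto simp: couniversal_arrow_def hom_iff)
  define t where "t x h = (THE k. k \<in> hom D x (r (Cod C h)) \<and> Comp C (e (Cod C h)) (FAr L k) = h)"
    for x h
  have ex1: "\<exists>!k. k \<in> hom D x (r (Cod C h)) \<and> Comp C (e (Cod C h)) (FAr L k) = h"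
    if "x \<in> Obj D" "h \<in> Arr C" "Dom C h = FOb L x" for x h
    using re[of "Cod C h"] that unfolding couniversal_arrow_def by (simp add: hom_iff)
  have t [simp]: "t x h \<in> Arr D" "Dom D (t x h) = x" "Cod D (t x h) = r (Cod C h)"
    and te: "Comp C (e (Cod C h)) (FAr L (t x h)) = h"
    if "x \<in> Obj D" "h \<in> Arr C" "Dom C h = FOb L x" for x h
    using theI'[OF ex1[OF that]] by (auto simp: t_def hom_iff)
  have uniq: "k = l" if "Comp C (e y) (FAr L k) = Comp C (e y) (FAr L l)" "y \<in> Obj C"
    "k \<in> Arr D" "l \<in> Arr D" "Dom D k = Dom D l" "Cod D k = r y" "Cod D l = r y" for k l y
    using ex1[of "Dom D k" "Comp C (e y) (FAr L k)"] that by (auto simp: hom_iff)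
  define R where "R = \<lparr>FOb = (\<lambda>y\<in>Obj C. r y), FAr = (\<lambda>h\<in>Arr C. t (r (Dom C h)) (Comp C h (e (Dom C h))))\<rparr>"
  have RO [simp]: "FOb R y = r y" if "y \<in> Obj C" for y
    using that by (simp add: R_def)
  have RA [simp]: "FAr R h \<in> Arr D" "Dom D (FAr R h) = r (Dom C h)" "Cod D (FAr R h) = r (Cod C h)"
    and eR: "Comp C (e (Cod C h)) (FAr L (FAr R h)) = Comp C h (e (Dom C h))" if "h \<in> Arr C" for h
    using te[of "r (Dom C h)" "Comp C h (e (Dom C h))"] that by (auto simp: R_def)
  have R: "cat_functor C D R"
  proof (rule cat_functorI)
    fix y assume y: "y \<in> Obj C"
    show "FAr R (Idn C y) = Idn D (FOb R y)"
      by (rule uniq[of y]) (use y eR[of "Idn C y"] in auto)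
  next
    fix h k assume hk: "h \<in> Arr C" "k \<in> Arr C" "Dom C k = Cod C h"
    have "Comp C (e (Cod C k)) (FAr L (Comp D (FAr R k) (FAr R h)))
      = Comp C (e (Cod C k)) (Comp C (FAr L (FAr R k)) (FAr L (FAr R h)))"
      using hk by (simp add: L.FAr_Comp_simp)
    also have "\<dots> = Comp C k (Comp C (e (Cod C h)) (FAr L (FAr R h)))"
      using hk eR[of k] by (intro L.target.Comp_eq_whisker) auto
    also have "\<dots> = Comp C k (Comp C h (e (Dom C h)))"
      using hk eR[of h] by simp
    finally show "FAr R (Comp C k h) = Comp D (FAr R k) (FAr R h)"
      by (intro uniq[of "Cod C k"]) (use hk eR[of "Comp C k h"] in auto)
  qed (auto simp: L.source.category_axioms L.target.category_axioms, auto simp: R_def)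
  interpret R: cat_functor C D R by (rule R)
  define \<eta> where "\<eta> = (\<lambda>x\<in>Obj D. t x (Idn C (FOb L x)))"
  have \<eta> [simp]: "\<eta> x \<in> Arr D" "Dom D (\<eta> x) = x" "Cod D (\<eta> x) = r (FOb L x)"
    and e\<eta>: "Comp C (e (FOb L x)) (FAr L (\<eta> x)) = Idn C (FOb L x)" if "x \<in> Obj D" for x
    using te[of x "Idn C (FOb L x)"] that by (auto simp: \<eta>_def)
  have "nat_trans D D (id_ftr D) (comp_ftr D R L) \<eta>"
  proof (rule nat_transI)
    fix k assume k: "k \<in> Arr D"
    have "Comp C (e (FOb L (Cod D k))) (FAr L (Comp D (FAr R (FAr L k)) (\<eta> (Dom D k))))
      = Comp C (e (FOb L (Cod D k))) (Comp C (FAr L (FAr R (FAr L k))) (FAr L (\<eta> (Dom D k))))"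
      using k by (simp add: L.FAr_Comp_simp)
    also have "\<dots> = Comp C (FAr L k) (Comp C (e (FOb L (Dom D k))) (FAr L (\<eta> (Dom D k))))"
      using k eR[of "FAr L k"] by (intro L.target.Comp_eq_whisker) auto
    also have "\<dots> = FAr L k" using k by (simp add: e\<eta>)
    finally have 1: "Comp C (e (FOb L (Cod D k))) (FAr L (Comp D (FAr R (FAr L k)) (\<eta> (Dom D k)))) = FAr L k" .
    have "Comp C (e (FOb L (Cod D k))) (FAr L (Comp D (\<eta> (Cod D k)) k))
      = Comp C (Comp C (e (FOb L (Cod D k))) (FAr L (\<eta> (Cod D k)))) (FAr L k)"
      using k by (simp add: L.FAr_Comp_simp)
    also have "\<dots> = FAr L k" unfolding e\<eta>[OF L.source.Cod_in_Obj[OF k]] using k by simp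
    finally have "Comp D (\<eta> (Cod D k)) k = Comp D (FAr R (FAr L k)) (\<eta> (Dom D k))"
      by (intro uniq[of "FOb L (Cod D k)"]) (use 1 k in auto)
    then show "Comp D (\<eta> (Cod D k)) (FAr (id_ftr D) k) = Comp D (FAr (comp_ftr D R L) k) (\<eta> (Dom D k))"
      using k by simp
  qed (auto simp: id_ftr_functor[OF L.source.category_axioms] comp_ftr_functor[OF L R], simp add: \<eta>_def)
  moreover have "nat_trans C C (comp_ftr C L R) (id_ftr C) (\<lambda>y\<in>Obj C. e y)"
    by (rule nat_transI)
      (auto simp: id_ftr_functor[OF L.target.category_axioms] comp_ftr_functor[OF R L] eR)
  moreover have "Comp D (FAr R (e y)) (\<eta> (r y)) = Idn D (r y)" if y: "y \<in> Obj C" for y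
  proof (rule uniq[of y])
    have "Comp C (e y) (FAr L (Comp D (FAr R (e y)) (\<eta> (r y))))
      = Comp C (e y) (Comp C (FAr L (FAr R (e y))) (FAr L (\<eta> (r y))))"
      using y by (simp add: L.FAr_Comp_simp)
    also have "\<dots> = Comp C (e y) (Comp C (e (FOb L (r y))) (FAr L (\<eta> (r y))))"
      using y eR[of "e y"] by (intro L.target.Comp_eq_whisker) auto
    finally show "Comp C (e y) (FAr L (Comp D (FAr R (e y)) (\<eta> (r y)))) = Comp C (e y) (FAr L (Idn D (r y)))"
      using y by (simp add: e\<eta>)
  qed (use y in auto)
  ultimately have "weak_geometric_morphism C D
    \<lparr>inv_im = L, dir_im = R, adj_unit = \<eta>, adj_counit = (\<lambda>y\<in>Obj C. e y)\<rparr>"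
    using L R e\<eta> by (simp add: weak_geometric_morphism_def)
  then show ?thesis by (intro exI conjI) auto
qed


section \<open>Terminal objects and pullbacks\<close>

definition terminal_object :: "('o, 'a) cat \<Rightarrow> 'o \<Rightarrow> bool" where
  "terminal_object C t \<longleftrightarrow> t \<in> Obj C \<and> (\<forall>x\<in>Obj C. \<exists>!h. h \<in> hom C x t)"

definition terminal_arr :: "('o, 'a) cat \<Rightarrow> 'o \<Rightarrow> 'o \<Rightarrow> 'a" where
  "terminal_arr C t x = (THE h. h \<in> hom C x t)"

lemma terminal_arr:
  assumes "terminal_object C t" "x \<in> Obj C"
  shows "terminal_arr C t x \<in> Arr C" "Dom C (terminal_arr C t x) = x" "Cod C (terminal_arr C t x) = t"
proof -
  have "\<exists>!h. h \<in> hom C x t" using assms unfolding terminal_object_def by blast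
  from theI'[OF this]
  show "terminal_arr C t x \<in> Arr C" "Dom C (terminal_arr C t x) = x" "Cod C (terminal_arr C t x) = t"
    unfolding terminal_arr_def[symmetric] by (simp_all add: hom_iff)
qed

lemma terminal_arr_unique:
  assumes "terminal_object C t" "category C" "h \<in> Arr C" "k \<in> Arr C" "Cod C h = t" "Cod C k = t"
    "Dom C h = Dom C k"
  shows "h = k"
proof -
  have "\<exists>!h. h \<in> hom C (Dom C k) t"
    using assms(1) category.Dom_in_Obj[OF assms(2,4)] unfolding terminal_object_def by blast
  moreover have "h \<in> hom C (Dom C k) t" "k \<in> hom C (Dom C k) t"
    using assms by (simp_all add: hom_iff)
  ultimately show ?thesis by blast
qed


definition pullback_square :: "('o, 'a) cat \<Rightarrow> 'a \<Rightarrow> 'a \<Rightarrow> 'a \<Rightarrow> 'a \<Rightarrow> bool" where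
  "pullback_square C f g p q \<longleftrightarrow>
     p \<in> Arr C \<and> q \<in> Arr C \<and> Dom C p = Dom C q \<and> Cod C p = Dom C f \<and> Cod C q = Dom C g \<and>
     Comp C f p = Comp C g q \<and>
     (\<forall>u\<in>Arr C. \<forall>v\<in>Arr C. Dom C u = Dom C v \<and> Cod C u = Dom C f \<and> Cod C v = Dom C g \<and>
        Comp C f u = Comp C g v \<longrightarrow>
        (\<exists>!h. h \<in> hom C (Dom C u) (Dom C p) \<and> Comp C p h = u \<and> Comp C q h = v))"

definition has_pullbacks :: "('o, 'a) cat \<Rightarrow> bool" where
  "has_pullbacks C \<longleftrightarrow> (\<forall>f\<in>Arr C. \<forall>g\<in>Arr C. Cod C f = Cod C g \<longrightarrow>
     (\<exists>p q. pullback_square C f g p q))"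

lemma pullback_square_ex1:
  assumes "pullback_square C f g p q" "u \<in> Arr C" "v \<in> Arr C" "Dom C u = Dom C v"
    "Cod C u = Dom C f" "Cod C v = Dom C g" "Comp C f u = Comp C g v"
  shows "\<exists>!h. h \<in> hom C (Dom C u) (Dom C p) \<and> Comp C p h = u \<and> Comp C q h = v"
  using assms unfolding pullback_square_def by blast

text \<open>A terminal object is a limit of the empty diagram.\<close>

lemma preserves_terminal_object:
  fixes C :: "('o, 'a) cat" and D :: "('p, 'b) cat"
  assumes F: "cat_functor C D F" and lim: "preserves_finite_limits C D F"
    and t: "terminal_object C t"
  shows "terminal_object D (FOb F t)"
proof -
  interpret cat_functor C D F by fact
  define I :: "(nat, nat) cat" where "I = \<lparr>Obj = {}, Arr = {}, Dom = id, Cod = id, Idn = id,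
    Comp = (\<lambda>g f. f)\<rparr>"
  define K :: "(nat, nat, 'o, 'a) ftr" where "K = \<lparr>FOb = (\<lambda>_. undefined), FAr = (\<lambda>_. undefined)\<rparr>"
  have I: "category I" "finite (Obj I)" "finite (Arr I)"
    by (auto simp: I_def intro!: categoryI)
  have K: "cat_functor I C K"
    by (rule cat_functorI) (auto simp: source.category_axioms I, auto simp: I_def K_def)
  have empty: "is_limit_cone I A K' x (\<lambda>_. undefined) \<longleftrightarrow> terminal_object A x"
    for A :: "('d, 'e) cat" and K' x
    unfolding is_limit_cone_def is_cone_def terminal_object_def by (auto simp: I_def)
  have "is_limit_cone I D (comp_ftr I F K) (FOb F t) (\<lambda>i\<in>Obj I. FAr F undefined)"
    using lim[unfolded preserves_finite_limits_def, rule_format, OF conjI, OF I(1) conjI, OF I(2) conjI,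
        OF I(3) conjI, OF K empty[THEN iffD2, OF t]] .
  moreover have "(\<lambda>i\<in>Obj I. FAr F undefined) = (\<lambda>_. undefined)"
    by (auto simp: I_def)
  ultimately show ?thesis by (simp add: empty)
qed

text \<open>An object whose image is isomorphic to the terminal object is terminal, because arrows into it
  correspond to arrows into its image.\<close>

lemma equivalence_reflects_terminal_object:
  assumes "cat_functor C D F" and full: "full_functor C D F" and faith: "faithful_functor C D F"
    and ess: "essentially_surjective C D F" and t: "terminal_object D t"
  shows "\<exists>s. terminal_object C s"
proof -
  interpret F: cat_functor C D F by fact
  obtain s e where s: "s \<in> Obj C" and e: "e \<in> Arr D" "Dom D e = FOb F s" "Cod D e = t" and iso: "is_iso D e"
    using essentially_surjectiveE[OF ess, of t] t unfolding terminal_object_def by blast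
  note i = F.target.inverse_arr[OF iso]
  have "\<exists>!h. h \<in> hom C x s" if x: "x \<in> Obj C" for x
  proof -
    obtain h where h: "h \<in> hom D (FOb F x) t" and uniq: "\<And>h'. h' \<in> hom D (FOb F x) t \<Longrightarrow> h' = h"
      using t x unfolding terminal_object_def by (metis F.FOb_in_Obj)
    have "Comp D (F.target.inverse_arr e) h \<in> hom D (FOb F x) (FOb F s)"
      using h i e by (simp add: hom_iff)
    then obtain k where k: "k \<in> hom C x s"
      using full x s unfolding full_functor_def by blast
    moreover have "l = k" if l: "l \<in> hom C x s" for l
    proof -
      have "Comp D e (FAr F l) = h" "Comp D e (FAr F k) = h"
        by (rule uniq, use l k e in \<open>simp add: hom_iff\<close>)+
      then have "FAr F l = FAr F k"
        using F.target.iso_cancel_left[OF iso, of "FAr F l" "FAr F k"] l k e by (simp add: hom_iff)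
      then show "l = k" using faith l k unfolding faithful_functor_def by (auto simp: hom_iff)
    qed
    ultimately show ?thesis by blast
  qed
  then show ?thesis using s unfolding terminal_object_def by blast
qed

text \<open>The apex of the pullback in \<open>D\<close> is isomorphic by some \<open>e\<close> to the image of an object \<open>s\<close>, and the
  projections composed with \<open>e\<close> lift to \<open>C\<close>. A factorisation in \<open>D\<close>, composed with the inverse of
  \<open>e\<close>, lifts as well.\<close>

lemma equivalence_reflects_pullbacks:
  assumes "cat_functor C D F" and full: "full_functor C D F" and faith: "faithful_functor C D F"
    and ess: "essentially_surjective C D F" and pb: "has_pullbacks D"
  shows "has_pullbacks C"
  unfolding has_pullbacks_def
proof (intro ballI impI)
  interpret F: cat_functor C D F by fact
  note faithD = faithful_functorD[OF faith]
  note fullE = full_functorE[OF full]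
  fix f g assume f: "f \<in> Arr C" and g: "g \<in> Arr C" and fg: "Cod C f = Cod C g"
  obtain p q where pq: "pullback_square D (FAr F f) (FAr F g) p q"
    using pb f g fg unfolding has_pullbacks_def by (metis F.FAr_simps(1,3))
  then have p: "p \<in> Arr D" "Dom D p = Dom D q" "Cod D p = FOb F (Dom C f)"
    and q: "q \<in> Arr D" "Cod D q = FOb F (Dom C g)"
    and comm: "Comp D (FAr F f) p = Comp D (FAr F g) q"
    using f g unfolding pullback_square_def by auto
  obtain s e where s: "s \<in> Obj C" and e: "e \<in> Arr D" "Dom D e = FOb F s" "Cod D e = Dom D q"
    and iso: "is_iso D e"
    using essentially_surjectiveE[OF ess F.target.Dom_in_Obj[OF q(1)]] by blast
  note i = F.target.inverse_arr[OF iso]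
  obtain p' where p': "p' \<in> Arr C" "Dom C p' = s" "Cod C p' = Dom C f" "FAr F p' = Comp D p e"
    by (rule fullE[of s "Dom C f" "Comp D p e"]) (use p e f s in auto)
  obtain q' where q': "q' \<in> Arr C" "Dom C q' = s" "Cod C q' = Dom C g" "FAr F q' = Comp D q e"
    by (rule fullE[of s "Dom C g" "Comp D q e"]) (use q e g s in auto)
  have "pullback_square C f g p' q'"
    unfolding pullback_square_def
  proof (intro conjI ballI impI)
    have "Comp D (FAr F f) (Comp D p e) = Comp D (FAr F g) (Comp D q e)"
      by (rule F.target.Comp_eq_whisker[OF comm]) (use p q e f g in auto)
    then show "Comp C f p' = Comp C g q'"
      by (intro faithD) (use p' q' f g fg in \<open>auto simp: F.FAr_Comp_simp\<close>)
  next
    fix u v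
    assume u: "u \<in> Arr C" and v: "v \<in> Arr C" and
      uv: "Dom C u = Dom C v \<and> Cod C u = Dom C f \<and> Cod C v = Dom C g \<and> Comp C f u = Comp C g v"
    have "Comp D (FAr F f) (FAr F u) = Comp D (FAr F g) (FAr F v)"
      using u v uv f g by (metis F.FAr_Comp_simp)
    then have "\<exists>!h. h \<in> hom D (Dom D (FAr F u)) (Dom D p) \<and> Comp D p h = FAr F u \<and> Comp D q h = FAr F v"
      by (intro pullback_square_ex1[OF pq]) (use u v uv f g in auto)
    then obtain h where h': "h \<in> hom D (Dom D (FAr F u)) (Dom D p)" "Comp D p h = FAr F u" "Comp D q h = FAr F v"
      and uniq: "\<And>h'. h' \<in> hom D (Dom D (FAr F u)) (Dom D p) \<Longrightarrow> Comp D p h' = FAr F u \<Longrightarrow>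
        Comp D q h' = FAr F v \<Longrightarrow> h' = h"
      by blast
    have h: "h \<in> Arr D" "Dom D h = FOb F (Dom C v)" "Cod D h = Dom D q"
      "Comp D p h = FAr F u" "Comp D q h = FAr F v"
      using h' u uv p by (simp_all add: hom_iff)
    obtain k where k: "k \<in> Arr C" "Dom C k = Dom C v" "Cod C k = s"
      "FAr F k = Comp D (F.target.inverse_arr e) h"
      by (rule fullE[of "Dom C v" s "Comp D (F.target.inverse_arr e) h"]) (use h e i s v in auto)
    show "\<exists>!h. h \<in> hom C (Dom C u) (Dom C p') \<and> Comp C p' h = u \<and> Comp C q' h = v"
    proof (rule ex1I)
      have "Comp C p' k = u" "Comp C q' k = v"
        by (rule faithD; use k p' q' p q e h u v uv in
          \<open>simp add: F.FAr_Comp_simp F.target.inverse_arr_cancel[OF iso] i\<close>)+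
      then show "k \<in> hom C (Dom C u) (Dom C p') \<and> Comp C p' k = u \<and> Comp C q' k = v"
        using k p' q' uv by (simp add: hom_iff)
    next
      fix l assume "l \<in> hom C (Dom C u) (Dom C p') \<and> Comp C p' l = u \<and> Comp C q' l = v"
      then have l: "l \<in> Arr C" "Dom C l = Dom C v" "Cod C l = s" and
        lp: "Comp C p' l = u" and lq: "Comp C q' l = v"
        using uv p' by (auto simp: hom_iff)
      have "Comp D e (FAr F l) = h"
      proof (rule uniq)
        show "Comp D e (FAr F l) \<in> hom D (Dom D (FAr F u)) (Dom D p)"
          using l e u uv p by (simp add: hom_iff)
        show "Comp D p (Comp D e (FAr F l)) = FAr F u"
          using l p' p e by (simp add: lp[symmetric] F.FAr_Comp_simp)
        show "Comp D q (Comp D e (FAr F l)) = FAr F v"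
          using l q' q e by (simp add: lq[symmetric] F.FAr_Comp_simp)
      qed
      then have h_eq: "h = Comp D e (FAr F l)" by simp
      have "FAr F k = FAr F l"
        unfolding k(4) h_eq using l e by (intro F.target.inverse_arr_cancel[OF iso]) auto
      then show "l = k" using l k by (intro faithD) simp_all
    qed
  qed (use p' q' in auto)
  then show "\<exists>p q. pullback_square C f g p q" by blast
qed


section \<open>Limits of sheaves\<close>

lemma op_cat_simps [simp]:
  "Obj (op_cat C) = Obj C" "Arr (op_cat C) = Arr C" "Dom (op_cat C) = Cod C"
  "Cod (op_cat C) = Dom C" "Idn (op_cat C) = Idn C" "Comp (op_cat C) g f = Comp C f g"
  by (simp_all add: op_cat_def)

lemma op_category: "category C \<Longrightarrow> category (op_cat C)"
proof -
  assume "category C"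
  then interpret category C .
  show ?thesis by (rule categoryI) auto
qed

lemma Set_cat_simps [simp]:
  "Obj Set_cat = {A. small A}"
  "(A, B, m) \<in> Arr Set_cat \<longleftrightarrow> small A \<and> small B \<and> m \<in> A \<rightarrow>\<^sub>E B"
  "Dom Set_cat (A, B, m) = A" "Cod Set_cat (A, B, m) = B"
  "Idn Set_cat A = (A, A, \<lambda>a\<in>A. a)"
  "Comp Set_cat (B, D, k) (A, B', m) = (A, D, \<lambda>a\<in>A. k (m a))"
  by (simp_all add: Set_cat_def)

lemma Set_category: "category Set_cat"
proof (rule categoryI)
  fix f :: "'a set \<times> 'a set \<times> ('a \<Rightarrow> 'a)"
  assume f: "f \<in> Arr Set_cat"
  then show "Comp Set_cat f (Idn Set_cat (Dom Set_cat f)) = f \<and>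
    Comp Set_cat (Idn Set_cat (Cod Set_cat f)) f = f"
    by (cases f) (auto simp: fun_eq_iff PiE_def extensional_def Pi_iff)
qed (auto simp: PiE_iff fun_eq_iff)

lemma small_finite: "infinite (UNIV :: 'u set) \<Longrightarrow> finite (A :: 'u set) \<Longrightarrow> small A"
  unfolding small_def by (rule finite_lesspoll_infinite)

lemma small_subset: "small B \<Longrightarrow> A \<subseteq> B \<Longrightarrow> small A"
  unfolding small_def by (meson lesspoll_trans1 subset_imp_lepoll)

text \<open>The product embeds in the square of the larger factor, which is finite or equipotent to that
  factor.\<close>

lemma lesspoll_Times:
  assumes inf: "infinite U" and A: "A \<prec> U" and B: "B \<prec> U"
  shows "A \<times> B \<prec> U"
proof -
  have *: "X \<times> Y \<prec> U" if "X \<lesssim> Z" "Y \<lesssim> Z" "Z \<prec> U" for X :: "'x set" and Y :: "'y set" and Z :: "'z set"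
  proof -
    have le: "X \<times> Y \<lesssim> Z \<times> Z" using that by (rule_tac times_lepoll_mono)
    have "Z \<times> Z \<prec> U"
    proof (cases "finite Z")
      case True
      then show ?thesis by (intro finite_lesspoll_infinite inf) auto
    next
      case False
      then have "Z \<times> Z \<approx> Z"
        by (simp add: eqpoll_iff_card_of_ordIso card_of_Times_same_infinite)
      then show ?thesis using that(3) by (rule eq_lesspoll_trans)
    qed
    with le show ?thesis by (rule lesspoll_trans1)
  qed
  have "A \<lesssim> B \<or> B \<lesssim> A"
    using ordLeq_total[OF card_of_Well_order card_of_Well_order, of A B]
    by (simp add: lepoll_def flip: card_of_ordLeq)
  then show ?thesis
    using *[of A B B] *[of A A B] A B lepoll_refl by blast
qed

text \<open>An arrow of \<open>Set_cat\<close> carries its source, its target and an extensional function. The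
  following constructions and rules trade functors and natural transformations into \<open>Set_cat\<close> for
  elements and functions.\<close>

definition presheaf_of ::
  "('u, 'u) cat \<Rightarrow> ('u \<Rightarrow> 'u set) \<Rightarrow> ('u \<Rightarrow> 'u \<Rightarrow> 'u) \<Rightarrow>
    ('u, 'u, 'u set, 'u set \<times> 'u set \<times> ('u \<Rightarrow> 'u)) ftr" where
  "presheaf_of C P r = \<lparr>FOb = (\<lambda>c\<in>Obj C. P c),
     FAr = (\<lambda>f\<in>Arr C. (P (Cod C f), P (Dom C f), \<lambda>x\<in>P (Cod C f). r f x))\<rparr>"

definition presheaf_map_of where
  "presheaf_map_of C P Q m = (\<lambda>c\<in>Obj C. (FOb P c, FOb Q c, \<lambda>x\<in>FOb P c. m c x))"

definition at_elem :: "('u \<Rightarrow> 'u set \<times> 'u set \<times> ('u \<Rightarrow> 'u)) \<Rightarrow> 'u \<Rightarrow> 'u \<Rightarrow> 'u" where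
  "at_elem \<theta> c = snd (snd (\<theta> c))"

lemma presheaf_of_simps [simp]:
  "c \<in> Obj C \<Longrightarrow> FOb (presheaf_of C P r) c = P c"
  "f \<in> Arr C \<Longrightarrow> x \<in> P (Cod C f) \<Longrightarrow> restr (presheaf_of C P r) f x = r f x"
  by (auto simp: presheaf_of_def restr_def)

lemma presheaf_map_of_simps [simp]:
  "c \<in> Obj C \<Longrightarrow> x \<in> FOb P c \<Longrightarrow> at_elem (presheaf_map_of C P Q m) c x = m c x"
  by (auto simp: presheaf_map_of_def at_elem_def)

lemma presheaf_of_functor:
  assumes C: "category C" and small: "\<And>c. c \<in> Obj C \<Longrightarrow> small (P c)"
    and r: "\<And>f x. f \<in> Arr C \<Longrightarrow> x \<in> P (Cod C f) \<Longrightarrow> r f x \<in> P (Dom C f)"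
    and id: "\<And>c x. c \<in> Obj C \<Longrightarrow> x \<in> P c \<Longrightarrow> r (Idn C c) x = x"
    and comp: "\<And>f g x. f \<in> Arr C \<Longrightarrow> g \<in> Arr C \<Longrightarrow> Dom C g = Cod C f \<Longrightarrow> x \<in> P (Cod C g) \<Longrightarrow>
      r (Comp C g f) x = r f (r g x)"
  shows "cat_functor (op_cat C) Set_cat (presheaf_of C P r)"
proof -
  interpret category C by fact
  show ?thesis
    by (rule cat_functorI)
      (auto simp: op_category C Set_category small r comp id presheaf_of_def fun_eq_iff)
qed

lemma presheaf_elem:
  fixes C :: "('u, 'u) cat"
  assumes "cat_functor (op_cat C) Set_cat P"
  shows "c \<in> Obj C \<Longrightarrow> small (FOb P c)"
    and "f \<in> Arr C \<Longrightarrow> FAr P f = (FOb P (Cod C f), FOb P (Dom C f), restr P f)"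
    and "f \<in> Arr C \<Longrightarrow> restr P f \<in> FOb P (Cod C f) \<rightarrow>\<^sub>E FOb P (Dom C f)"
    and "f \<in> Arr C \<Longrightarrow> x \<in> FOb P (Cod C f) \<Longrightarrow> restr P f x \<in> FOb P (Dom C f)"
    and "c \<in> Obj C \<Longrightarrow> x \<in> FOb P c \<Longrightarrow> restr P (Idn C c) x = x"
    and "f \<in> Arr C \<Longrightarrow> g \<in> Arr C \<Longrightarrow> Dom C g = Cod C f \<Longrightarrow> x \<in> FOb P (Cod C g) \<Longrightarrow>
      restr P (Comp C g f) x = restr P f (restr P g x)"
proof -
  interpret P: cat_functor "op_cat C" Set_cat P by fact
  show "small (FOb P c)" if "c \<in> Obj C" using P.FOb_in_Obj that by simp
  have FAr: "FAr P f = (FOb P (Cod C f), FOb P (Dom C f), restr P f)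
      \<and> restr P f \<in> FOb P (Cod C f) \<rightarrow>\<^sub>E FOb P (Dom C f)" if "f \<in> Arr C" for f
    using P.FAr_simps[of f] that by (cases "FAr P f") (auto simp: restr_def)
  then show "f \<in> Arr C \<Longrightarrow> FAr P f = (FOb P (Cod C f), FOb P (Dom C f), restr P f)"
    "f \<in> Arr C \<Longrightarrow> restr P f \<in> FOb P (Cod C f) \<rightarrow>\<^sub>E FOb P (Dom C f)"
    "f \<in> Arr C \<Longrightarrow> x \<in> FOb P (Cod C f) \<Longrightarrow> restr P f x \<in> FOb P (Dom C f)"
    by (blast | blast intro: PiE_mem)+
  show "restr P (Idn C c) x = x" if "c \<in> Obj C" "x \<in> FOb P c"
    using P.FAr_Idn_simp[of c] that by (simp add: restr_def)
  show "restr P (Comp C g f) x = restr P f (restr P g x)"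
    if "f \<in> Arr C" "g \<in> Arr C" "Dom C g = Cod C f" "x \<in> FOb P (Cod C g)"
    using P.FAr_Comp_simp[of g f] that FAr[of f] FAr[of g] by (simp add: restr_def[of P "Comp C g f"])
qed

lemma presheaf_map_of_nat_trans:
  fixes C :: "('u, 'u) cat"
  assumes P: "cat_functor (op_cat C) Set_cat P" and Q: "cat_functor (op_cat C) Set_cat Q"
    and C: "category C"
    and m: "\<And>c x. c \<in> Obj C \<Longrightarrow> x \<in> FOb P c \<Longrightarrow> m c x \<in> FOb Q c"
    and nat: "\<And>f x. f \<in> Arr C \<Longrightarrow> x \<in> FOb P (Cod C f) \<Longrightarrow>
      m (Dom C f) (restr P f x) = restr Q f (m (Cod C f) x)"
  shows "nat_trans (op_cat C) Set_cat P Q (presheaf_map_of C P Q m)"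
proof -
  interpret category C by fact
  show ?thesis
    by (rule nat_transI)
      (auto simp: P Q m nat presheaf_map_of_def presheaf_elem[OF P] presheaf_elem[OF Q] fun_eq_iff)
qed

lemma presheaf_map_elem:
  fixes C :: "('u, 'u) cat"
  assumes "nat_trans (op_cat C) Set_cat P Q \<theta>" "category C"
  shows "c \<in> Obj C \<Longrightarrow> \<theta> c = (FOb P c, FOb Q c, at_elem \<theta> c)"
    and "c \<in> Obj C \<Longrightarrow> at_elem \<theta> c \<in> FOb P c \<rightarrow>\<^sub>E FOb Q c"
    and "c \<in> Obj C \<Longrightarrow> x \<in> FOb P c \<Longrightarrow> at_elem \<theta> c x \<in> FOb Q c"
    and "f \<in> Arr C \<Longrightarrow> x \<in> FOb P (Cod C f) \<Longrightarrow>
      at_elem \<theta> (Dom C f) (restr P f x) = restr Q f (at_elem \<theta> (Cod C f) x)"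
proof -
  interpret nat_trans "op_cat C" Set_cat P Q \<theta> by fact
  interpret C: category C by fact
  have \<theta>: "\<theta> c = (FOb P c, FOb Q c, at_elem \<theta> c) \<and> at_elem \<theta> c \<in> FOb P c \<rightarrow>\<^sub>E FOb Q c"
    if "c \<in> Obj C" for c
    using component_simps[of c] that by (cases "\<theta> c") (auto simp: at_elem_def)
  then show "c \<in> Obj C \<Longrightarrow> \<theta> c = (FOb P c, FOb Q c, at_elem \<theta> c)"
    "c \<in> Obj C \<Longrightarrow> at_elem \<theta> c \<in> FOb P c \<rightarrow>\<^sub>E FOb Q c"
    "c \<in> Obj C \<Longrightarrow> x \<in> FOb P c \<Longrightarrow> at_elem \<theta> c x \<in> FOb Q c"
    by (blast | blast intro: PiE_mem)+
  show "at_elem \<theta> (Dom C f) (restr P f x) = restr Q f (at_elem \<theta> (Cod C f) x)"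
    if f: "f \<in> Arr C" and x: "x \<in> FOb P (Cod C f)"
  proof -
    have "Comp Set_cat (FOb P (Dom C f), FOb Q (Dom C f), at_elem \<theta> (Dom C f))
        (FOb P (Cod C f), FOb P (Dom C f), restr P f)
      = Comp Set_cat (FOb Q (Cod C f), FOb Q (Dom C f), restr Q f)
        (FOb P (Cod C f), FOb Q (Cod C f), at_elem \<theta> (Cod C f))"
      using naturality_Arr[of f] \<theta>[of "Dom C f"] \<theta>[of "Cod C f"] f
        presheaf_elem(2)[OF F.cat_functor_axioms f] presheaf_elem(2)[OF G.cat_functor_axioms f] by simp
    then show ?thesis using x by (auto simp: fun_eq_iff restrict_def split: if_splits)
  qed
qed

lemma presheaf_map_eqI:
  fixes C :: "('u, 'u) cat"
  assumes "nat_trans (op_cat C) Set_cat P Q \<theta>" "nat_trans (op_cat C) Set_cat P Q \<theta>'" "category C"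
    and "\<And>c x. c \<in> Obj C \<Longrightarrow> x \<in> FOb P c \<Longrightarrow> at_elem \<theta> c x = at_elem \<theta>' c x"
  shows "\<theta> = \<theta>'"
proof (rule extensionalityI)
  show "\<theta> \<in> extensional (Obj C)" "\<theta>' \<in> extensional (Obj C)"
    using nat_trans.ext[OF assms(1)] nat_trans.ext[OF assms(2)] by simp_all
  fix c assume c: "c \<in> Obj C"
  have "at_elem \<theta> c = at_elem \<theta>' c"
    by (rule PiE_ext[OF presheaf_map_elem(2)[OF assms(1,3) c] presheaf_map_elem(2)[OF assms(2,3) c]])
      (use assms(4) c in auto)
  then show "\<theta> c = \<theta>' c"
    using presheaf_map_elem(1)[OF assms(1,3) c] presheaf_map_elem(1)[OF assms(2,3) c] by simp
qed

lemma at_elem_comp_nat: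
  fixes C :: "('u, 'u) cat"
  assumes "nat_trans (op_cat C) Set_cat P Q \<sigma>" "nat_trans (op_cat C) Set_cat Q R \<tau>" "category C"
    "c \<in> Obj C" "x \<in> FOb P c"
  shows "at_elem (comp_nat (op_cat C) Set_cat \<tau> \<sigma>) c x = at_elem \<tau> c (at_elem \<sigma> c x)"
proof -
  have "comp_nat (op_cat C) Set_cat \<tau> \<sigma> c = Comp Set_cat (\<tau> c) (\<sigma> c)"
    using assms(4) by (simp add: comp_nat_def)
  also have "\<dots> = (FOb P c, FOb R c, \<lambda>x\<in>FOb P c. at_elem \<tau> c (at_elem \<sigma> c x))"
    by (subst presheaf_map_elem(1)[OF assms(1,3,4)], subst presheaf_map_elem(1)[OF assms(2,3,4)]) simp
  finally show ?thesis using assms(5) by (simp add: at_elem_def[of "comp_nat _ _ _ _"])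
qed

lemma sheaf_cat_simps [simp]:
  "Obj (sheaf_cat C J) = {P. is_sheaf C J P}"
  "(P, Q, \<theta>) \<in> Arr (sheaf_cat C J) \<longleftrightarrow>
    is_sheaf C J P \<and> is_sheaf C J Q \<and> nat_trans (op_cat C) Set_cat P Q \<theta>"
  "Dom (sheaf_cat C J) (P, Q, \<theta>) = P" "Cod (sheaf_cat C J) (P, Q, \<theta>) = Q"
  "Comp (sheaf_cat C J) (Q, R, \<tau>) (P, Q', \<sigma>) = (P, R, comp_nat (op_cat C) Set_cat \<tau> \<sigma>)"
  by (auto simp: sheaf_cat_def full_subcat_def functor_cat_def is_sheaf_def)

lemma covering_sieve:
  assumes "grothendieck_topology C J" "c \<in> Obj C" "S \<in> J c" "f \<in> S"
  shows "f \<in> Arr C" "Cod C f = c" "g \<in> Arr C \<Longrightarrow> Cod C g = Dom C f \<Longrightarrow> Comp C f g \<in> S"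
proof -
  have sieve: "is_sieve C c S"
    using assms(1)[unfolded grothendieck_topology_def, THEN conjunct1] assms(2,3) by blast
  then show "f \<in> Arr C" "Cod C f = c" using assms(4) unfolding is_sieve_def by blast+
  show "Comp C f g \<in> S" if "g \<in> Arr C" "Cod C g = Dom C f"
    using sieve[unfolded is_sieve_def, THEN conjunct2] assms(4) that by blast
qed

lemma sheaf_amalgamation:
  assumes "is_sheaf C J P" "c \<in> Obj C" "S \<in> J c" "\<And>f. f \<in> S \<Longrightarrow> x f \<in> FOb P (Dom C f)"
    "\<And>f g. f \<in> S \<Longrightarrow> g \<in> Arr C \<Longrightarrow> Cod C g = Dom C f \<Longrightarrow> restr P g (x f) = x (Comp C f g)"
  shows "\<exists>!y. y \<in> FOb P c \<and> (\<forall>f\<in>S. restr P f y = x f)"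
  by (rule assms(1)[unfolded is_sheaf_def, THEN conjunct2, THEN bspec, OF assms(2), THEN bspec,
        OF assms(3), THEN spec, THEN mp])
    (intro conjI ballI impI assms(4,5))

text \<open>Both elements amalgamate the family of restrictions of \<open>y\<close>.\<close>

lemma sheaf_separated:
  assumes P: "is_sheaf C J P" and C: "category C" and J: "grothendieck_topology C J"
    and c: "c \<in> Obj C" and S: "S \<in> J c" and yz: "y \<in> FOb P c" "z \<in> FOb P c"
    and eq: "\<And>f. f \<in> S \<Longrightarrow> restr P f y = restr P f z"
  shows "y = z"
proof -
  interpret category C by fact
  have P': "cat_functor (op_cat C) Set_cat P" using P by (simp add: is_sheaf_def)
  note cov = covering_sieve[OF J c S]
  have "\<exists>!y'. y' \<in> FOb P c \<and> (\<forall>f\<in>S. restr P f y' = restr P f y)"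
  proof (rule sheaf_amalgamation[OF P c S])
    fix f assume f: "f \<in> S"
    show "restr P f y \<in> FOb P (Dom C f)"
      using presheaf_elem(4)[OF P'] cov(1,2)[OF f] yz by auto
    fix g assume "g \<in> Arr C" "Cod C g = Dom C f"
    then show "restr P g (restr P f y) = restr P (Comp C f g) y"
      using presheaf_elem(6)[OF P', of g f y] cov(1,2)[OF f] yz by simp
  qed
  then show ?thesis using yz eq by (metis (no_types, lifting))
qed

text \<open>The constant presheaf with one element is a sheaf.\<close>

lemma sheaf_category_terminal_object:
  fixes C :: "('u, 'u) cat"
  assumes inf: "infinite (UNIV :: 'u set)" and C: "category C"
    and J: "grothendieck_topology C J"
  shows "\<exists>t. terminal_object (sheaf_cat C J) t"
proof -
  interpret C: category C by fact
  \<comment> \<open>An arbitrary element of the universe.\<close>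
  define z :: 'u where "z = undefined"
  define T where "T = presheaf_of C (\<lambda>_. {z}) (\<lambda>_ _. z)"
  have T: "cat_functor (op_cat C) Set_cat T"
    unfolding T_def by (rule presheaf_of_functor) (auto simp: C small_finite[OF inf])
  have TO: "\<And>c. c \<in> Obj C \<Longrightarrow> FOb T c = {z}" by (simp add: T_def)
  have sheaf: "is_sheaf C J T"
    unfolding is_sheaf_def
  proof (intro conjI T ballI allI impI)
    fix c S x assume c: "c \<in> Obj C" and S: "S \<in> J c"
      and x: "(\<forall>f\<in>S. x f \<in> FOb T (Dom C f)) \<and>
        (\<forall>f\<in>S. \<forall>g\<in>Arr C. Cod C g = Dom C f \<longrightarrow> restr T g (x f) = x (Comp C f g))"
    show "\<exists>!y. y \<in> FOb T c \<and> (\<forall>f\<in>S. restr T f y = x f)"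
    proof (rule ex1I)
      have "f \<in> Arr C \<and> Cod C f = c \<and> x f = z" if f: "f \<in> S" for f
      proof -
        have "f \<in> Arr C" "Cod C f = c" using covering_sieve[OF J c S f] by auto
        moreover have "x f \<in> FOb T (Dom C f)" using x f by blast
        ultimately show ?thesis by (simp add: TO)
      qed
      then show "z \<in> FOb T c \<and> (\<forall>f\<in>S. restr T f z = x f)"
        using c by (auto simp: T_def)
    qed (use c TO in auto)
  qed
  have "\<exists>!h. h \<in> hom (sheaf_cat C J) P T" if P: "is_sheaf C J P" for P
  proof -
    have P': "cat_functor (op_cat C) Set_cat P" using P by (simp add: is_sheaf_def)
    have m: "nat_trans (op_cat C) Set_cat P T (presheaf_map_of C P T (\<lambda>_ _. z))"
      by (rule presheaf_map_of_nat_trans[OF P' T C]) (auto simp: TO, auto simp: T_def)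
    show ?thesis
    proof (rule ex1I)
      show "(P, T, presheaf_map_of C P T (\<lambda>_ _. z)) \<in> hom (sheaf_cat C J) P T"
        using P sheaf m by (simp add: hom_iff)
    next
      fix h assume "h \<in> hom (sheaf_cat C J) P T"
      then obtain \<theta> where h: "h = (P, T, \<theta>)" and \<theta>: "nat_trans (op_cat C) Set_cat P T \<theta>"
        by (cases h) (auto simp: hom_iff)
      have "\<theta> = presheaf_map_of C P T (\<lambda>_ _. z)"
        by (rule presheaf_map_eqI[OF \<theta> m C]) (use presheaf_map_elem(3)[OF \<theta> C] TO in auto)
      then show "h = (P, T, presheaf_map_of C P T (\<lambda>_ _. z))" using h by simp
    qed
  qed
  then have "terminal_object (sheaf_cat C J) T"
    using sheaf by (auto simp: terminal_object_def)
  then show ?thesis by blast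
qed


text \<open>The pullback is formed pointwise. Its values must again be subsets of the universe, so pairs are
  coded by an injection \<open>pr\<close> of \<open>'u \<times> 'u\<close> into \<open>'u\<close>. It is a sheaf because both components of a
  matching family of pairs amalgamate, and their images in the third sheaf agree locally, hence
  globally.\<close>

lemma sheaf_category_has_pullbacks:
  fixes C :: "('u, 'u) cat"
  assumes inf: "infinite (UNIV :: 'u set)" and C: "category C"
    and J: "grothendieck_topology C J"
  shows "has_pullbacks (sheaf_cat C J)"
  unfolding has_pullbacks_def
proof (intro ballI impI)
  interpret C: category C by fact
  have "(UNIV :: 'u set) \<times> (UNIV :: 'u set) \<approx> (UNIV :: 'u set)"
    unfolding eqpoll_iff_card_of_ordIso by (rule card_of_Times_same_infinite[OF inf])
  then obtain pr :: "'u \<times> 'u \<Rightarrow> 'u" where pr: "inj pr"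
    unfolding eqpoll_def bij_betw_def by auto
  define lft where "lft z = fst (inv pr z)" for z
  define rgt where "rgt z = snd (inv pr z)" for z
  have lr [simp]: "lft (pr (a, b)) = a" "rgt (pr (a, b)) = b" for a b
    using pr by (simp_all add: lft_def rgt_def)
  fix f g assume f: "f \<in> Arr (sheaf_cat C J)" and g: "g \<in> Arr (sheaf_cat C J)"
    and fg: "Cod (sheaf_cat C J) f = Cod (sheaf_cat C J) g"
  obtain P R \<alpha> where f_eq: "f = (P, R, \<alpha>)" by (cases f)
  obtain Q \<beta> where g_eq: "g = (Q, R, \<beta>)" using fg f_eq by (cases g) auto
  have sh: "is_sheaf C J P" "is_sheaf C J Q" "is_sheaf C J R"
    and \<alpha>: "nat_trans (op_cat C) Set_cat P R \<alpha>" and \<beta>: "nat_trans (op_cat C) Set_cat Q R \<beta>"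
    using f g f_eq g_eq by auto
  have P: "cat_functor (op_cat C) Set_cat P" and Q: "cat_functor (op_cat C) Set_cat Q"
    and R: "cat_functor (op_cat C) Set_cat R"
    using sh by (simp_all add: is_sheaf_def)
  note P_elem = presheaf_elem[OF P] and Q_elem = presheaf_elem[OF Q]
  note \<alpha>_elem = presheaf_map_elem[OF \<alpha> C] and \<beta>_elem = presheaf_map_elem[OF \<beta> C]
  define N where "N c = {z. \<exists>a b. z = pr (a, b) \<and> a \<in> FOb P c \<and> b \<in> FOb Q c \<and>
    at_elem \<alpha> c a = at_elem \<beta> c b}" for c
  define r where "r h z = pr (restr P h (lft z), restr Q h (rgt z))" for h z
  define M where "M = presheaf_of C N r"
  have N_I: "pr (a, b) \<in> N c"
    if "a \<in> FOb P c" "b \<in> FOb Q c" "at_elem \<alpha> c a = at_elem \<beta> c b" for a b c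
    using that by (auto simp: N_def)
  have N_D: "lft z \<in> FOb P c" "rgt z \<in> FOb Q c" "at_elem \<alpha> c (lft z) = at_elem \<beta> c (rgt z)"
    "pr (lft z, rgt z) = z" if "z \<in> N c" for z c
    using that by (auto simp: N_def)
  have M: "cat_functor (op_cat C) Set_cat M"
    unfolding M_def
  proof (rule presheaf_of_functor[OF C])
    fix c assume c: "c \<in> Obj C"
    have "FOb P c \<times> FOb Q c \<prec> (UNIV :: 'u set)"
      using inf P_elem(1)[OF c] Q_elem(1)[OF c] unfolding small_def by (rule lesspoll_Times)
    then have "small (pr ` (FOb P c \<times> FOb Q c))"
      unfolding small_def by (rule lesspoll_trans1[OF image_lepoll])
    then show "small (N c)"
      by (rule small_subset) (auto simp: N_def)
  next
    fix h z assume h: "h \<in> Arr C" and z: "z \<in> N (Cod C h)"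
    show "r h z \<in> N (Dom C h)"
      unfolding r_def using h N_D[OF z] P_elem(4)[OF h] Q_elem(4)[OF h] \<alpha>_elem(4)[OF h] \<beta>_elem(4)[OF h]
      by (intro N_I) auto
  qed (auto simp: r_def N_D P_elem(5,6) Q_elem(5,6))
  have MO [simp]: "FOb M c = N c" if "c \<in> Obj C" for c
    using that by (simp add: M_def)
  have Mr [simp]: "restr M h z = r h z" if "h \<in> Arr C" "z \<in> N (Cod C h)" for h z
    using that by (simp add: M_def)
  have M_sheaf: "is_sheaf C J M"
    unfolding is_sheaf_def
  proof (intro conjI M ballI allI impI)
    fix c S x assume c: "c \<in> Obj C" and S: "S \<in> J c"
      and x: "(\<forall>f\<in>S. x f \<in> FOb M (Dom C f)) \<and>
        (\<forall>f\<in>S. \<forall>g\<in>Arr C. Cod C g = Dom C f \<longrightarrow> restr M g (x f) = x (Comp C f g))"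
    note cov = covering_sieve[OF J c S]
    have xN: "x h \<in> N (Dom C h)" if h: "h \<in> S" for h
      using x h cov(1)[OF h] by force
    have x_match: "r k (x h) = x (Comp C h k)" if "h \<in> S" "k \<in> Arr C" "Cod C k = Dom C h" for h k
      using x that xN[of h] by force
    have "\<exists>!a. a \<in> FOb P c \<and> (\<forall>h\<in>S. restr P h a = lft (x h))"
    proof (rule sheaf_amalgamation[OF sh(1) c S])
      show "restr P k (lft (x h)) = lft (x (Comp C h k))"
        if "h \<in> S" "k \<in> Arr C" "Cod C k = Dom C h" for h k
        unfolding x_match[OF that, symmetric] by (simp add: r_def)
    qed (rule N_D(1)[OF xN])
    then obtain a where a: "a \<in> FOb P c" "\<And>h. h \<in> S \<Longrightarrow> restr P h a = lft (x h)"
      and a_uniq: "\<And>a'. a' \<in> FOb P c \<Longrightarrow> (\<forall>h\<in>S. restr P h a' = lft (x h)) \<Longrightarrow> a' = a"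
      by blast
    have "\<exists>!b. b \<in> FOb Q c \<and> (\<forall>h\<in>S. restr Q h b = rgt (x h))"
    proof (rule sheaf_amalgamation[OF sh(2) c S])
      show "restr Q k (rgt (x h)) = rgt (x (Comp C h k))"
        if "h \<in> S" "k \<in> Arr C" "Cod C k = Dom C h" for h k
        unfolding x_match[OF that, symmetric] by (simp add: r_def)
    qed (rule N_D(2)[OF xN])
    then obtain b where b: "b \<in> FOb Q c" "\<And>h. h \<in> S \<Longrightarrow> restr Q h b = rgt (x h)"
      and b_uniq: "\<And>b'. b' \<in> FOb Q c \<Longrightarrow> (\<forall>h\<in>S. restr Q h b' = rgt (x h)) \<Longrightarrow> b' = b"
      by blast
    have "at_elem \<alpha> c a = at_elem \<beta> c b"
    proof (rule sheaf_separated[OF sh(3) C J c S])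
      fix h assume h: "h \<in> S"
      have "restr R h (at_elem \<alpha> c a) = at_elem \<alpha> (Dom C h) (lft (x h))"
        using \<alpha>_elem(4)[of h a] cov(1,2)[OF h] a h by simp
      also have "\<dots> = at_elem \<beta> (Dom C h) (rgt (x h))" by (rule N_D(3)[OF xN[OF h]])
      also have "\<dots> = restr R h (at_elem \<beta> c b)"
        using \<beta>_elem(4)[of h b] cov(1,2)[OF h] b h by simp
      finally show "restr R h (at_elem \<alpha> c a) = restr R h (at_elem \<beta> c b)" .
    qed (use \<alpha>_elem(3) \<beta>_elem(3) a b c in auto)
    then have ab: "pr (a, b) \<in> N c" using a(1) b(1) by (intro N_I)
    show "\<exists>!y. y \<in> FOb M c \<and> (\<forall>f\<in>S. restr M f y = x f)"
    proof (rule ex1I)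
      have "restr M h (pr (a, b)) = x h" if h: "h \<in> S" for h
        using cov(1,2)[OF h] ab a(2)[OF h] b(2)[OF h] N_D(4)[OF xN[OF h]] by (simp add: r_def)
      then show "pr (a, b) \<in> FOb M c \<and> (\<forall>f\<in>S. restr M f (pr (a, b)) = x f)"
        using ab c by simp
    next
      fix y assume y: "y \<in> FOb M c \<and> (\<forall>f\<in>S. restr M f y = x f)"
      then have yN: "y \<in> N c" using c by simp
      have "r h y = x h" if h: "h \<in> S" for h
        using y h cov(1,2)[OF h] yN by force
      then have "restr P h (lft y) = lft (x h)" "restr Q h (rgt y) = rgt (x h)" if "h \<in> S" for h
        using that by (metis lr r_def)+
      then have "lft y = a" "rgt y = b"
        using a_uniq b_uniq N_D[OF yN] by blast+
      then show "y = pr (a, b)" using N_D(4)[OF yN] by simp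
    qed
  qed
  define p where "p = presheaf_map_of C M P (\<lambda>_. lft)"
  define q where "q = presheaf_map_of C M Q (\<lambda>_. rgt)"
  have p: "nat_trans (op_cat C) Set_cat M P p"
    unfolding p_def by (rule presheaf_map_of_nat_trans[OF M P C]) (auto simp: N_D r_def)
  have q: "nat_trans (op_cat C) Set_cat M Q q"
    unfolding q_def by (rule presheaf_map_of_nat_trans[OF M Q C]) (auto simp: N_D r_def)
  have p_elem: "at_elem p c z = lft z" and q_elem: "at_elem q c z = rgt z"
    if "c \<in> Obj C" "z \<in> N c" for c z
    using that by (simp_all add: p_def q_def)
  have "pullback_square (sheaf_cat C J) f g (M, P, p) (M, Q, q)"
    unfolding pullback_square_def
  proof (intro conjI ballI impI)
    have "comp_nat (op_cat C) Set_cat \<alpha> p = comp_nat (op_cat C) Set_cat \<beta> q"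
      by (rule presheaf_map_eqI[OF comp_nat_trans[OF p \<alpha>] comp_nat_trans[OF q \<beta>] C])
        (simp add: at_elem_comp_nat[OF p \<alpha> C] at_elem_comp_nat[OF q \<beta> C] p_elem q_elem N_D)
    then show "Comp (sheaf_cat C J) f (M, P, p) = Comp (sheaf_cat C J) g (M, Q, q)"
      by (simp add: f_eq g_eq)
  next
    fix u v assume u: "u \<in> Arr (sheaf_cat C J)" and v: "v \<in> Arr (sheaf_cat C J)"
      and uv: "Dom (sheaf_cat C J) u = Dom (sheaf_cat C J) v \<and>
        Cod (sheaf_cat C J) u = Dom (sheaf_cat C J) f \<and> Cod (sheaf_cat C J) v = Dom (sheaf_cat C J) g \<and>
        Comp (sheaf_cat C J) f u = Comp (sheaf_cat C J) g v"
    obtain K \<sigma> where u_eq: "u = (K, P, \<sigma>)" using uv f_eq by (cases u) auto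
    obtain \<tau> where v_eq: "v = (K, Q, \<tau>)" using uv g_eq u_eq by (cases v) auto
    have K_sheaf: "is_sheaf C J K" and \<sigma>: "nat_trans (op_cat C) Set_cat K P \<sigma>"
      and \<tau>: "nat_trans (op_cat C) Set_cat K Q \<tau>"
      using u v u_eq v_eq by auto
    have K: "cat_functor (op_cat C) Set_cat K" using K_sheaf by (simp add: is_sheaf_def)
    note \<sigma>_elem = presheaf_map_elem[OF \<sigma> C] and \<tau>_elem = presheaf_map_elem[OF \<tau> C]
    have comm: "comp_nat (op_cat C) Set_cat \<alpha> \<sigma> = comp_nat (op_cat C) Set_cat \<beta> \<tau>"
      using uv by (simp add: u_eq v_eq f_eq g_eq)
    have pair: "pr (at_elem \<sigma> c x, at_elem \<tau> c x) \<in> N c" if "c \<in> Obj C" "x \<in> FOb K c" for c x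
      using at_elem_comp_nat[OF \<sigma> \<alpha> C that] at_elem_comp_nat[OF \<tau> \<beta> C that] \<sigma>_elem(3)[OF that]
        \<tau>_elem(3)[OF that] by (intro N_I) (simp_all add: comm)
    define m where "m = presheaf_map_of C K M (\<lambda>c x. pr (at_elem \<sigma> c x, at_elem \<tau> c x))"
    have m: "nat_trans (op_cat C) Set_cat K M m"
      unfolding m_def
      by (rule presheaf_map_of_nat_trans[OF K M C]) (auto simp: pair r_def \<sigma>_elem(4) \<tau>_elem(4))
    have m_elem: "at_elem m c x = pr (at_elem \<sigma> c x, at_elem \<tau> c x)"
      if "c \<in> Obj C" "x \<in> FOb K c" for c x
      using that by (simp add: m_def)
    show "\<exists>!h. h \<in> hom (sheaf_cat C J) (Dom (sheaf_cat C J) u) (Dom (sheaf_cat C J) (M, P, p)) \<and>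
      Comp (sheaf_cat C J) (M, P, p) h = u \<and> Comp (sheaf_cat C J) (M, Q, q) h = v"
    proof (rule ex1I)
      have "comp_nat (op_cat C) Set_cat p m = \<sigma>"
        by (rule presheaf_map_eqI[OF comp_nat_trans[OF m p] \<sigma> C])
          (simp add: at_elem_comp_nat[OF m p C] m_elem p_elem pair)
      moreover have "comp_nat (op_cat C) Set_cat q m = \<tau>"
        by (rule presheaf_map_eqI[OF comp_nat_trans[OF m q] \<tau> C])
          (simp add: at_elem_comp_nat[OF m q C] m_elem q_elem pair)
      ultimately show "(K, M, m) \<in> hom (sheaf_cat C J) (Dom (sheaf_cat C J) u) (Dom (sheaf_cat C J) (M, P, p)) \<and>
        Comp (sheaf_cat C J) (M, P, p) (K, M, m) = u \<and> Comp (sheaf_cat C J) (M, Q, q) (K, M, m) = v"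
        using K_sheaf M_sheaf m by (simp add: hom_iff u_eq v_eq)
    next
      fix h assume h: "h \<in> hom (sheaf_cat C J) (Dom (sheaf_cat C J) u) (Dom (sheaf_cat C J) (M, P, p)) \<and>
        Comp (sheaf_cat C J) (M, P, p) h = u \<and> Comp (sheaf_cat C J) (M, Q, q) h = v"
      then obtain n where h_eq: "h = (K, M, n)" and n: "nat_trans (op_cat C) Set_cat K M n"
        by (cases h) (auto simp: hom_iff u_eq)
      have pn: "comp_nat (op_cat C) Set_cat p n = \<sigma>" and qn: "comp_nat (op_cat C) Set_cat q n = \<tau>"
        using h by (simp_all add: h_eq u_eq v_eq)
      have "n = m"
      proof (rule presheaf_map_eqI[OF n m C])
        fix c x assume cx: "c \<in> Obj C" "x \<in> FOb K c"
        have nN: "at_elem n c x \<in> N c" using presheaf_map_elem(3)[OF n C cx] cx by simp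
        have "lft (at_elem n c x) = at_elem \<sigma> c x" "rgt (at_elem n c x) = at_elem \<tau> c x"
          using at_elem_comp_nat[OF n p C cx] at_elem_comp_nat[OF n q C cx]
          by (simp_all add: pn qn p_elem q_elem cx nN)
        then show "at_elem n c x = at_elem m c x"
          using N_D(4)[OF nN] by (simp add: m_elem cx)
      qed
      then show "h = (K, M, m)" by (simp add: h_eq)
    qed
  qed (use sh M_sheaf p q in \<open>simp_all add: f_eq g_eq\<close>)
  then show "\<exists>p q. pullback_square (sheaf_cat C J) f g p q" by blast
qed

lemma topos_finite_limits:
  assumes "universe TYPE('u)" "grothendieck_topos TYPE('u) E"
  shows "category E" "has_pullbacks E" "\<exists>t. terminal_object E t"
proof -
  obtain C :: "('u, 'u) cat" and J where C: "category C" and J: "grothendieck_topology C J"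
    and E: "equivalent_categories E (sheaf_cat C J)"
    using assms(2) unfolding grothendieck_topos_def small_site_def by blast
  have inf: "infinite (UNIV :: 'u set)" using assms(1) by (simp add: universe_def)
  show "category E" using assms(2) by (simp add: grothendieck_topos_def)
  obtain H where H: "cat_functor E (sheaf_cat C J) H" "full_functor E (sheaf_cat C J) H"
    "faithful_functor E (sheaf_cat C J) H" "essentially_surjective E (sheaf_cat C J) H"
    using equivalence_is_fully_faithful[OF E] by blast
  show "has_pullbacks E"
    using equivalence_reflects_pullbacks[OF H sheaf_category_has_pullbacks[OF inf C J]] .
  show "\<exists>t. terminal_object E t"
    using sheaf_category_terminal_object[OF inf C J] equivalence_reflects_terminal_object[OF H] by blast
qed


section \<open>Slices and the canonical stack\<close>

lemma slice_simps [simp]: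
  "x \<in> Obj (slice_cat E X) \<longleftrightarrow> x \<in> Arr E \<and> Cod E x = X"
  "(x, y, h) \<in> Arr (slice_cat E X) \<longleftrightarrow> x \<in> Arr E \<and> Cod E x = X \<and> y \<in> Arr E \<and> Cod E y = X \<and>
     h \<in> Arr E \<and> Dom E h = Dom E x \<and> Cod E h = Dom E y \<and> Comp E y h = x"
  "Dom (slice_cat E X) (x, y, h) = x"
  "Cod (slice_cat E X) (x, y, h) = y"
  "Idn (slice_cat E X) x = (x, x, Idn E (Dom E x))"
  "Comp (slice_cat E X) (y, z, k) (x, y', h) = (x, z, Comp E k h)"
  by (auto simp: slice_cat_def hom_iff)

lemma slice_category:
  assumes "category E"
  shows "category (slice_cat E X)"
proof -
  interpret category E by fact
  let ?S = "slice_cat E X"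
  show ?thesis
  proof (rule categoryI)
    fix u v w assume u: "u \<in> Arr ?S"
    obtain x y h where u_eq: "u = (x, y, h)" by (metis surj_pair)
    show "Dom ?S u \<in> Obj ?S \<and> Cod ?S u \<in> Obj ?S" using u by (simp add: u_eq)
    show "Comp ?S u (Idn ?S (Dom ?S u)) = u \<and> Comp ?S (Idn ?S (Cod ?S u)) u = u"
      using u by (simp add: u_eq)
    assume v: "v \<in> Arr ?S" "Dom ?S v = Cod ?S u"
    then obtain z k where v_eq: "v = (y, z, k)" by (cases v) (simp add: u_eq)
    have "Comp E z (Comp E k h) = Comp E (Comp E z k) h"
      by (rule assoc[symmetric]) (use u v in \<open>simp_all add: u_eq v_eq\<close>)
    also have "\<dots> = x" using u v by (simp del: assoc add: u_eq v_eq)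
    finally show "Comp ?S v u \<in> Arr ?S \<and> Dom ?S (Comp ?S v u) = Dom ?S u \<and>
      Cod ?S (Comp ?S v u) = Cod ?S v"
      using u v by (simp add: u_eq v_eq)
    assume w: "w \<in> Arr ?S" "Dom ?S w = Cod ?S v"
    then obtain z' l where "w = (z, z', l)" by (cases w) (simp add: v_eq)
    then show "Comp ?S w (Comp ?S v u) = Comp ?S (Comp ?S w v) u"
      using u v w by (simp add: u_eq v_eq)
  qed simp
qed

lemma stack_objs_iff [simp]:
  "(A, x) \<in> stack_objs E F f \<longleftrightarrow> A \<in> Obj F \<and> x \<in> Arr E \<and> Cod E x = FOb (inv_im f) A"
  by (simp add: stack_objs_def)

lemma stack_simps [simp]:
  "Obj (canonical_stack E F f) = stack_objs E F f"
  "((A, x), (B, y), (g, h)) \<in> Arr (canonical_stack E F f) \<longleftrightarrow>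
    (A, x) \<in> stack_objs E F f \<and> (B, y) \<in> stack_objs E F f \<and> g \<in> Arr F \<and> Dom F g = A \<and> Cod F g = B \<and>
    h \<in> Arr E \<and> Dom E h = Dom E x \<and> Cod E h = Dom E y \<and>
    Comp E y h = Comp E (FAr (inv_im f) g) x"
  "Dom (canonical_stack E F f) (u, v, gh) = u"
  "Cod (canonical_stack E F f) (u, v, gh) = v"
  "Idn (canonical_stack E F f) (A, x) = ((A, x), (A, x), (Idn F A, Idn E (Dom E x)))"
  "Comp (canonical_stack E F f) (v, w, (g', h')) (u, v', (g, h))
    = (u, w, (Comp F g' g, Comp E h' h))"
  by (auto simp: canonical_stack_def hom_iff)

lemma stack_category:
  assumes "cat_functor F E (inv_im f)"
  shows "category (canonical_stack E F f)"
proof -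
  interpret cat_functor F E "inv_im f" by fact
  let ?S = "canonical_stack E F f"
  show ?thesis
  proof (rule categoryI)
    fix s assume "s \<in> Obj ?S"
    then show "Idn ?S s \<in> Arr ?S \<and> Dom ?S (Idn ?S s) = s \<and> Cod ?S (Idn ?S s) = s"
      by (cases s) simp
  next
    fix u v w assume u: "u \<in> Arr ?S"
    obtain A x B y g h where u_eq: "u = ((A, x), (B, y), (g, h))" by (metis surj_pair)
    show "Dom ?S u \<in> Obj ?S \<and> Cod ?S u \<in> Obj ?S" using u by (simp add: u_eq)
    show "Comp ?S u (Idn ?S (Dom ?S u)) = u \<and> Comp ?S (Idn ?S (Cod ?S u)) u = u"
      using u by (simp add: u_eq)
    assume v: "v \<in> Arr ?S" "Dom ?S v = Cod ?S u"
    then obtain C z g' h' where v_eq: "v = ((B, y), (C, z), (g', h'))"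
      by (cases v) (auto simp: u_eq)
    have "Comp E z (Comp E h' h) = Comp E (FAr (inv_im f) g') (Comp E y h)"
      using u v by (intro target.Comp_eq_whisker) (simp_all add: u_eq v_eq)
    then show "Comp ?S v u \<in> Arr ?S \<and> Dom ?S (Comp ?S v u) = Dom ?S u \<and>
      Cod ?S (Comp ?S v u) = Cod ?S v"
      using u v by (simp add: u_eq v_eq FAr_Comp_simp)
    assume w: "w \<in> Arr ?S" "Dom ?S w = Cod ?S v"
    then obtain D z' g'' h'' where "w = ((C, z), (D, z'), (g'', h''))"
      by (cases w) (auto simp: v_eq)
    then show "Comp ?S w (Comp ?S v u) = Comp ?S (Comp ?S w v) u"
      using u v w by (simp add: u_eq v_eq)
  qed
qed

lemma stack_proj_simps [simp]:
  "u \<in> stack_objs E F f \<Longrightarrow> FOb (stack_proj E F f) u = fst u"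
  "(u, v, (g, h)) \<in> Arr (canonical_stack E F f) \<Longrightarrow> FAr (stack_proj E F f) (u, v, (g, h)) = g"
  by (auto simp: stack_proj_def)

lemma stack_proj_functor:
  assumes "cat_functor F E (inv_im f)"
  shows "cat_functor (canonical_stack E F f) F (stack_proj E F f)"
proof -
  interpret cat_functor F E "inv_im f" by fact
  interpret S: category "canonical_stack E F f" using assms by (rule stack_category)
  let ?S = "canonical_stack E F f" and ?p = "stack_proj E F f"
  show ?thesis
  proof (rule cat_functorI)
    show "category ?S" "category F" by (fact S.category_axioms source.category_axioms)+
    show "FOb ?p \<in> extensional (Obj ?S)" "FAr ?p \<in> extensional (Arr ?S)"
      by (auto simp: stack_proj_def)
    show "FOb ?p s \<in> Obj F" if "s \<in> Obj ?S" for s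
      using that by (cases s) simp
    show "FAr ?p (Idn ?S s) = Idn F (FOb ?p s)" if "s \<in> Obj ?S" for s
      using that by (cases s) simp
    fix u assume u: "u \<in> Arr ?S"
    obtain A x B y g h where u_eq: "u = ((A, x), (B, y), (g, h))" by (metis surj_pair)
    show "FAr ?p u \<in> Arr F \<and> Dom F (FAr ?p u) = FOb ?p (Dom ?S u) \<and>
      Cod F (FAr ?p u) = FOb ?p (Cod ?S u)"
      using u by (simp add: u_eq)
    fix v assume v: "v \<in> Arr ?S" "Dom ?S v = Cod ?S u"
    obtain C z g' h' where v_eq: "v = ((B, y), (C, z), (g', h'))"
      using v by (cases v) (auto simp: u_eq)
    have "Comp ?S v u \<in> Arr ?S" using u v by simp
    then show "FAr ?p (Comp ?S v u) = Comp F (FAr ?p v) (FAr ?p u)"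
      using u v stack_proj_simps(2)[of "(A, x)" "(C, z)" "Comp F g' g" "Comp E h' h" E F f]
      by (simp add: u_eq v_eq del: stack_simps(2))
  qed
qed

text \<open>Over \<open>g\<close>, the arrow \<open>(g, id) : (A, x) \<rightarrow> (B, f\<^sup>*g \<circ> x)\<close> is cocartesian, and any other
  cocartesian arrow with the same source differs from it by an isomorphism of the target.\<close>

lemma cocartesian_iff_is_iso:
  assumes "cat_functor F E (inv_im f)" and u: "((A, x), (B, y), (g, h)) \<in> Arr (canonical_stack E F f)"
  shows "cocartesian (canonical_stack E F f) F (stack_proj E F f) ((A, x), (B, y), (g, h)) \<longleftrightarrow> is_iso E h"
    (is "cocartesian ?S F ?p ?u \<longleftrightarrow> _")
proof -
  interpret cat_functor F E "inv_im f" by fact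
  have A: "A \<in> Obj F" and x: "x \<in> Arr E" "Cod E x = FOb (inv_im f) A"
    and B: "B \<in> Obj F" and y: "y \<in> Arr E" "Cod E y = FOb (inv_im f) B"
    and g: "g \<in> Arr F" "Dom F g = A" "Cod F g = B"
    and h: "h \<in> Arr E" "Dom E h = Dom E x" "Cod E h = Dom E y"
    and yh: "Comp E y h = Comp E (FAr (inv_im f) g) x"
    using u by auto
  show ?thesis
  proof
    assume iso: "is_iso E h"
    note i = target.inverse_arr[OF iso]
    let ?i = "target.inverse_arr h"
    show "cocartesian ?S F ?p ?u"
      unfolding cocartesian_def
    proof (intro conjI u ballI impI)
      fix w k assume w: "w \<in> Arr ?S" and k: "k \<in> Arr F"
        and wk: "Dom ?S w = Dom ?S ?u \<and> k \<in> hom F (FOb ?p (Cod ?S ?u)) (FOb ?p (Cod ?S w)) \<and>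
          Comp F k (FAr ?p ?u) = FAr ?p w"
      obtain A' x' C z l m where w_eq: "w = ((A', x'), (C, z), (l, m))" by (metis surj_pair)
      have w': "A' = A" "x' = x" "C \<in> Obj F" "z \<in> Arr E" "Cod E z = FOb (inv_im f) C"
        "m \<in> Arr E" "Dom E m = Dom E x" "Cod E m = Dom E z"
        "Comp E z m = Comp E (FAr (inv_im f) l) x"
        using w wk w_eq by auto
      have k': "Dom F k = B" "Cod F k = C" "Comp F k g = l"
        using w wk w_eq u by (auto simp: hom_iff)
      have l: "FAr (inv_im f) l = Comp E (FAr (inv_im f) k) (FAr (inv_im f) g)"
        using k k' g by (simp flip: k'(3) add: FAr_Comp_simp)
      have "Comp E z (Comp E m ?i) = Comp E (FAr (inv_im f) l) (Comp E x ?i)"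
        using w' i k k' g h l x by (intro target.Comp_eq_whisker) auto
      also have "\<dots> = Comp E (FAr (inv_im f) k) (Comp E (FAr (inv_im f) g) (Comp E x ?i))"
        unfolding l using k k' g x i h by simp
      also have "Comp E (FAr (inv_im f) g) (Comp E x ?i) = Comp E y (Comp E h ?i)"
        using yh i g x y h by (intro target.Comp_eq_whisker) auto
      also have "\<dots> = y" using i h y by simp
      finally have zmi: "Comp E z (Comp E m ?i) = Comp E (FAr (inv_im f) k) y" .
      show "\<exists>!v. v \<in> hom ?S (Cod ?S ?u) (Cod ?S w) \<and> FAr ?p v = k \<and> Comp ?S v ?u = w"
      proof (rule ex1I)
        show "((B, y), (C, z), (k, Comp E m ?i)) \<in> hom ?S (Cod ?S ?u) (Cod ?S w) \<and>
          FAr ?p ((B, y), (C, z), (k, Comp E m ?i)) = k \<and>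
          Comp ?S ((B, y), (C, z), (k, Comp E m ?i)) ?u = w"
          using zmi w' k k' i h y B by (simp add: hom_iff w_eq)
      next
        fix v assume v: "v \<in> hom ?S (Cod ?S ?u) (Cod ?S w) \<and> FAr ?p v = k \<and> Comp ?S v ?u = w"
        obtain B' y' C' z' k' n where v_eq: "v = ((B', y'), (C', z'), (k', n))" by (metis surj_pair)
        have v': "B' = B" "y' = y" "C' = C" "z' = z" "k' = k" "n \<in> Arr E" "Dom E n = Dom E y"
          "Comp E n h = m"
          using v by (auto simp: hom_iff v_eq w_eq)
        have "n = Comp E m ?i"
          using v' i h by (simp flip: v'(8))
        then show "v = ((B, y), (C, z), (k, Comp E m ?i))" by (simp add: v_eq v')
      qed
    qed
  next
    assume coc: "cocartesian ?S F ?p ?u"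
    \<comment> \<open>The standard lift \<open>w\<close> of \<open>g\<close> factors as \<open>m \<circ> h\<close> through the given one; \<open>h \<circ> m\<close> and the identity
      both factor \<open>u\<close> through itself.\<close>
    let ?gx = "Comp E (FAr (inv_im f) g) x"
    let ?w = "((A, x), (B, ?gx), (g, Idn E (Dom E x)))"
    have w: "?w \<in> Arr ?S" using A B g x by simp
    have "\<exists>!v. v \<in> hom ?S (Cod ?S ?u) (Cod ?S ?w) \<and> FAr ?p v = Idn F B \<and> Comp ?S v ?u = ?w"
      using coc[unfolded cocartesian_def, THEN conjunct2, rule_format, OF w, of "Idn F B"] u w B g
      by (simp add: hom_iff)
    then obtain v where v: "v \<in> hom ?S (Cod ?S ?u) (Cod ?S ?w)" "FAr ?p v = Idn F B"
      "Comp ?S v ?u = ?w" by blast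
    obtain B1 y1 B2 y2 k m where v_eq: "v = ((B1, y1), (B2, y2), (k, m))" by (metis surj_pair)
    have v_ends: "B1 = B" "y1 = y" "B2 = B" "y2 = ?gx"
      using v(1) by (auto simp: hom_iff v_eq)
    have v_Arr: "((B1, y1), (B2, y2), (k, m)) \<in> Arr ?S"
      using v(1) by (simp only: hom_iff v_eq)
    have k: "k = Idn F B"
      using stack_proj_simps(2)[OF v_Arr] v(2) by (simp only: v_eq)
    have m: "m \<in> Arr E" "Dom E m = Dom E y" "Cod E m = Dom E x" "Comp E ?gx m = y"
      using v(1) g x y B by (auto simp: hom_iff v_eq v_ends k)
    have mh: "Comp E m h = Idn E (Dom E x)"
      using v(3) by (simp add: v_eq)
    have uniq: "\<exists>!v. v \<in> hom ?S (Cod ?S ?u) (Cod ?S ?u) \<and> FAr ?p v = Idn F B \<and> Comp ?S v ?u = ?u"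
      using coc[unfolded cocartesian_def, THEN conjunct2, rule_format, OF u, of "Idn F B"] u B g
      by (simp add: hom_iff)
    have "Comp E y (Comp E h m) = Comp E (FAr (inv_im f) g) (Comp E x m)"
      using yh m x y h g by (intro target.Comp_eq_whisker) auto
    also have "\<dots> = y" using m x g by simp
    finally have yhm: "Comp E y (Comp E h m) = y" .
    have "((B, y), (B, y), (Idn F B, Comp E h m)) = ((B, y), (B, y), (Idn F B, Idn E (Dom E y)))"
    proof (rule ex1E[OF uniq])
      fix v0 assume *: "\<forall>v. v \<in> hom ?S (Cod ?S ?u) (Cod ?S ?u) \<and> FAr ?p v = Idn F B \<and> Comp ?S v ?u = ?u
        \<longrightarrow> v = v0"
      have "((B, y), (B, y), (Idn F B, Comp E h m)) = v0"
        by (rule *[rule_format]) (use yhm mh m h y B g in \<open>simp add: hom_iff\<close>)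
      moreover have "((B, y), (B, y), (Idn F B, Idn E (Dom E y))) = v0"
        by (rule *[rule_format]) (use h y B g in \<open>simp add: hom_iff\<close>)
      ultimately show ?thesis by simp
    qed
    then have "Comp E h m = Idn E (Dom E y)" by simp
    with mh show "is_iso E h"
      by (intro target.is_isoI[of h m]) (use h m in auto)
  qed
qed

text \<open>The inverse of \<open>h\<close> again lies over \<open>id\<close>.\<close>

lemma stack_is_isoI:
  assumes "cat_functor F E (inv_im f)" and u: "((A, x), (A, y), (Idn F A, h)) \<in> Arr (canonical_stack E F f)"
    and iso: "is_iso E h"
  shows "is_iso (canonical_stack E F f) ((A, x), (A, y), (Idn F A, h))"
proof -
  interpret cat_functor F E "inv_im f" by fact
  interpret S: category "canonical_stack E F f" using assms(1) by (rule stack_category)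
  note i = target.inverse_arr[OF iso]
  have A: "A \<in> Obj F" and x: "x \<in> Arr E" "Cod E x = FOb (inv_im f) A"
    and y: "y \<in> Arr E" "Cod E y = FOb (inv_im f) A"
    and h: "h \<in> Arr E" "Dom E h = Dom E x" "Cod E h = Dom E y" and yh: "Comp E y h = x"
    using u by auto
  have "Comp E x (target.inverse_arr h) = Comp E y (Comp E h (target.inverse_arr h))"
    unfolding yh[symmetric] by (rule target.assoc) (use i h y in simp_all)
  then have "Comp E x (target.inverse_arr h) = y" using i h y by simp
  then show ?thesis
    using u A x y h i
    by (intro S.is_isoI[where g = "((A, y), (A, x), (Idn F A, target.inverse_arr h))"]) simp_all
qed

section \<open>The two categories of weak morphisms\<close>

lemma LaxWmor_simps [simp]:
  "Obj (LaxWmor E E' F f f') = {u. lax_wmor_obj E E' F f f' u}"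
  "(u, v, \<theta>) \<in> Arr (LaxWmor E E' F f f') \<longleftrightarrow>
    lax_wmor_obj E E' F f f' u \<and> lax_wmor_obj E E' F f f' v \<and>
    nat_trans E' E (inv_im (fst u)) (inv_im (fst v)) \<theta> \<and>
    (\<forall>X\<in>Obj F. Comp E (snd v X) (\<theta> (FOb (inv_im f') X)) = snd u X)"
  "Dom (LaxWmor E E' F f f') (u, v, \<theta>) = u"
  "Cod (LaxWmor E E' F f f') (u, v, \<theta>) = v"
  "Idn (LaxWmor E E' F f f') u = (u, u, id_nat E' E (inv_im (fst u)))"
  "Comp (LaxWmor E E' F f f') (v, w, \<tau>) (u, v', \<sigma>) = (u, w, comp_nat E' E \<tau> \<sigma>)"
  by (cases u; cases v; auto simp: LaxWmor_def)+

lemma lax_wmor_objD: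
  assumes "lax_wmor_obj E E' F f f' u"
  shows "cat_functor E' E (inv_im (fst u))" "has_couniversal_arrows E' E (inv_im (fst u))"
    "nat_trans F E (comp_ftr F (inv_im (fst u)) (inv_im f')) (inv_im f) (snd u)"
  using assms weak_geometric_morphism_has_couniversal_arrows[of E E' "fst u"]
  by (cases u; simp add: lax_wmor_obj_def weak_geometric_morphism_def)+

lemma LaxWmor_category:
  assumes f': "cat_functor F E' (inv_im f')" and E: "category E"
  shows "category (LaxWmor E E' F f f')" (is "category ?L")
proof (rule categoryI)
  interpret f': cat_functor F E' "inv_im f'" by fact
  interpret E: category E by fact
  fix u v w assume uvw: "u \<in> Arr ?L"
  obtain a b \<theta> where u: "u = (a, b, \<theta>)" by (metis surj_pair)
  show "Comp ?L u (Idn ?L (Dom ?L u)) = u \<and> Comp ?L (Idn ?L (Cod ?L u)) u = u"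
    using uvw comp_nat_units[of E' E "inv_im (fst a)" "inv_im (fst b)" \<theta>] by (simp add: u)
  show "Dom ?L u \<in> Obj ?L \<and> Cod ?L u \<in> Obj ?L" using uvw by (simp add: u)
  assume v: "v \<in> Arr ?L" "Dom ?L v = Cod ?L u"
  then obtain c \<tau> where v_eq: "v = (b, c, \<tau>)" by (cases v) (auto simp: u)
  have \<theta>: "nat_trans E' E (inv_im (fst a)) (inv_im (fst b)) \<theta>"
    and \<tau>: "nat_trans E' E (inv_im (fst b)) (inv_im (fst c)) \<tau>" using uvw v by (simp_all add: u v_eq)
  have "Comp E (snd c X) (comp_nat E' E \<tau> \<theta> (FOb (inv_im f') X)) = snd a X" if X: "X \<in> Obj F" for X
  proof -
    interpret t: nat_trans E' E "inv_im (fst a)" "inv_im (fst b)" \<theta> by fact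
    interpret s: nat_trans E' E "inv_im (fst b)" "inv_im (fst c)" \<tau> by fact
    interpret c: nat_trans F E "comp_ftr F (inv_im (fst c)) (inv_im f')" "inv_im f" "snd c"
      using v by (auto simp: v_eq intro: lax_wmor_objD)
    have "Comp E (snd c X) (Comp E (\<tau> (FOb (inv_im f') X)) (\<theta> (FOb (inv_im f') X)))
      = Comp E (Comp E (snd c X) (\<tau> (FOb (inv_im f') X))) (\<theta> (FOb (inv_im f') X))"
      by (rule E.assoc[symmetric]) (use X in simp_all)
    also have "\<dots> = snd a X" using uvw v X by (simp del: E.assoc add: u v_eq)
    finally show ?thesis using X by (simp add: comp_nat_def)
  qed
  then show "Comp ?L v u \<in> Arr ?L \<and> Dom ?L (Comp ?L v u) = Dom ?L u \<and> Cod ?L (Comp ?L v u) = Cod ?L v"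
    using uvw v comp_nat_trans[OF \<theta> \<tau>] by (simp add: u v_eq)
  assume w: "w \<in> Arr ?L" "Dom ?L w = Cod ?L v"
  then obtain d \<rho> where w_eq: "w = (c, d, \<rho>)" by (cases w) (auto simp: v_eq)
  then have \<rho>: "nat_trans E' E (inv_im (fst c)) (inv_im (fst d)) \<rho>" using w by simp
  show "Comp ?L w (Comp ?L v u) = Comp ?L (Comp ?L w v) u"
    using comp_nat_assoc[OF \<theta> \<tau> \<rho>] by (simp add: u v_eq w_eq)
next
  interpret f': cat_functor F E' "inv_im f'" by fact
  fix a assume "a \<in> Obj ?L"
  then have a: "lax_wmor_obj E E' F f f' a" by simp
  interpret A: nat_trans F E "comp_ftr F (inv_im (fst a)) (inv_im f')" "inv_im f" "snd a"
    using a by (rule lax_wmor_objD)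
  show "Idn ?L a \<in> Arr ?L \<and> Dom ?L (Idn ?L a) = a \<and> Cod ?L (Idn ?L a) = a"
    using a id_nat_trans[OF lax_wmor_objD(1)[OF a]] by (simp add: id_nat_def)
qed

lemma OpfibWeak_simps [simp]:
  "Obj (OpfibWeak E E' F f f') = {u. opfib_weak_obj E E' F f f' u}"
  "(u, v, \<theta>) \<in> Arr (OpfibWeak E E' F f f') \<longleftrightarrow>
    opfib_weak_obj E E' F f f' u \<and> opfib_weak_obj E E' F f f' v \<and>
    nat_trans (canonical_stack E' F f') (canonical_stack E F f) (snd u) (snd v) \<theta> \<and>
    (\<forall>s\<in>stack_objs E' F f'. FAr (stack_proj E F f) (\<theta> s) = Idn F (fst s))"
  "Dom (OpfibWeak E E' F f f') (u, v, \<theta>) = u"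
  "Cod (OpfibWeak E E' F f f') (u, v, \<theta>) = v"
  "Idn (OpfibWeak E E' F f f') u
    = (u, u, id_nat (canonical_stack E' F f') (canonical_stack E F f) (snd u))"
  "Comp (OpfibWeak E E' F f f') (v, w, \<tau>) (u, v', \<sigma>)
    = (u, w, comp_nat (canonical_stack E' F f') (canonical_stack E F f) \<tau> \<sigma>)"
  by (cases u; cases v; auto simp: OpfibWeak_def)+


text \<open>A functor between the total categories over \<open>F\<close>. Its action on the \<open>F\<close>-components is forced, so
  it amounts to what \<open>ob\<close> and \<open>ar\<close> give: the arrows of \<open>E\<close> in its values.\<close>

locale stack_functor =
  f: cat_functor F E "inv_im f" + f': cat_functor F E' "inv_im f'" +
  cat_functor "canonical_stack E' F f'" "canonical_stack E F f" T
  for E :: "('o, 'a) cat" and E' :: "('p, 'b) cat" and F :: "('q, 'c) cat" and f f' T +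
  assumes over: "comp_ftr (canonical_stack E' F f') (stack_proj E F f) T = stack_proj E' F f'"
begin

definition "ob A x = snd (FOb T (A, x))"

definition "ar u = snd (snd (snd (FAr T u)))"

lemma FOb_T:
  assumes "(A, x) \<in> stack_objs E' F f'"
  shows "FOb T (A, x) = (A, ob A x)" "ob A x \<in> Arr E" "Cod E (ob A x) = FOb (inv_im f) A"
proof -
  have mem: "FOb T (A, x) \<in> stack_objs E F f"
    using FOb_in_Obj[of "(A, x)"] assms by simp
  have "FOb (comp_ftr (canonical_stack E' F f') (stack_proj E F f) T) (A, x) = A"
    unfolding over using assms by simp
  then have "fst (FOb T (A, x)) = A"
    using mem assms by simp
  then show eq: "FOb T (A, x) = (A, ob A x)" by (simp add: ob_def prod_eq_iff)
  show "ob A x \<in> Arr E" "Cod E (ob A x) = FOb (inv_im f) A"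
    using mem unfolding eq by simp_all
qed

lemma FAr_T:
  assumes "((A, x), (B, y), (g, h)) \<in> Arr (canonical_stack E' F f')" (is "?u \<in> Arr ?S'")
  shows "FAr T ?u = ((A, ob A x), (B, ob B y), (g, ar ?u))" "ar ?u \<in> Arr E"
    "Dom E (ar ?u) = Dom E (ob A x)" "Cod E (ar ?u) = Dom E (ob B y)"
    "Comp E (ob B y) (ar ?u) = Comp E (FAr (inv_im f) g) (ob A x)"
proof -
  let ?S = "canonical_stack E F f"
  have mem: "FAr T ?u \<in> Arr ?S" "Dom ?S (FAr T ?u) = FOb T (A, x)" "Cod ?S (FAr T ?u) = FOb T (B, y)"
    using FAr_simps[OF assms] by simp_all
  obtain r s k m where u: "FAr T ?u = (r, s, (k, m))" by (metis surj_pair)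
  have r: "r = (A, ob A x)" and s: "s = (B, ob B y)"
    using mem u FOb_T[of A x] FOb_T[of B y] assms by auto
  have "FAr (comp_ftr ?S' (stack_proj E F f) T) ?u = g"
    unfolding over using assms by simp
  then have "FAr (stack_proj E F f) (r, s, (k, m)) = g"
    using assms by (simp only: comp_ftr_simps u)
  then have k: "k = g"
    using mem(1) unfolding u by (simp only: stack_proj_simps)
  show eq: "FAr T ?u = ((A, ob A x), (B, ob B y), (g, ar ?u))"
    by (simp add: ar_def u r s k)
  show "ar ?u \<in> Arr E" "Dom E (ar ?u) = Dom E (ob A x)" "Cod E (ar ?u) = Dom E (ob B y)"
    "Comp E (ob B y) (ar ?u) = Comp E (FAr (inv_im f) g) (ob A x)"
    using mem(1) unfolding eq by simp_all
qed

lemma ar_Comp: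
  assumes "((A, x), (B, y), (g, h)) \<in> Arr (canonical_stack E' F f')"
    "((B, y), (C, z), (g', h')) \<in> Arr (canonical_stack E' F f')"
  shows "ar ((A, x), (C, z), (Comp F g' g, Comp E' h' h))
    = Comp E (ar ((B, y), (C, z), (g', h'))) (ar ((A, x), (B, y), (g, h)))"
  using FAr_Comp_simp[OF assms] FAr_T(1)[OF assms(1)] FAr_T(1)[OF assms(2)]
  by (simp add: ar_def[of "((A, x), (C, z), (Comp F g' g, Comp E' h' h))"])

lemma ar_Idn:
  assumes "(A, x) \<in> stack_objs E' F f'"
  shows "ar ((A, x), (A, x), (Idn F A, Idn E' (Dom E' x))) = Idn E (Dom E (ob A x))"
  using FAr_Idn_simp[of "(A, x)"] FOb_T(1)[OF assms] assms by (simp add: ar_def)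

end

lemma opfib_weak_objD:
  assumes "opfib_weak_obj E E' F f f' u"
  shows "cat_functor (canonical_stack E' F f') (canonical_stack E F f) (snd u)"
    "opfibration_morphism (canonical_stack E' F f') (canonical_stack E F f) F
       (stack_proj E' F f') (stack_proj E F f) (snd u)"
    "A \<in> Obj F \<Longrightarrow> has_couniversal_arrows (slice_cat E' (FOb (inv_im f') A))
       (slice_cat E (FOb (inv_im f) A)) (fibre_component E' F f' (snd u) A)"
  using assms weak_geometric_morphism_has_couniversal_arrows[of
      "slice_cat E (FOb (inv_im f) A)" "slice_cat E' (FOb (inv_im f') A)" "fst u A"]
  by (cases u; auto simp: opfib_weak_obj_def opfibration_morphism_def)+

lemma OpfibWeak_category:
  assumes f: "cat_functor F E (inv_im f)" and f': "cat_functor F E' (inv_im f')"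
  shows "category (OpfibWeak E E' F f f')" (is "category ?O")
proof (rule categoryI)
  let ?S = "canonical_stack E F f" and ?S' = "canonical_stack E' F f'" and ?p = "stack_proj E F f"
  interpret f: cat_functor F E "inv_im f" by fact
  interpret f': cat_functor F E' "inv_im f'" by fact
  interpret p: cat_functor ?S F ?p using f by (rule stack_proj_functor)
  fix u v w assume uvw: "u \<in> Arr ?O"
  obtain a b \<theta> where u: "u = (a, b, \<theta>)" by (metis surj_pair)
  show "Comp ?O u (Idn ?O (Dom ?O u)) = u \<and> Comp ?O (Idn ?O (Cod ?O u)) u = u"
    using uvw comp_nat_units[of ?S' ?S "snd a" "snd b" \<theta>] by (simp add: u)
  show "Dom ?O u \<in> Obj ?O \<and> Cod ?O u \<in> Obj ?O" using uvw by (simp add: u)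
  assume v: "v \<in> Arr ?O" "Dom ?O v = Cod ?O u"
  then obtain c \<tau> where v_eq: "v = (b, c, \<tau>)" by (cases v) (auto simp: u)
  have \<theta>: "nat_trans ?S' ?S (snd a) (snd b) \<theta>"
    and \<tau>: "nat_trans ?S' ?S (snd b) (snd c) \<tau>" using uvw v by (simp_all add: u v_eq)
  have "FAr ?p (comp_nat ?S' ?S \<tau> \<theta> s) = Idn F (fst s)" if s: "s \<in> stack_objs E' F f'" for s
  proof -
    interpret t: nat_trans ?S' ?S "snd a" "snd b" \<theta> by fact
    interpret s: nat_trans ?S' ?S "snd b" "snd c" \<tau> by fact
    have "FAr ?p (Comp ?S (\<tau> s) (\<theta> s)) = Comp F (FAr ?p (\<tau> s)) (FAr ?p (\<theta> s))"
      using s by (intro p.FAr_Comp_simp) simp_all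
    then show ?thesis using uvw v s by (cases s) (simp add: comp_nat_def u v_eq)
  qed
  then show "Comp ?O v u \<in> Arr ?O \<and> Dom ?O (Comp ?O v u) = Dom ?O u \<and> Cod ?O (Comp ?O v u) = Cod ?O v"
    using uvw v comp_nat_trans[OF \<theta> \<tau>] by (simp add: u v_eq)
  assume w: "w \<in> Arr ?O" "Dom ?O w = Cod ?O v"
  then obtain d \<rho> where w_eq: "w = (c, d, \<rho>)" by (cases w) (auto simp: v_eq)
  then have \<rho>: "nat_trans ?S' ?S (snd c) (snd d) \<rho>" using w by simp
  show "Comp ?O w (Comp ?O v u) = Comp ?O (Comp ?O w v) u"
    using comp_nat_assoc[OF \<theta> \<tau> \<rho>] by (simp add: u v_eq w_eq)
next
  let ?S = "canonical_stack E F f" and ?S' = "canonical_stack E' F f'" and ?p = "stack_proj E F f"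
  interpret f: cat_functor F E "inv_im f" by fact
  interpret f': cat_functor F E' "inv_im f'" by fact
  fix a assume "a \<in> Obj ?O"
  then have a: "opfib_weak_obj E E' F f f' a" by simp
  interpret a: stack_functor E E' F f f' "snd a"
    using f f' opfib_weak_objD(1,2)[OF a]
    by (simp add: stack_functor_def stack_functor_axioms_def opfibration_morphism_def)
  have "FAr ?p (Idn ?S (FOb (snd a) s)) = Idn F (fst s)" if "s \<in> stack_objs E' F f'" for s
    using that by (cases s) (simp add: a.FOb_T)
  then show "Idn ?O a \<in> Arr ?O \<and> Dom ?O (Idn ?O a) = a \<and> Cod ?O (Idn ?O a) = a"
    using a id_nat_trans[OF opfib_weak_objD(1)[OF a]] by (simp add: id_nat_def)
qed

text \<open>The inverse of a vertical natural isomorphism is vertical.\<close>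

lemma OpfibWeak_is_isoI:
  assumes f: "cat_functor F E (inv_im f)" and f': "cat_functor F E' (inv_im f')"
    and u: "(a, b, \<theta>) \<in> Arr (OpfibWeak E E' F f f')"
    and iso: "\<And>s. s \<in> stack_objs E' F f' \<Longrightarrow> is_iso (canonical_stack E F f) (\<theta> s)"
  shows "is_iso (OpfibWeak E E' F f f') (a, b, \<theta>)"
proof -
  let ?S = "canonical_stack E F f" and ?S' = "canonical_stack E' F f'" and ?p = "stack_proj E F f"
  interpret f: cat_functor F E "inv_im f" by fact
  interpret p: cat_functor ?S F ?p using f by (rule stack_proj_functor)
  interpret O: category "OpfibWeak E E' F f f'" using f f' by (rule OpfibWeak_category)
  have \<theta>: "nat_trans ?S' ?S (snd a) (snd b) \<theta>"
    and vert: "\<And>s. s \<in> stack_objs E' F f' \<Longrightarrow> FAr ?p (\<theta> s) = Idn F (fst s)"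
    using u by simp_all
  interpret \<theta>: nat_trans ?S' ?S "snd a" "snd b" \<theta> by fact
  define i where "i = (\<lambda>s\<in>Obj ?S'. p.source.inverse_arr (\<theta> s))"
  have i: "nat_trans ?S' ?S (snd b) (snd a) i"
    unfolding i_def using \<theta> iso by (intro nat_trans_inverse) simp_all
  note inv = p.source.inverse_arr[OF iso]
  have "FAr ?p (i s) = Idn F (fst s)" if s: "s \<in> stack_objs E' F f'" for s
  proof -
    have "Comp F (FAr ?p (i s)) (FAr ?p (\<theta> s)) = FAr ?p (Comp ?S (i s) (\<theta> s))"
      using s inv[OF s] by (intro p.FAr_Comp_simp[symmetric]) (simp_all add: i_def)
    also have "\<dots> = Idn F (Dom F (FAr ?p (\<theta> s)))"
      using s inv[OF s] \<theta>.F.FOb_in_Obj[of s] by (simp add: i_def)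
    finally have "Comp F (FAr ?p (i s)) (Idn F (fst s)) = Idn F (Dom F (FAr ?p (\<theta> s)))"
      using s vert by simp
    moreover have "fst s \<in> Obj F" using s by (cases s) simp
    moreover have "Dom F (FAr ?p (i s)) = Cod F (FAr ?p (\<theta> s))"
      using s inv[OF s] by (simp add: i_def)
    moreover have "FAr ?p (i s) \<in> Arr F" using s inv[OF s] by (simp add: i_def)
    ultimately show ?thesis using s vert by simp
  qed
  then have "(b, a, i) \<in> Arr (OpfibWeak E E' F f f')" using u i by simp
  moreover have "comp_nat ?S' ?S i \<theta> = id_nat ?S' ?S (snd a)" "comp_nat ?S' ?S \<theta> i = id_nat ?S' ?S (snd b)"
    using inv by (auto simp: comp_nat_def id_nat_def i_def fun_eq_iff restrict_def)
  ultimately show ?thesis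
    using u by (intro O.is_isoI[where g = "(b, a, i)"]) simp_all
qed


section \<open>The morphism of opfibrations induced by a lax morphism\<close>

definition induced_stack_ob ::
  "('o, 'a) cat \<Rightarrow> ('p, 'b, 'o, 'a) ftr \<Rightarrow> ('q \<Rightarrow> 'a) \<Rightarrow> ('q, 'b) stack_obj \<Rightarrow> ('q, 'a) stack_obj" where
  "induced_stack_ob E L \<phi> s = (fst s, Comp E (\<phi> (fst s)) (FAr L (snd s)))"

definition induced_stack_ftr ::
  "('o, 'a) cat \<Rightarrow> ('p, 'b) cat \<Rightarrow> ('q, 'c) cat \<Rightarrow> ('p, 'b, 'q, 'c) wgm \<Rightarrow>
   ('p, 'b, 'o, 'a) ftr \<Rightarrow> ('q \<Rightarrow> 'a) \<Rightarrow>
   (('q, 'b) stack_obj, ('q, 'b, 'c) stack_arr, ('q, 'a) stack_obj, ('q, 'a, 'c) stack_arr) ftr" where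
  "induced_stack_ftr E E' F f' L \<phi> =
     \<lparr>FOb = (\<lambda>s\<in>stack_objs E' F f'. induced_stack_ob E L \<phi> s),
      FAr = (\<lambda>(s, r, (g, h))\<in>Arr (canonical_stack E' F f').
        (induced_stack_ob E L \<phi> s, induced_stack_ob E L \<phi> r, (g, FAr L h)))\<rparr>"

text \<open>A weak morphism over \<open>F\<close>, reduced to its inverse image \<open>L\<close> and its cell \<open>\<phi> : L f'\<^sup>* \<Rightarrow> f\<^sup>*\<close>.\<close>

locale lax_square =
  f: cat_functor F E "inv_im f" + f': cat_functor F E' "inv_im f'" + L: cat_functor E' E L +
  \<phi>: nat_trans F E "comp_ftr F L (inv_im f')" "inv_im f" \<phi>
  for E :: "('o, 'a) cat" and E' :: "('p, 'b) cat" and F :: "('q, 'c) cat"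
    and f :: "('o, 'a, 'q, 'c) wgm" and f' :: "('p, 'b, 'q, 'c) wgm" and L \<phi>
begin

abbreviation "T \<equiv> induced_stack_ftr E E' F f' L \<phi>"

lemma T_simps [simp]:
  "(A, x) \<in> stack_objs E' F f' \<Longrightarrow> FOb T (A, x) = (A, Comp E (\<phi> A) (FAr L x))"
  "((A, x), (B, y), (g, h)) \<in> Arr (canonical_stack E' F f') \<Longrightarrow>
    FAr T ((A, x), (B, y), (g, h))
      = ((A, Comp E (\<phi> A) (FAr L x)), (B, Comp E (\<phi> B) (FAr L y)), (g, FAr L h))"
  by (auto simp: induced_stack_ftr_def induced_stack_ob_def)

text \<open>This is the naturality of \<open>\<phi>\<close> at \<open>g\<close>.\<close>

lemma T_arrow:
  assumes "((A, x), (B, y), (g, h)) \<in> Arr (canonical_stack E' F f')"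
  shows "((A, Comp E (\<phi> A) (FAr L x)), (B, Comp E (\<phi> B) (FAr L y)), (g, FAr L h))
    \<in> Arr (canonical_stack E F f)"
proof -
  have u: "A \<in> Obj F" "x \<in> Arr E'" "Cod E' x = FOb (inv_im f') A" "B \<in> Obj F" "y \<in> Arr E'"
    "Cod E' y = FOb (inv_im f') B" "g \<in> Arr F" "Dom F g = A" "Cod F g = B"
    "h \<in> Arr E'" "Dom E' h = Dom E' x" "Cod E' h = Dom E' y"
    and yh: "Comp E' y h = Comp E' (FAr (inv_im f') g) x"
    using assms by auto
  have "Comp E (\<phi> B) (Comp E (FAr L y) (FAr L h)) = Comp E (\<phi> B) (FAr L (Comp E' y h))"
    using u by (simp add: L.FAr_Comp_simp)
  also have "\<dots> = Comp E (\<phi> B) (Comp E (FAr L (FAr (inv_im f') g)) (FAr L x))"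
    using u by (simp add: yh L.FAr_Comp_simp)
  also have "\<dots> = Comp E (FAr (inv_im f) g) (Comp E (\<phi> A) (FAr L x))"
    using u \<phi>.naturality_Arr[of g] by (intro f.target.Comp_eq_whisker) simp_all
  finally show ?thesis using u by simp
qed

lemma T_functor: "cat_functor (canonical_stack E' F f') (canonical_stack E F f) T"
proof (rule cat_functorI)
  let ?S = "canonical_stack E F f" and ?S' = "canonical_stack E' F f'"
  show "category ?S'" "category ?S"
    by (rule stack_category f.cat_functor_axioms f'.cat_functor_axioms)+
  show "FOb T \<in> extensional (Obj ?S')" "FAr T \<in> extensional (Arr ?S')"
    by (auto simp: induced_stack_ftr_def)
  show "FOb T s \<in> Obj ?S" if "s \<in> Obj ?S'" for s
    using that by (cases s) simp
  show "FAr T (Idn ?S' s) = Idn ?S (FOb T s)" if "s \<in> Obj ?S'" for s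
    using that by (cases s) simp
  fix u assume u: "u \<in> Arr ?S'"
  obtain A x B y g h where u_eq: "u = ((A, x), (B, y), (g, h))" by (metis surj_pair)
  show "FAr T u \<in> Arr ?S \<and> Dom ?S (FAr T u) = FOb T (Dom ?S' u) \<and>
    Cod ?S (FAr T u) = FOb T (Cod ?S' u)"
    using T_arrow[of A x B y g h] u by (simp add: u_eq)
  fix v assume v: "v \<in> Arr ?S'" "Dom ?S' v = Cod ?S' u"
  obtain C z g' h' where v_eq: "v = ((B, y), (C, z), (g', h'))"
    using v by (cases v) (auto simp: u_eq)
  have "Comp ?S' v u \<in> Arr ?S'"
    using u v category.Comp_simps(1)[OF stack_category[OF f'.cat_functor_axioms]] by simp
  then have "((A, x), (C, z), (Comp F g' g, Comp E' h' h)) \<in> Arr ?S'"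
    by (simp only: u_eq v_eq stack_simps)
  from T_simps(2)[OF this] show "FAr T (Comp ?S' v u) = Comp ?S (FAr T v) (FAr T u)"
    using u v by (simp add: u_eq v_eq L.FAr_Comp_simp)
qed

text \<open>Cocartesian arrows are preserved because \<open>L\<close> preserves isomorphisms.\<close>

lemma T_opfibration_morphism:
  "opfibration_morphism (canonical_stack E' F f') (canonical_stack E F f) F
     (stack_proj E' F f') (stack_proj E F f) T"
  unfolding opfibration_morphism_def
proof (intro conjI allI impI T_functor)
  let ?S = "canonical_stack E F f" and ?S' = "canonical_stack E' F f'"
  let ?p = "stack_proj E F f" and ?p' = "stack_proj E' F f'"
  interpret p: cat_functor ?S F ?p by (rule stack_proj_functor[OF f.cat_functor_axioms])
  interpret p': cat_functor ?S' F ?p' by (rule stack_proj_functor[OF f'.cat_functor_axioms])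
  have "FOb (comp_ftr ?S' ?p T) = FOb ?p'"
  proof (rule extensionalityI[OF _ p'.FOb_ext])
    show "FOb (comp_ftr ?S' ?p T) s = FOb ?p' s" if "s \<in> Obj ?S'" for s
      using that by (cases s) simp
  qed (simp add: comp_ftr_def)
  moreover have "FAr (comp_ftr ?S' ?p T) = FAr ?p'"
  proof (rule extensionalityI[OF _ p'.FAr_ext])
    fix u assume u: "u \<in> Arr ?S'"
    obtain A x B y g h where u_eq: "u = ((A, x), (B, y), (g, h))" by (metis surj_pair)
    show "FAr (comp_ftr ?S' ?p T) u = FAr ?p' u"
      using u stack_proj_simps(2)[OF T_arrow[OF u[unfolded u_eq]]] by (simp add: u_eq)
  qed (simp add: comp_ftr_def)
  ultimately show "comp_ftr ?S' ?p T = ?p'" by simp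
  fix u assume coc: "cocartesian ?S' F ?p' u"
  then have u: "u \<in> Arr ?S'" by (simp add: cocartesian_def)
  obtain A x B y g h where u_eq: "u = ((A, x), (B, y), (g, h))" by (metis surj_pair)
  have "is_iso E' h"
    using coc u cocartesian_iff_is_iso[OF f'.cat_functor_axioms] by (simp only: u_eq)
  then have "is_iso E (FAr L h)" by (rule L.preserves_iso)
  then show "cocartesian ?S F ?p (FAr T u)"
    using cocartesian_iff_is_iso[OF f.cat_functor_axioms T_arrow[OF u[unfolded u_eq]]] u
    by (simp only: u_eq T_simps)
qed

lemma fibre_component_T_simps [simp]:
  assumes "A \<in> Obj F"
  shows "x \<in> Arr E' \<Longrightarrow> Cod E' x = FOb (inv_im f') A \<Longrightarrow>
      FOb (fibre_component E' F f' T A) x = Comp E (\<phi> A) (FAr L x)"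
    "(x, y, h) \<in> Arr (slice_cat E' (FOb (inv_im f') A)) \<Longrightarrow>
      FAr (fibre_component E' F f' T A) (x, y, h)
        = (Comp E (\<phi> A) (FAr L x), Comp E (\<phi> A) (FAr L y), FAr L h)"
  using assms by (auto simp: fibre_component_def)

lemma fibre_component_T_functor:
  assumes A: "A \<in> Obj F"
  shows "cat_functor (slice_cat E' (FOb (inv_im f') A)) (slice_cat E (FOb (inv_im f) A))
    (fibre_component E' F f' T A)" (is "cat_functor ?D ?C ?G")
proof (rule cat_functorI)
  show "category ?D" "category ?C"
    by (rule slice_category f.target.category_axioms f'.target.category_axioms)+
  show "FOb ?G \<in> extensional (Obj ?D)" "FAr ?G \<in> extensional (Arr ?D)"
    by (auto simp: fibre_component_def)
  show "FOb ?G x \<in> Obj ?C" if "x \<in> Obj ?D" for x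
    using that A by simp
  show "FAr ?G (Idn ?D x) = Idn ?C (FOb ?G x)" if "x \<in> Obj ?D" for x
    using that A by simp
  fix u assume u: "u \<in> Arr ?D"
  obtain x y h where u_eq: "u = (x, y, h)" by (metis surj_pair)
  have "Comp E (FAr L y) (FAr L h) = FAr L x"
    using u by (auto simp: u_eq simp flip: L.FAr_Comp_simp)
  then show "FAr ?G u \<in> Arr ?C \<and> Dom ?C (FAr ?G u) = FOb ?G (Dom ?D u) \<and>
    Cod ?C (FAr ?G u) = FOb ?G (Cod ?D u)"
    using u A by (simp add: u_eq)
  fix v assume v: "v \<in> Arr ?D" "Dom ?D v = Cod ?D u"
  obtain z k where v_eq: "v = (y, z, k)" using v by (cases v) (simp add: u_eq)
  have "Comp ?D v u \<in> Arr ?D"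
    using u v category.Comp_simps(1)[OF slice_category[OF f'.target.category_axioms]] by simp
  then have "(x, z, Comp E' k h) \<in> Arr ?D" by (simp only: u_eq v_eq slice_simps)
  from fibre_component_T_simps(2)[OF A this]
  show "FAr ?G (Comp ?D v u) = Comp ?C (FAr ?G v) (FAr ?G u)"
    using u v A by (simp add: u_eq v_eq L.FAr_Comp_simp)
qed

text \<open>If \<open>L\<close> has the right adjoint \<open>R\<close>, with counit \<open>e\<close>, then the couniversal arrow to
  \<open>y : Y \<rightarrow> f\<^sup>*A\<close> is the pullback of \<open>R y\<close> along the transpose \<open>f'\<^sup>*A \<rightarrow> R f\<^sup>*A\<close> of \<open>\<phi>\<^sub>A\<close>: a
  map into it from \<open>x\<close> is a map \<open>X \<rightarrow> R Y\<close> compatible with \<open>x\<close>, that is, a map \<open>L X \<rightarrow> Y\<close> over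
  \<open>\<phi>\<^sub>A \<circ> L x\<close>.\<close>

lemma fibre_component_T_couniversal:
  assumes A: "A \<in> Obj F" and pb: "has_pullbacks E'" and adj: "has_couniversal_arrows E' E L"
  shows "has_couniversal_arrows (slice_cat E' (FOb (inv_im f') A)) (slice_cat E (FOb (inv_im f) A))
    (fibre_component E' F f' T A)"
  unfolding has_couniversal_arrows_def
proof
  let ?D = "slice_cat E' (FOb (inv_im f') A)" and ?C = "slice_cat E (FOb (inv_im f) A)"
  let ?G = "fibre_component E' F f' T A"
  fix y assume "y \<in> Obj ?C"
  then have y: "y \<in> Arr E" "Cod E y = FOb (inv_im f) A" by simp_all
  obtain R e where Re: "couniversal_arrow E' E L R (Dom E y) e"
    using adj y unfolding has_couniversal_arrows_def by (metis f.target.Dom_in_Obj)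
  obtain R' e' where Re': "couniversal_arrow E' E L R' (FOb (inv_im f) A) e'"
    using adj A unfolding has_couniversal_arrows_def by (metis f.FOb_in_Obj)
  have e: "R \<in> Obj E'" "e \<in> Arr E" "Dom E e = FOb L R" "Cod E e = Dom E y"
    using Re by (simp_all add: couniversal_arrow_def hom_iff)
  have e': "R' \<in> Obj E'" "e' \<in> Arr E" "Dom E e' = FOb L R'" "Cod E e' = FOb (inv_im f) A"
    using Re' by (simp_all add: couniversal_arrow_def hom_iff)
  have e_ex1: "\<exists>!k. k \<in> hom E' x R \<and> Comp E e (FAr L k) = h"
    if "x \<in> Obj E'" "h \<in> hom E (FOb L x) (Dom E y)" for x h
    using Re that by (simp add: couniversal_arrow_def)
  have e'_ex1: "\<exists>!k. k \<in> hom E' x R' \<and> Comp E e' (FAr L k) = h"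
    if "x \<in> Obj E'" "h \<in> hom E (FOb L x) (FOb (inv_im f) A)" for x h
    using Re' that by (simp add: couniversal_arrow_def)
  have e'_uniq: "k = l" if "Comp E e' (FAr L k) = Comp E e' (FAr L l)" "k \<in> Arr E'" "l \<in> Arr E'"
    "Dom E' k = Dom E' l" "Cod E' k = R'" "Cod E' l = R'" for k l
  proof -
    have "Comp E e' (FAr L l) \<in> hom E (FOb L (Dom E' l)) (FOb (inv_im f) A)"
      using that e' by (simp add: hom_iff)
    from e'_ex1[OF _ this] have "\<exists>!k. k \<in> hom E' (Dom E' l) R' \<and> Comp E e' (FAr L k) = Comp E e' (FAr L l)"
      using that by simp
    moreover have "k \<in> hom E' (Dom E' l) R'" "l \<in> hom E' (Dom E' l) R'"
      using that by (simp_all add: hom_iff)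
    ultimately show ?thesis using that(1) by blast
  qed
  \<comment> \<open>\<open>R y\<close>, with the target of \<open>y\<close> known to be \<open>f\<^sup>*A\<close>.\<close>
  obtain Ry where Ry: "Ry \<in> Arr E'" "Dom E' Ry = R" "Cod E' Ry = R'"
    and e_Ry: "Comp E e' (FAr L Ry) = Comp E y e"
    using e'_ex1[of R "Comp E y e"] e y by (auto simp: hom_iff)
  \<comment> \<open>The transpose of \<open>\<phi>\<^sub>A\<close>.\<close>
  obtain t where t: "t \<in> Arr E'" "Dom E' t = FOb (inv_im f') A" "Cod E' t = R'"
    and e_t: "Comp E e' (FAr L t) = \<phi> A"
    using e'_ex1[of "FOb (inv_im f') A" "\<phi> A"] A by (auto simp: hom_iff)
  obtain p q where pq: "pullback_square E' t Ry p q"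
    using pb t Ry unfolding has_pullbacks_def by metis
  then have p: "p \<in> Arr E'" "Cod E' p = FOb (inv_im f') A" and q: "q \<in> Arr E'" "Dom E' q = Dom E' p"
    "Cod E' q = R" and tp: "Comp E' t p = Comp E' Ry q"
    using t Ry by (simp_all add: pullback_square_def)
  have "Comp E y (Comp E e (FAr L q)) = Comp E e' (Comp E (FAr L Ry) (FAr L q))"
    using e_Ry e e' y Ry q by (intro f.target.Comp_eq_whisker) simp_all
  also have "\<dots> = Comp E e' (FAr L (Comp E' t p))"
    using Ry q by (simp add: tp L.FAr_Comp_simp)
  also have "\<dots> = Comp E (Comp E e' (FAr L t)) (FAr L p)"
    using t p e' by (simp add: L.FAr_Comp_simp)
  finally have counit: "Comp E y (Comp E e (FAr L q)) = Comp E (\<phi> A) (FAr L p)"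
    by (simp only: e_t)
  have "couniversal_arrow ?D ?C ?G p y (Comp E (\<phi> A) (FAr L p), y, Comp E e (FAr L q))"
    unfolding couniversal_arrow_def
  proof (intro conjI ballI)
    show "(Comp E (\<phi> A) (FAr L p), y, Comp E e (FAr L q)) \<in> hom ?C (FOb ?G p) y"
      using counit p q e y A by (simp add: hom_iff)
  next
    fix x u assume x0: "x \<in> Obj ?D" and "u \<in> hom ?C (FOb ?G x) y"
    then obtain h where u: "u = (Comp E (\<phi> A) (FAr L x), y, h)"
      and h: "h \<in> Arr E" "Dom E h = FOb L (Dom E' x)" "Cod E h = Dom E y"
      "Comp E y h = Comp E (\<phi> A) (FAr L x)"
      using A by (cases u) (auto simp: hom_iff)
    have x: "x \<in> Arr E'" "Cod E' x = FOb (inv_im f') A" using x0 by simp_all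
    obtain k where k: "k \<in> Arr E'" "Dom E' k = Dom E' x" "Cod E' k = R" and ek: "Comp E e (FAr L k) = h"
      using e_ex1[of "Dom E' x" h] x h by (auto simp: hom_iff)
    have "Comp E e' (FAr L (Comp E' Ry k)) = Comp E e' (Comp E (FAr L Ry) (FAr L k))"
      using Ry k by (simp add: L.FAr_Comp_simp)
    also have "\<dots> = Comp E y (Comp E e (FAr L k))"
      using e_Ry e e' y Ry k by (intro f.target.Comp_eq_whisker) simp_all
    also have "\<dots> = Comp E (Comp E e' (FAr L t)) (FAr L x)"
      unfolding ek h(4) e_t ..
    also have "\<dots> = Comp E e' (FAr L (Comp E' t x))"
      using t x e' by (simp add: L.FAr_Comp_simp)
    finally have tx: "Comp E' t x = Comp E' Ry k"
      using t x Ry k by (intro e'_uniq) simp_all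
    have "\<exists>!m. m \<in> hom E' (Dom E' x) (Dom E' p) \<and> Comp E' p m = x \<and> Comp E' q m = k"
      using pullback_square_ex1[OF pq x(1) k(1)] x k t Ry tx by simp
    then obtain m where m': "m \<in> hom E' (Dom E' x) (Dom E' p)" "Comp E' p m = x" "Comp E' q m = k"
      and m_uniq: "\<And>n. n \<in> hom E' (Dom E' x) (Dom E' p) \<Longrightarrow> Comp E' p n = x \<Longrightarrow> Comp E' q n = k \<Longrightarrow> n = m"
      by blast
    have m: "m \<in> Arr E'" "Dom E' m = Dom E' x" "Cod E' m = Dom E' p"
      "Comp E' p m = x" "Comp E' q m = k"
      using m' by (simp_all only: hom_iff)
    show "\<exists>!l. l \<in> hom ?D x p \<and> Comp ?C (Comp E (\<phi> A) (FAr L p), y, Comp E e (FAr L q)) (FAr ?G l) = u"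
    proof (rule ex1I)
      have "Comp E e (Comp E (FAr L q) (FAr L m)) = h"
        using ek L.FAr_Comp_simp[of m q] m q by simp
      then show "(x, p, m) \<in> hom ?D x p \<and>
        Comp ?C (Comp E (\<phi> A) (FAr L p), y, Comp E e (FAr L q)) (FAr ?G (x, p, m)) = u"
        using m x p q e A by (simp add: hom_iff u)
    next
      fix l assume l: "l \<in> hom ?D x p \<and> Comp ?C (Comp E (\<phi> A) (FAr L p), y, Comp E e (FAr L q)) (FAr ?G l) = u"
      then obtain n where l_eq: "l = (x, p, n)" by (cases l) (auto simp: hom_iff)
      have l_Arr: "(x, p, n) \<in> Arr ?D" using l by (simp only: l_eq hom_iff)
      then have n: "n \<in> Arr E'" "Dom E' n = Dom E' x" "Cod E' n = Dom E' p" "Comp E' p n = x" by simp_all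
      have "Comp E (Comp E e (FAr L q)) (FAr L n) = h"
        using l fibre_component_T_simps(2)[OF A l_Arr] by (simp only: l_eq u slice_simps prod.inject)
      then have en: "Comp E e (FAr L (Comp E' q n)) = h"
        using n q e by (simp add: L.FAr_Comp_simp)
      have "Comp E' q n \<in> hom E' (Dom E' x) R" "k \<in> hom E' (Dom E' x) R"
        using n q k by (simp_all add: hom_iff)
      then have "Comp E' q n = k"
        using e_ex1[of "Dom E' x" h] en ek x h by (auto simp: hom_iff)
      then have "n = m"
        using n by (intro m_uniq) (simp_all add: hom_iff)
      then show "l = (x, p, m)" by (simp add: l_eq)
    qed
  qed (use p in simp)
  then show "\<exists>r e. couniversal_arrow ?D ?C ?G r y e" by blast
qed

end


section \<open>The comparison functor\<close>

text \<open>The finite limits that carry the comparison: pullbacks in \<open>E'\<close> for the right adjoints on the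
  fibres, and a terminal object \<open>t\<close> of \<open>F\<close>, preserved by both inverse images, over which the fibres
  are \<open>E\<close> and \<open>E'\<close>.\<close>

locale relative_toposes =
  f: cat_functor F E "inv_im f" + f': cat_functor F E' "inv_im f'"
  for E :: "('o, 'a) cat" and E' :: "('p, 'b) cat" and F :: "('q, 'c) cat"
    and f :: "('o, 'a, 'q, 'c) wgm" and f' :: "('p, 'b, 'q, 'c) wgm" +
  fixes t
  assumes pullbacks: "has_pullbacks E'"
    and t: "terminal_object F t"
    and f_t: "terminal_object E (FOb (inv_im f) t)"
    and f'_t: "terminal_object E' (FOb (inv_im f') t)"
begin

abbreviation "S \<equiv> canonical_stack E F f"
abbreviation "S' \<equiv> canonical_stack E' F f'"
abbreviation "Lax \<equiv> LaxWmor E E' F f f'"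
abbreviation "Opf \<equiv> OpfibWeak E E' F f f'"

definition "induced u = induced_stack_ftr E E' F f' (inv_im (fst u)) (snd u)"

text \<open>Any choice of right adjoints will do: an arrow of \<open>OpfibWeak\<close> involves the left adjoints only,
  so two choices give isomorphic objects.\<close>

definition "fibre_adjunctions u = (\<lambda>A\<in>Obj F. SOME w.
  weak_geometric_morphism (slice_cat E (FOb (inv_im f) A)) (slice_cat E' (FOb (inv_im f') A)) w \<and>
  inv_im w = fibre_component E' F f' (induced u) A)"

definition "lax_to_opfib_nat u v \<theta> = (\<lambda>s\<in>stack_objs E' F f'.
  (FOb (induced u) s, FOb (induced v) s, (Idn F (fst s), \<theta> (Dom E' (snd s)))))"

definition "lax_to_opfib = \<lparr>FOb = (\<lambda>u\<in>Obj Lax. (fibre_adjunctions u, induced u)),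
  FAr = (\<lambda>(u, v, \<theta>)\<in>Arr Lax. ((fibre_adjunctions u, induced u), (fibre_adjunctions v, induced v), lax_to_opfib_nat u v \<theta>))\<rparr>"

interpretation S: category S by (rule stack_category[OF f.cat_functor_axioms])
interpretation S': category S' by (rule stack_category[OF f'.cat_functor_axioms])

lemma Lax_category: "category Lax"
  by (rule LaxWmor_category[OF f'.cat_functor_axioms f.target.category_axioms])

lemma Opf_category: "category Opf"
  by (rule OpfibWeak_category[OF f.cat_functor_axioms f'.cat_functor_axioms])

lemma lax_square:
  assumes "lax_wmor_obj E E' F f f' u"
  shows "lax_square E E' F f f' (inv_im (fst u)) (snd u)"
  using lax_wmor_objD[OF assms] f.cat_functor_axioms f'.cat_functor_axioms
  by (simp add: lax_square_def)

lemma lax_to_opfib_obj: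
  assumes u: "lax_wmor_obj E E' F f f' u"
  shows "opfib_weak_obj E E' F f f' (fibre_adjunctions u, induced u)"
proof -
  interpret u: lax_square E E' F f f' "inv_im (fst u)" "snd u" using u by (rule lax_square)
  have "weak_geometric_morphism (slice_cat E (FOb (inv_im f) A)) (slice_cat E' (FOb (inv_im f') A))
      (fibre_adjunctions u A) \<and> inv_im (fibre_adjunctions u A) = fibre_component E' F f' (induced u) A"
    if A: "A \<in> Obj F" for A
    using someI_ex[OF couniversal_arrows_give_weak_geometric_morphism[OF u.fibre_component_T_functor[OF A]
          u.fibre_component_T_couniversal[OF A pullbacks lax_wmor_objD(2)[OF u]]]] A
    by (simp add: fibre_adjunctions_def induced_def)
  then show ?thesis
    using u.T_opfibration_morphism
    by (simp add: opfib_weak_obj_def induced_def fibre_adjunctions_def)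
qed

lemma induced_ob:
  assumes "lax_wmor_obj E E' F f f' u" "(A, x) \<in> stack_objs E' F f'"
  shows "FOb (induced u) (A, x) = (A, Comp E (snd u A) (FAr (inv_im (fst u)) x))"
  unfolding induced_def by (rule lax_square.T_simps(1)[OF lax_square[OF assms(1)] assms(2)])

lemma induced_ar:
  assumes u: "lax_wmor_obj E E' F f f' u" and w: "((A, x), (B, y), (g, h)) \<in> Arr S'"
  shows "FAr (induced u) ((A, x), (B, y), (g, h))
    = (FOb (induced u) (A, x), FOb (induced u) (B, y), (g, FAr (inv_im (fst u)) h))"
  using lax_square.T_simps(2)[OF lax_square[OF u] w] w induced_ob[OF u, of A x] induced_ob[OF u, of B y]
  by (simp add: induced_def)

lemma induced_functor: "lax_wmor_obj E E' F f f' u \<Longrightarrow> cat_functor S' S (induced u)"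
  unfolding induced_def by (rule lax_square.T_functor[OF lax_square])

lemma lax_to_opfib_nat_component:
  assumes u: "(u, v, \<theta>) \<in> Arr Lax" and s: "(A, x) \<in> stack_objs E' F f'"
  shows "lax_to_opfib_nat u v \<theta> (A, x) = (FOb (induced u) (A, x), FOb (induced v) (A, x), (Idn F A, \<theta> (Dom E' x)))"
    "lax_to_opfib_nat u v \<theta> (A, x) \<in> Arr S"
proof -
  have uv: "lax_wmor_obj E E' F f f' u" "lax_wmor_obj E E' F f f' v"
    and \<theta>: "nat_trans E' E (inv_im (fst u)) (inv_im (fst v)) \<theta>"
    and sq: "\<And>X. X \<in> Obj F \<Longrightarrow> Comp E (snd v X) (\<theta> (FOb (inv_im f') X)) = snd u X"
    using u by simp_all
  interpret \<theta>: nat_trans E' E "inv_im (fst u)" "inv_im (fst v)" \<theta> by fact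
  interpret u: lax_square E E' F f f' "inv_im (fst u)" "snd u" using uv(1) by (rule lax_square)
  interpret v: lax_square E E' F f f' "inv_im (fst v)" "snd v" using uv(2) by (rule lax_square)
  have Ax: "A \<in> Obj F" "x \<in> Arr E'" "Cod E' x = FOb (inv_im f') A" using s by simp_all
  show eq: "lax_to_opfib_nat u v \<theta> (A, x) = (FOb (induced u) (A, x), FOb (induced v) (A, x), (Idn F A, \<theta> (Dom E' x)))"
    using s by (simp add: lax_to_opfib_nat_def)
  have "Comp E (snd v A) (Comp E (FAr (inv_im (fst v)) x) (\<theta> (Dom E' x)))
    = Comp E (snd v A) (Comp E (\<theta> (FOb (inv_im f') A)) (FAr (inv_im (fst u)) x))"
    using \<theta>.naturality_Arr[of x] Ax by simp
  also have "\<dots> = Comp E (Comp E (snd v A) (\<theta> (FOb (inv_im f') A))) (FAr (inv_im (fst u)) x)"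
    by (rule f.target.assoc[symmetric]) (use Ax in simp_all)
  also have "\<dots> = Comp E (snd u A) (FAr (inv_im (fst u)) x)" using sq Ax by simp
  finally show "lax_to_opfib_nat u v \<theta> (A, x) \<in> Arr S"
    using Ax by (simp add: eq induced_ob[OF uv(1) s] induced_ob[OF uv(2) s])
qed

lemma lax_to_opfib_nat_Opf:
  assumes u: "(u, v, \<theta>) \<in> Arr Lax"
  shows "((fibre_adjunctions u, induced u), (fibre_adjunctions v, induced v), lax_to_opfib_nat u v \<theta>) \<in> Arr Opf"
proof -
  have uv: "lax_wmor_obj E E' F f f' u" "lax_wmor_obj E E' F f f' v"
    and \<theta>: "nat_trans E' E (inv_im (fst u)) (inv_im (fst v)) \<theta>"
    using u by simp_all
  interpret \<theta>: nat_trans E' E "inv_im (fst u)" "inv_im (fst v)" \<theta> by fact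
  have "nat_trans S' S (induced u) (induced v) (lax_to_opfib_nat u v \<theta>)"
  proof (rule nat_transI)
    show "cat_functor S' S (induced u)" "cat_functor S' S (induced v)" using uv by (simp_all add: induced_functor)
    show "lax_to_opfib_nat u v \<theta> \<in> extensional (Obj S')" by (simp add: lax_to_opfib_nat_def)
    show "lax_to_opfib_nat u v \<theta> s \<in> Arr S \<and> Dom S (lax_to_opfib_nat u v \<theta> s) = FOb (induced u) s \<and>
      Cod S (lax_to_opfib_nat u v \<theta> s) = FOb (induced v) s" if "s \<in> Obj S'" for s
      using lax_to_opfib_nat_component[OF u, of "fst s" "snd s"] that by (cases s) simp
    fix w assume w: "w \<in> Arr S'"
    obtain A x B y g h where w_eq: "w = ((A, x), (B, y), (g, h))" by (metis surj_pair)
    show "Comp S (lax_to_opfib_nat u v \<theta> (Cod S' w)) (FAr (induced u) w) = Comp S (FAr (induced v) w) (lax_to_opfib_nat u v \<theta> (Dom S' w))"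
      using w \<theta>.naturality_Arr[of h] lax_to_opfib_nat_component(1)[OF u, of A x] lax_to_opfib_nat_component(1)[OF u, of B y]
        induced_ar[OF uv(1), of A x B y g h] induced_ar[OF uv(2), of A x B y g h]
      by (simp add: w_eq)
  qed
  moreover have "FAr (stack_proj E F f) (lax_to_opfib_nat u v \<theta> s) = Idn F (fst s)" if "s \<in> stack_objs E' F f'" for s
  proof -
    obtain A x where s: "s = (A, x)" by (cases s)
    have "(A, x) \<in> stack_objs E' F f'" using that s by simp
    from lax_to_opfib_nat_component[OF u this] show ?thesis
      by (simp only: s stack_proj_simps fst_conv)
  qed
  ultimately show ?thesis using lax_to_opfib_obj[OF uv(1)] lax_to_opfib_obj[OF uv(2)] by simp
qed

lemma lax_to_opfib_simps:
  "lax_wmor_obj E E' F f f' u \<Longrightarrow> FOb lax_to_opfib u = (fibre_adjunctions u, induced u)"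
  "(u, v, \<theta>) \<in> Arr Lax \<Longrightarrow>
    FAr lax_to_opfib (u, v, \<theta>) = ((fibre_adjunctions u, induced u), (fibre_adjunctions v, induced v), lax_to_opfib_nat u v \<theta>)"
  by (auto simp: lax_to_opfib_def)

lemma lax_to_opfib_functor: "cat_functor Lax Opf lax_to_opfib"
proof (rule cat_functorI[OF Lax_category Opf_category])
  interpret Lax: category Lax by (rule Lax_category)
  show "FOb lax_to_opfib \<in> extensional (Obj Lax)" "FAr lax_to_opfib \<in> extensional (Arr Lax)"
    by (auto simp: lax_to_opfib_def)
  show "FOb lax_to_opfib u \<in> Obj Opf" if "u \<in> Obj Lax" for u
    using that lax_to_opfib_obj[of u] by (simp add: lax_to_opfib_simps)
  show "FAr lax_to_opfib (Idn Lax u) = Idn Opf (FOb lax_to_opfib u)" if "u \<in> Obj Lax" for u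
  proof -
    have u: "lax_wmor_obj E E' F f f' u" using that by simp
    interpret u: lax_square E E' F f f' "inv_im (fst u)" "snd u" using u by (rule lax_square)
    have id: "(u, u, id_nat E' E (inv_im (fst u))) \<in> Arr Lax"
      using Lax.Idn_simps(1)[OF that] unfolding LaxWmor_simps(5) .
    have "lax_to_opfib_nat u u (id_nat E' E (inv_im (fst u))) = id_nat S' S (induced u)"
    proof (rule extensionalityI)
      fix s assume "s \<in> stack_objs E' F f'"
      moreover obtain A x where "s = (A, x)" by (cases s)
      ultimately show "lax_to_opfib_nat u u (id_nat E' E (inv_im (fst u))) s = id_nat S' S (induced u) s"
        using lax_to_opfib_nat_component(1)[OF id, of A x] induced_ob[OF u, of A x] by (simp add: id_nat_def)
    qed (simp_all add: lax_to_opfib_nat_def id_nat_def)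
    then show ?thesis by (simp add: lax_to_opfib_simps u lax_to_opfib_simps(2)[OF id])
  qed
  fix p assume p: "p \<in> Arr Lax"
  obtain u v \<theta> where p_eq: "p = (u, v, \<theta>)" by (metis surj_pair)
  have uv: "lax_wmor_obj E E' F f f' u" "lax_wmor_obj E E' F f f' v" using p by (simp_all add: p_eq)
  show "FAr lax_to_opfib p \<in> Arr Opf \<and> Dom Opf (FAr lax_to_opfib p) = FOb lax_to_opfib (Dom Lax p) \<and> Cod Opf (FAr lax_to_opfib p) = FOb lax_to_opfib (Cod Lax p)"
    using lax_to_opfib_nat_Opf[OF p[unfolded p_eq]]
    unfolding p_eq lax_to_opfib_simps(2)[OF p[unfolded p_eq]] LaxWmor_simps OpfibWeak_simps(3,4) lax_to_opfib_simps(1)[OF uv(1)]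
      lax_to_opfib_simps(1)[OF uv(2)] by blast
  fix q assume q: "q \<in> Arr Lax" "Dom Lax q = Cod Lax p"
  obtain w \<tau> where q_eq: "q = (v, w, \<tau>)" using q by (cases q) (auto simp: p_eq)
  have qp: "(u, w, comp_nat E' E \<tau> \<theta>) \<in> Arr Lax"
    using Lax.Comp_simps(1)[OF p q] unfolding p_eq q_eq LaxWmor_simps(6) .
  note pa = p[unfolded p_eq] and qa = q(1)[unfolded q_eq]
  have "lax_to_opfib_nat u w (comp_nat E' E \<tau> \<theta>) = comp_nat S' S (lax_to_opfib_nat v w \<tau>) (lax_to_opfib_nat u v \<theta>)"
  proof (rule extensionalityI)
    fix s assume "s \<in> stack_objs E' F f'"
    moreover obtain A x where "s = (A, x)" by (cases s)
    ultimately show "lax_to_opfib_nat u w (comp_nat E' E \<tau> \<theta>) s = comp_nat S' S (lax_to_opfib_nat v w \<tau>) (lax_to_opfib_nat u v \<theta>) s"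
      using lax_to_opfib_nat_component(1)[OF qp, of A x] lax_to_opfib_nat_component(1)[OF pa, of A x]
        lax_to_opfib_nat_component(1)[OF qa, of A x] by (simp add: comp_nat_def)
  qed (simp_all add: lax_to_opfib_nat_def comp_nat_def)
  then show "FAr lax_to_opfib (Comp Lax q p) = Comp Opf (FAr lax_to_opfib q) (FAr lax_to_opfib p)"
    unfolding p_eq q_eq LaxWmor_simps lax_to_opfib_simps(2)[OF pa] lax_to_opfib_simps(2)[OF qa] lax_to_opfib_simps(2)[OF qp]
    by simp
qed

text \<open>Over the terminal object every object \<open>X\<close> of \<open>E'\<close> becomes an object of the fibre of
  \<open>S\<^bsub>f'\<^esub>\<close>, and \<open>(!, id) : (A, x) \<rightarrow> (1, !)\<close> is a cocartesian arrow.\<close>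

abbreviation "bang X \<equiv> terminal_arr E' (FOb (inv_im f') t) X"

lemma t_Obj [simp]: "t \<in> Obj F"
  using t by (simp add: terminal_object_def)

lemma bang [simp]:
  assumes "X \<in> Obj E'"
  shows "bang X \<in> Arr E'" "Dom E' (bang X) = X" "Cod E' (bang X) = FOb (inv_im f') t"
  using terminal_arr[OF f'_t assms] by simp_all

lemma E'_to_t: "h \<in> Arr E' \<Longrightarrow> k \<in> Arr E' \<Longrightarrow> Cod E' h = FOb (inv_im f') t \<Longrightarrow>
    Cod E' k = FOb (inv_im f') t \<Longrightarrow> Dom E' h = Dom E' k \<Longrightarrow> h = k"
  by (rule terminal_arr_unique[OF f'_t f'.target.category_axioms])

lemma E_to_t: "h \<in> Arr E \<Longrightarrow> k \<in> Arr E \<Longrightarrow> Cod E h = FOb (inv_im f) t \<Longrightarrow>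
    Cod E k = FOb (inv_im f) t \<Longrightarrow> Dom E h = Dom E k \<Longrightarrow> h = k"
  by (rule terminal_arr_unique[OF f_t f.target.category_axioms])

definition "to_fibre_t A x
  = ((A, x), (t, bang (Dom E' x)), (terminal_arr F t A, Idn E' (Dom E' x)))"

lemma to_fibre_t:
  assumes "(A, x) \<in> stack_objs E' F f'"
  shows "to_fibre_t A x \<in> Arr S'"
  using assms terminal_arr[OF t, of A] unfolding to_fibre_t_def
  by (auto intro: E'_to_t)

lemma bang_arrow:
  assumes "h \<in> Arr E'"
  shows "((t, bang (Dom E' h)), (t, bang (Cod E' h)), (Idn F t, h)) \<in> Arr S'"
  using assms by (auto intro: E'_to_t)

text \<open>The component \<open>\<theta>\<^sub>X\<close> is the \<open>E\<close>-component of the image of \<open>\<theta>\<close> at \<open>(1, X \<rightarrow> 1)\<close>.\<close>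

lemma lax_to_opfib_faithful: "faithful_functor Lax Opf lax_to_opfib"
  unfolding faithful_functor_def
proof (intro ballI impI)
  fix p q assume p: "p \<in> Arr Lax" and q: "q \<in> Arr Lax"
    and pq: "Dom Lax p = Dom Lax q \<and> Cod Lax p = Cod Lax q \<and> FAr lax_to_opfib p = FAr lax_to_opfib q"
  obtain u v \<theta> where p_eq: "p = (u, v, \<theta>)" by (metis surj_pair)
  obtain \<tau> where q_eq: "q = (u, v, \<tau>)" using pq by (cases q) (auto simp: p_eq)
  note pa = p[unfolded p_eq] and qa = q[unfolded q_eq]
  have lax_to_opfib_eq: "lax_to_opfib_nat u v \<theta> = lax_to_opfib_nat u v \<tau>"
    using pq lax_to_opfib_simps(2)[OF pa] lax_to_opfib_simps(2)[OF qa] by (simp only: p_eq q_eq prod.inject)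
  have "\<theta> = \<tau>"
  proof (rule extensionalityI)
    show "\<theta> \<in> extensional (Obj E')" "\<tau> \<in> extensional (Obj E')"
      using pa qa by (auto dest: nat_trans.ext)
    fix X assume X: "X \<in> Obj E'"
    then have "(t, bang X) \<in> stack_objs E' F f'" by simp
    then show "\<theta> X = \<tau> X"
      using lax_to_opfib_nat_component(1)[OF pa, of t "bang X"] lax_to_opfib_nat_component(1)[OF qa, of t "bang X"] lax_to_opfib_eq X
      by simp
  qed
  then show "p = q" by (simp add: p_eq q_eq)
qed

text \<open>A vertical transformation \<open>\<Theta>\<close> is determined by its components over the terminal object,
  because it is natural in the cocartesian arrows \<open>(!, id)\<close> into the fibre there, and both functors
  send \<open>(!, id)\<close> to an arrow with \<open>E\<close>-component \<open>id\<close>. That the component at \<open>(A, id)\<close> is an arrow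
  of the stack is the compatibility of \<open>\<theta>\<close> with the cells.\<close>

lemma lax_to_opfib_full: "full_functor Lax Opf lax_to_opfib"
  unfolding full_functor_def
proof (intro ballI)
  fix u v p assume "u \<in> Obj Lax" "v \<in> Obj Lax" and p: "p \<in> hom Opf (FOb lax_to_opfib u) (FOb lax_to_opfib v)"
  then have u: "lax_wmor_obj E E' F f f' u" and v: "lax_wmor_obj E E' F f f' v" by simp_all
  interpret u: lax_square E E' F f f' "inv_im (fst u)" "snd u" using u by (rule lax_square)
  interpret v: lax_square E E' F f f' "inv_im (fst v)" "snd v" using v by (rule lax_square)
  obtain \<Theta> where p_eq: "p = ((fibre_adjunctions u, induced u), (fibre_adjunctions v, induced v), \<Theta>)"
    using p by (cases p) (auto simp: hom_iff lax_to_opfib_simps u v)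
  have \<Theta>: "nat_trans S' S (induced u) (induced v) \<Theta>"
    and vert: "\<And>s. s \<in> stack_objs E' F f' \<Longrightarrow> FAr (stack_proj E F f) (\<Theta> s) = Idn F (fst s)"
    using p by (simp_all add: p_eq hom_iff)
  interpret \<Theta>: nat_trans S' S "induced u" "induced v" \<Theta> by fact
  define \<theta>' where "\<theta>' s = snd (snd (snd (\<Theta> s)))" for s
  have \<Theta>_comp: "\<Theta> (A, x) = (FOb (induced u) (A, x), FOb (induced v) (A, x), (Idn F A, \<theta>' (A, x)))"
    "\<Theta> (A, x) \<in> Arr S" if s: "(A, x) \<in> stack_objs E' F f'" for A x
  proof -
    show mem: "\<Theta> (A, x) \<in> Arr S" using \<Theta>.component_simps(1)[of "(A, x)"] s by simp
    obtain r r' g h where eq: "\<Theta> (A, x) = (r, r', (g, h))" by (metis surj_pair)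
    have "r = FOb (induced u) (A, x)" "r' = FOb (induced v) (A, x)"
      using \<Theta>.component_simps(2,3)[of "(A, x)"] s by (simp_all add: eq)
    moreover have "g = Idn F A"
      using vert[OF s] stack_proj_simps(2)[OF mem[unfolded eq]] by (simp add: eq)
    ultimately show "\<Theta> (A, x) = (FOb (induced u) (A, x), FOb (induced v) (A, x), (Idn F A, \<theta>' (A, x)))"
      by (simp add: \<theta>'_def eq)
  qed
  have \<theta>': "\<theta>' (A, x) \<in> Arr E" "Dom E (\<theta>' (A, x)) = FOb (inv_im (fst u)) (Dom E' x)"
    "Cod E (\<theta>' (A, x)) = FOb (inv_im (fst v)) (Dom E' x)"
    "Comp E (snd v A) (Comp E (FAr (inv_im (fst v)) x) (\<theta>' (A, x)))
      = Comp E (snd u A) (FAr (inv_im (fst u)) x)"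
    if s: "(A, x) \<in> stack_objs E' F f'" for A x
  proof -
    have arrow: "((A, Comp E (snd u A) (FAr (inv_im (fst u)) x)),
        (A, Comp E (snd v A) (FAr (inv_im (fst v)) x)), (Idn F A, \<theta>' (A, x))) \<in> Arr S"
      using \<Theta>_comp(2)[OF s] unfolding \<Theta>_comp(1)[OF s] induced_ob[OF u s] induced_ob[OF v s] .
    then show \<theta>': "\<theta>' (A, x) \<in> Arr E" "Dom E (\<theta>' (A, x)) = FOb (inv_im (fst u)) (Dom E' x)"
      "Cod E (\<theta>' (A, x)) = FOb (inv_im (fst v)) (Dom E' x)"
      using s by simp_all
    have "Comp E (snd v A) (Comp E (FAr (inv_im (fst v)) x) (\<theta>' (A, x)))
      = Comp E (Comp E (snd v A) (FAr (inv_im (fst v)) x)) (\<theta>' (A, x))"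
      by (rule f.target.assoc[symmetric]) (use \<theta>' s in simp_all)
    also have "\<dots> = Comp E (FAr (inv_im f) (Idn F A)) (Comp E (snd u A) (FAr (inv_im (fst u)) x))"
      using arrow unfolding stack_simps(2) by blast
    also have "\<dots> = Comp E (snd u A) (FAr (inv_im (fst u)) x)" using s by simp
    finally show "Comp E (snd v A) (Comp E (FAr (inv_im (fst v)) x) (\<theta>' (A, x)))
      = Comp E (snd u A) (FAr (inv_im (fst u)) x)" .
  qed
  have \<theta>'_nat: "Comp E (\<theta>' (B, y)) (FAr (inv_im (fst u)) h) = Comp E (FAr (inv_im (fst v)) h) (\<theta>' (A, x))"
    if w: "((A, x), (B, y), (g, h)) \<in> Arr S'" for A x B y g h
  proof -
    have s: "(A, x) \<in> stack_objs E' F f'" "(B, y) \<in> stack_objs E' F f'" using w by simp_all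
    show ?thesis
      using \<Theta>.naturality_Arr[OF w] unfolding induced_ar[OF u w] induced_ar[OF v w] stack_simps \<Theta>_comp(1)[OF s(1)]
        \<Theta>_comp(1)[OF s(2)] by simp
  qed
  define \<theta> where "\<theta> = (\<lambda>X\<in>Obj E'. \<theta>' (t, bang X))"
  have \<theta>_eq: "\<theta> (Dom E' x) = \<theta>' (A, x)" if s: "(A, x) \<in> stack_objs E' F f'" for A x
    using \<theta>'_nat[OF to_fibre_t[OF s, unfolded to_fibre_t_def]] \<theta>'[of t "bang (Dom E' x)"] \<theta>'[OF s] s
    by (simp add: \<theta>_def)
  have \<theta>: "nat_trans E' E (inv_im (fst u)) (inv_im (fst v)) \<theta>"
  proof (rule nat_transI)
    show "\<theta> X \<in> Arr E \<and> Dom E (\<theta> X) = FOb (inv_im (fst u)) X \<and> Cod E (\<theta> X) = FOb (inv_im (fst v)) X"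
      if "X \<in> Obj E'" for X
      using \<theta>'[of t "bang X"] that by (simp add: \<theta>_def)
    show "Comp E (\<theta> (Cod E' h)) (FAr (inv_im (fst u)) h) = Comp E (FAr (inv_im (fst v)) h) (\<theta> (Dom E' h))"
      if "h \<in> Arr E'" for h
      using \<theta>'_nat[OF bang_arrow[OF that]] that by (simp add: \<theta>_def)
  qed (auto simp: \<theta>_def u.L.cat_functor_axioms v.L.cat_functor_axioms)
  have "Comp E (snd v A) (\<theta> (FOb (inv_im f') A)) = snd u A" if A: "A \<in> Obj F" for A
  proof -
    have s: "(A, Idn E' (FOb (inv_im f') A)) \<in> stack_objs E' F f'" using A by simp
    show ?thesis using \<theta>_eq[OF s] \<theta>'[OF s] A by simp
  qed
  then have q: "(u, v, \<theta>) \<in> Arr Lax" using u v \<theta> by simp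
  have "lax_to_opfib_nat u v \<theta> = \<Theta>"
  proof (rule extensionalityI)
    show "\<Theta> \<in> extensional (stack_objs E' F f')" using \<Theta>.ext by simp
    fix s assume "s \<in> stack_objs E' F f'"
    moreover obtain A x where "s = (A, x)" by (cases s)
    ultimately show "lax_to_opfib_nat u v \<theta> s = \<Theta> s"
      using lax_to_opfib_nat_component(1)[OF q, of A x] \<Theta>_comp(1)[of A x] \<theta>_eq[of A x] by simp
  qed (simp add: lax_to_opfib_nat_def)
  then have "FAr lax_to_opfib (u, v, \<theta>) = p" by (simp only: lax_to_opfib_simps(2)[OF q] p_eq)
  with q show "\<exists>k\<in>hom Lax u v. FAr lax_to_opfib k = p"
    by (intro bexI[of _ "(u, v, \<theta>)"]) (simp_all add: hom_iff)
qed

end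


section \<open>Essential surjectivity\<close>

locale opfibred_functor = relative_toposes E E' F f f' t + T: stack_functor E E' F f f' T
  for E :: "('o, 'a) cat" and E' :: "('p, 'b) cat" and F :: "('q, 'c) cat"
    and f :: "('o, 'a, 'q, 'c) wgm" and f' :: "('p, 'b, 'q, 'c) wgm" and t T +
  assumes cocartesian: "cocartesian (canonical_stack E' F f') F (stack_proj E' F f') u \<Longrightarrow>
    cocartesian (canonical_stack E F f) F (stack_proj E F f) (FAr T u)"
begin

text \<open>The restriction of \<open>T\<close> to the fibres over the terminal object, read as a functor from \<open>E'\<close> to
  \<open>E\<close>.\<close>

definition "inverse_image = \<lparr>FOb = (\<lambda>X\<in>Obj E'. Dom E (T.ob t (bang X))),
  FAr = (\<lambda>h\<in>Arr E'. T.ar ((t, bang (Dom E' h)), (t, bang (Cod E' h)), (Idn F t, h)))\<rparr>"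

text \<open>The image of the cocartesian arrow \<open>(A, x) \<rightarrow> (1, X \<rightarrow> 1)\<close>: an isomorphism from the domain of
  \<open>T(A, x)\<close> to the inverse image of \<open>X\<close>.\<close>

definition "comparison A x = T.ar (to_fibre_t A x)"

text \<open>The arrow \<open>T(A, id)\<close> to \<open>f\<^sup>*A\<close>, with its domain replaced along the comparison isomorphism by the
  inverse image of \<open>f'\<^sup>*A\<close>.\<close>

definition "lax_cell = (\<lambda>A\<in>Obj F. Comp E (T.ob A (Idn E' (FOb (inv_im f') A)))
  (f.target.inverse_arr (comparison A (Idn E' (FOb (inv_im f') A)))))"

lemma inverse_image_simps [simp]:
  "X \<in> Obj E' \<Longrightarrow> FOb inverse_image X = Dom E (T.ob t (bang X))"
  "h \<in> Arr E' \<Longrightarrow>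
    FAr inverse_image h = T.ar ((t, bang (Dom E' h)), (t, bang (Cod E' h)), (Idn F t, h))"
  by (simp_all add: inverse_image_def)

lemma inverse_image_functor: "cat_functor E' E inverse_image"
proof (rule cat_functorI)
  show "category E'" "category E" by (fact f'.target.category_axioms f.target.category_axioms)+
  show "FOb inverse_image \<in> extensional (Obj E')" "FAr inverse_image \<in> extensional (Arr E')"
    by (simp_all add: inverse_image_def)
  show "FOb inverse_image X \<in> Obj E" if "X \<in> Obj E'" for X
    using that T.FOb_T(2)[of t "bang X"] by simp
  show "FAr inverse_image h \<in> Arr E \<and> Dom E (FAr inverse_image h) = FOb inverse_image (Dom E' h) \<and>
    Cod E (FAr inverse_image h) = FOb inverse_image (Cod E' h)" if "h \<in> Arr E'" for h
    using T.FAr_T[OF bang_arrow[OF that]] that by simp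
  show "FAr inverse_image (Idn E' X) = Idn E (FOb inverse_image X)" if "X \<in> Obj E'" for X
    using T.ar_Idn[of t "bang X"] that by simp
  show "FAr inverse_image (Comp E' k h) = Comp E (FAr inverse_image k) (FAr inverse_image h)"
    if "h \<in> Arr E'" "k \<in> Arr E'" "Dom E' k = Cod E' h" for h k
    using T.ar_Comp[OF bang_arrow[OF that(1)] bang_arrow[OF that(2), unfolded that(3)]] that by simp
qed

lemma comparison:
  assumes s: "(A, x) \<in> stack_objs E' F f'"
  shows "comparison A x \<in> Arr E" "Dom E (comparison A x) = Dom E (T.ob A x)"
    "Cod E (comparison A x) = FOb inverse_image (Dom E' x)" "is_iso E (comparison A x)"
proof -
  note u = to_fibre_t[OF s, unfolded to_fibre_t_def]
  show "comparison A x \<in> Arr E" "Dom E (comparison A x) = Dom E (T.ob A x)"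
    "Cod E (comparison A x) = FOb inverse_image (Dom E' x)"
    using T.FAr_T[OF u] s by (simp_all add: comparison_def to_fibre_t_def)
  have "is_iso E' (Idn E' (Dom E' x))" using s by (intro f'.target.is_iso_Idn) simp
  then have "cocartesian (canonical_stack E' F f') F (stack_proj E' F f') (to_fibre_t A x)"
    unfolding to_fibre_t_def using cocartesian_iff_is_iso[OF f'.cat_functor_axioms u] by blast
  then have coc: "cocartesian S F (stack_proj E F f) (FAr T (to_fibre_t A x))"
    by (rule cocartesian)
  have mem: "FAr T (to_fibre_t A x) \<in> Arr S"
    using T.FAr_simps(1)[OF to_fibre_t[OF s]] .
  show "is_iso E (comparison A x)"
    using coc mem cocartesian_iff_is_iso[OF f.cat_functor_axioms]
    unfolding T.FAr_T(1)[OF u] comparison_def to_fibre_t_def by blast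
qed

text \<open>Both composites are the image under \<open>T\<close> of the one arrow \<open>(!, h)\<close>.\<close>

lemma comparison_natural:
  assumes u: "((A, x), (B, y), (g, h)) \<in> Arr S'"
  shows "Comp E (comparison B y) (T.ar ((A, x), (B, y), (g, h)))
    = Comp E (FAr inverse_image h) (comparison A x)"
proof -
  have s: "(A, x) \<in> stack_objs E' F f'" "(B, y) \<in> stack_objs E' F f'" using u by simp_all
  note p = to_fibre_t[OF s(1), unfolded to_fibre_t_def] and q = to_fibre_t[OF s(2), unfolded to_fibre_t_def]
  have h: "h \<in> Arr E'" "Dom E' h = Dom E' x" "Cod E' h = Dom E' y" and g: "g \<in> Arr F" "Dom F g = A" "Cod F g = B"
    using u by auto
  have A: "A \<in> Obj F" and B: "B \<in> Obj F" using s by simp_all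
  note tA = terminal_arr[OF t A] and tB = terminal_arr[OF t B]
  have bg: "Comp F (terminal_arr F t B) g = terminal_arr F t A"
    by (rule terminal_arr_unique[OF t f.source.category_axioms]) (use tA tB g in simp_all)
  have b: "((t, bang (Dom E' x)), (t, bang (Dom E' y)), (Idn F t, h)) \<in> Arr S'"
    using bang_arrow[OF h(1)] h by simp
  have "Comp E (comparison B y) (T.ar ((A, x), (B, y), (g, h)))
    = T.ar ((A, x), (t, bang (Dom E' y)), (terminal_arr F t A, h))"
    using T.ar_Comp[OF u q] h by (simp add: comparison_def to_fibre_t_def bg)
  also have "\<dots> = Comp E (FAr inverse_image h) (comparison A x)"
    using T.ar_Comp[OF p b] h tA by (simp add: comparison_def to_fibre_t_def)
  finally show ?thesis .
qed

lemma ob_natural: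
  assumes "((A, x), (B, y), (g, h)) \<in> Arr S'"
  shows "Comp E (T.ob B y) (T.ar ((A, x), (B, y), (g, h))) = Comp E (FAr (inv_im f) g) (T.ob A x)"
  by (rule T.FAr_T(5)[OF assms])

lemma lax_cell:
  assumes A: "A \<in> Obj F"
  shows "lax_cell A \<in> Arr E" "Dom E (lax_cell A) = FOb inverse_image (FOb (inv_im f') A)"
    "Cod E (lax_cell A) = FOb (inv_im f) A"
    "Comp E (lax_cell A) (comparison A (Idn E' (FOb (inv_im f') A))) = T.ob A (Idn E' (FOb (inv_im f') A))"
proof -
  have s: "(A, Idn E' (FOb (inv_im f') A)) \<in> stack_objs E' F f'" using A by simp
  note c = comparison[OF s] and o = T.FOb_T[OF s]
  note i = f.target.inverse_arr[OF c(4)]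
  show "lax_cell A \<in> Arr E" "Dom E (lax_cell A) = FOb inverse_image (FOb (inv_im f') A)"
    "Cod E (lax_cell A) = FOb (inv_im f) A"
    "Comp E (lax_cell A) (comparison A (Idn E' (FOb (inv_im f') A))) = T.ob A (Idn E' (FOb (inv_im f') A))"
    using A c o i by (simp_all add: lax_cell_def)
qed

text \<open>The naturality square at \<open>g\<close> is the image under \<open>T\<close> of \<open>(g, f'\<^sup>*g) : (A, id) \<rightarrow> (B, id)\<close>, up to
  the comparison isomorphism, which is cancelled at the end.\<close>

lemma lax_cell_nat_trans:
  "nat_trans F E (comp_ftr F inverse_image (inv_im f')) (inv_im f) lax_cell"
proof (rule nat_transI)
  interpret L: cat_functor E' E inverse_image by (rule inverse_image_functor)
  show "cat_functor F E (comp_ftr F inverse_image (inv_im f'))"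
    by (rule comp_ftr_functor[OF f'.cat_functor_axioms inverse_image_functor])
  show "cat_functor F E (inv_im f)" by (rule f.cat_functor_axioms)
  show "lax_cell \<in> extensional (Obj F)" by (simp add: lax_cell_def)
  show "lax_cell A \<in> Arr E \<and> Dom E (lax_cell A) = FOb (comp_ftr F inverse_image (inv_im f')) A \<and>
    Cod E (lax_cell A) = FOb (inv_im f) A" if "A \<in> Obj F" for A
    using lax_cell[OF that] that by simp
  fix g assume g: "g \<in> Arr F"
  let ?A = "Dom F g" and ?B = "Cod F g"
  let ?a = "Idn E' (FOb (inv_im f') ?A)" and ?b = "Idn E' (FOb (inv_im f') ?B)"
  let ?L = "FAr inverse_image (FAr (inv_im f') g)"
  have A: "?A \<in> Obj F" and B: "?B \<in> Obj F" using g by simp_all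
  have s: "(?A, ?a) \<in> stack_objs E' F f'" "(?B, ?b) \<in> stack_objs E' F f'" using g by simp_all
  have u: "((?A, ?a), (?B, ?b), (g, FAr (inv_im f') g)) \<in> Arr S'" (is "?u \<in> _") using g by simp
  note c = comparison[OF s(1)] comparison[OF s(2)] and l = lax_cell[OF A] lax_cell[OF B]
  note ar = T.FAr_T[OF u] and L = L.FAr_simps[of "FAr (inv_im f') g"]
  have "Comp E (lax_cell ?B) (Comp E ?L (comparison ?A ?a))
    = Comp E (lax_cell ?B) (Comp E (comparison ?B ?b) (T.ar ?u))"
    by (simp only: comparison_natural[OF u])
  also have "\<dots> = Comp E (Comp E (lax_cell ?B) (comparison ?B ?b)) (T.ar ?u)"
    by (rule f.target.assoc[symmetric]) (use g c l ar in simp_all)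
  also have "\<dots> = Comp E (FAr (inv_im f) g) (T.ob ?A ?a)"
    by (simp only: l ob_natural[OF u])
  also have "\<dots> = Comp E (FAr (inv_im f) g) (Comp E (lax_cell ?A) (comparison ?A ?a))"
    by (simp only: l)
  finally have eq: "Comp E (lax_cell ?B) (Comp E ?L (comparison ?A ?a))
    = Comp E (FAr (inv_im f) g) (Comp E (lax_cell ?A) (comparison ?A ?a))" .
  have "Comp E (lax_cell ?B) ?L = Comp E (FAr (inv_im f) g) (lax_cell ?A)"
  proof (rule f.target.iso_cancel_right[OF c(4)])
    have "Comp E (Comp E (lax_cell ?B) ?L) (comparison ?A ?a) = Comp E (lax_cell ?B) (Comp E ?L (comparison ?A ?a))"
      by (rule f.target.assoc) (use g c l L in \<open>simp_all del: inverse_image_simps\<close>)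
    also have "\<dots> = Comp E (Comp E (FAr (inv_im f) g) (lax_cell ?A)) (comparison ?A ?a)"
      unfolding eq by (rule f.target.assoc[symmetric]) (use g c l L in \<open>simp_all del: inverse_image_simps\<close>)
    finally show "Comp E (Comp E (lax_cell ?B) ?L) (comparison ?A ?a)
      = Comp E (Comp E (FAr (inv_im f) g) (lax_cell ?A)) (comparison ?A ?a)" .
  qed (use g c l L in \<open>simp_all del: inverse_image_simps\<close>)
  then show "Comp E (lax_cell ?B) (FAr (comp_ftr F inverse_image (inv_im f')) g)
    = Comp E (FAr (inv_im f) g) (lax_cell ?A)"
    using g by simp
qed

text \<open>Every \<open>(A, x)\<close> maps to \<open>(A, id)\<close> by \<open>x\<close> itself; apply \<open>T\<close> to this arrow.\<close>

lemma ob_eq_lax_cell: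
  assumes s: "(A, x) \<in> stack_objs E' F f'"
  shows "Comp E (lax_cell A) (Comp E (FAr inverse_image x) (comparison A x)) = T.ob A x"
proof -
  interpret L: cat_functor E' E inverse_image by (rule inverse_image_functor)
  let ?a = "Idn E' (FOb (inv_im f') A)"
  have A: "A \<in> Obj F" and x: "x \<in> Arr E'" "Cod E' x = FOb (inv_im f') A" using s by simp_all
  have s': "(A, ?a) \<in> stack_objs E' F f'" using A by simp
  have u: "((A, x), (A, ?a), (Idn F A, x)) \<in> Arr S'" (is "?u \<in> _") using A x by simp
  note l = lax_cell[OF A] and c = comparison[OF s'] and ar = T.FAr_T[OF u]
  have "Comp E (lax_cell A) (Comp E (FAr inverse_image x) (comparison A x))
    = Comp E (lax_cell A) (Comp E (comparison A ?a) (T.ar ?u))"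
    by (simp only: comparison_natural[OF u])
  also have "\<dots> = Comp E (Comp E (lax_cell A) (comparison A ?a)) (T.ar ?u)"
    by (rule f.target.assoc[symmetric]) (use A l c ar in simp_all)
  also have "\<dots> = Comp E (FAr (inv_im f) (Idn F A)) (T.ob A x)"
    by (simp only: l ob_natural[OF u])
  also have "\<dots> = T.ob A x" using A T.FOb_T[OF s] by simp
  finally show ?thesis .
qed

text \<open>The inverse image functor is \<open>T\<close> on the fibres over the terminal object, up to the
  identification of \<open>E'/1\<close> and \<open>E/1\<close> with \<open>E'\<close> and \<open>E\<close>, so it inherits a right adjoint.\<close>

lemma inverse_image_couniversal:
  assumes adj: "has_couniversal_arrows (slice_cat E' (FOb (inv_im f') t))
    (slice_cat E (FOb (inv_im f) t)) (fibre_component E' F f' T t)"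
  shows "has_couniversal_arrows E' E inverse_image"
  unfolding has_couniversal_arrows_def
proof
  let ?D = "slice_cat E' (FOb (inv_im f') t)" and ?C = "slice_cat E (FOb (inv_im f) t)"
  let ?G = "fibre_component E' F f' T t"
  interpret L: cat_functor E' E inverse_image by (rule inverse_image_functor)
  fix Y assume Y: "Y \<in> Obj E"
  let ?y = "terminal_arr E (FOb (inv_im f) t) Y"
  note y = terminal_arr[OF f_t Y]
  have "?y \<in> Obj ?C" using y by simp
  then obtain r u where ru: "couniversal_arrow ?D ?C ?G r ?y u"
    using adj unfolding has_couniversal_arrows_def by blast
  have r: "r \<in> Arr E'" "Cod E' r = FOb (inv_im f') t"
    using ru by (simp_all add: couniversal_arrow_def)
  have r_bang: "r = bang (Dom E' r)"
    by (rule E'_to_t) (use r in simp_all)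
  have G_ob: "FOb ?G x = T.ob t x" if "x \<in> Arr E'" "Cod E' x = FOb (inv_im f') t" for x
    using that by (simp add: fibre_component_def T.ob_def)
  obtain e where u_eq: "u = (T.ob t r, ?y, e)"
    using ru r G_ob[OF r] by (cases u) (auto simp: couniversal_arrow_def hom_iff)
  have u: "u \<in> hom ?C (FOb ?G r) ?y" using ru by (simp add: couniversal_arrow_def)
  have e: "e \<in> Arr E" "Dom E e = FOb inverse_image (Dom E' r)" "Cod E e = Y"
    using u y r r_bang by (simp_all add: u_eq hom_iff)
  have "couniversal_arrow E' E inverse_image (Dom E' r) Y e"
    unfolding couniversal_arrow_def
  proof (intro conjI ballI)
    show "Dom E' r \<in> Obj E'" using r by simp
    show "e \<in> hom E (FOb inverse_image (Dom E' r)) Y" using e by (simp only: hom_iff)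
    fix X h assume X: "X \<in> Obj E'" and h0: "h \<in> hom E (FOb inverse_image X) Y"
    then have h: "h \<in> Arr E" "Dom E h = Dom E (T.ob t (bang X))" "Cod E h = Y"
      by (simp_all add: hom_iff)
    have o: "T.ob t (bang X) \<in> Arr E" "Cod E (T.ob t (bang X)) = FOb (inv_im f) t"
      using T.FOb_T[of t "bang X"] X by simp_all
    have "Comp E ?y h = T.ob t (bang X)"
      by (rule E_to_t) (use h o y in simp_all)
    then have "(T.ob t (bang X), ?y, h) \<in> hom ?C (FOb ?G (bang X)) ?y"
      using h o y X G_ob by (simp add: hom_iff)
    moreover have "bang X \<in> Obj ?D" using X by simp
    ultimately have ex1: "\<exists>!l. l \<in> hom ?D (bang X) r \<and> Comp ?C u (FAr ?G l) = (T.ob t (bang X), ?y, h)"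
      using ru unfolding couniversal_arrow_def by blast
    have iff: "(bang X, r, k) \<in> hom ?D (bang X) r \<and>
        Comp ?C u (FAr ?G (bang X, r, k)) = (T.ob t (bang X), ?y, h) \<longleftrightarrow>
      k \<in> hom E' X (Dom E' r) \<and> Comp E e (FAr inverse_image k) = h" for k
    proof -
      have hom: "(bang X, r, k) \<in> hom ?D (bang X) r \<longleftrightarrow> k \<in> hom E' X (Dom E' r)"
        using X r by (auto simp: hom_iff intro: E'_to_t)
      moreover have "Comp ?C u (FAr ?G (bang X, r, k)) = (T.ob t (bang X), ?y, Comp E e (FAr inverse_image k))"
        if k: "k \<in> hom E' X (Dom E' r)"
      proof -
        have "(bang X, r, k) \<in> Arr ?D"
          using iffD2[OF hom k] unfolding hom_iff by blast
        moreover have "k \<in> Arr E'" "Dom E' k = X" "Cod E' k = Dom E' r" using k by (simp_all add: hom_iff)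
        ultimately show ?thesis
          using r_bang by (simp add: fibre_component_def u_eq T.ob_def T.ar_def del: slice_simps(2))
      qed
      ultimately show ?thesis by auto
    qed
    from ex1 obtain l where l: "l \<in> hom ?D (bang X) r" "Comp ?C u (FAr ?G l) = (T.ob t (bang X), ?y, h)"
      and l_uniq: "\<And>l'. l' \<in> hom ?D (bang X) r \<and> Comp ?C u (FAr ?G l') = (T.ob t (bang X), ?y, h) \<Longrightarrow> l' = l"
      by blast
    obtain k where k: "l = (bang X, r, k)" using l(1) by (cases l) (auto simp: hom_iff)
    show "\<exists>!k. k \<in> hom E' X (Dom E' r) \<and> Comp E e (FAr inverse_image k) = h"
    proof (rule ex1I[of _ k])
      show "k \<in> hom E' X (Dom E' r) \<and> Comp E e (FAr inverse_image k) = h"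
        using iff[of k] l unfolding k by blast
      show "k' = k" if "k' \<in> hom E' X (Dom E' r) \<and> Comp E e (FAr inverse_image k') = h" for k'
        using l_uniq[of "(bang X, r, k')"] iff[of k'] that unfolding k by blast
    qed
  qed
  then show "\<exists>r e. couniversal_arrow E' E inverse_image r Y e" by blast
qed

end

context relative_toposes
begin

text \<open>The comparison isomorphisms form a vertical natural isomorphism from the given morphism of
  opfibrations to the one induced by its inverse image and its cell.\<close>

lemma lax_to_opfib_essentially_surjective: "essentially_surjective Lax Opf lax_to_opfib"
  unfolding essentially_surjective_def
proof
  interpret S: category S by (rule stack_category[OF f.cat_functor_axioms])
  interpret S': category S' by (rule stack_category[OF f'.cat_functor_axioms])
  interpret Opf: category Opf by (rule Opf_category)
  fix v assume "v \<in> Obj Opf"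
  then have v: "opfib_weak_obj E E' F f f' v" by simp
  interpret V: stack_functor E E' F f f' "snd v"
    using f.cat_functor_axioms f'.cat_functor_axioms opfib_weak_objD(1,2)[OF v]
    by (simp add: stack_functor_def stack_functor_axioms_def opfibration_morphism_def)
  interpret V: opfibred_functor E E' F f f' t "snd v"
    by unfold_locales (use opfib_weak_objD(2)[OF v] in \<open>unfold opfibration_morphism_def, blast\<close>)
  obtain a where a: "weak_geometric_morphism E E' a" "inv_im a = V.inverse_image"
    using couniversal_arrows_give_weak_geometric_morphism[OF V.inverse_image_functor
        V.inverse_image_couniversal[OF opfib_weak_objD(3)[OF v t_Obj]]] by blast
  define u where "u = (a, V.lax_cell)"
  have u: "lax_wmor_obj E E' F f f' u"
    using a V.lax_cell_nat_trans by (simp add: u_def lax_wmor_obj_def)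
  interpret L: cat_functor E' E V.inverse_image by (rule V.inverse_image_functor)
  have induced_u: "FOb (induced u) (A, x) = (A, Comp E (V.lax_cell A) (FAr V.inverse_image x))"
    if "(A, x) \<in> stack_objs E' F f'" for A x
    using induced_ob[OF u that] by (simp add: u_def a)
  define c where "c = (\<lambda>s\<in>stack_objs E' F f'.
    (FOb (snd v) s, FOb (induced u) s, (Idn F (fst s), V.comparison (fst s) (snd s))))"
  have c_mem: "((A, V.ob A x), (A, Comp E (V.lax_cell A) (FAr V.inverse_image x)),
      (Idn F A, V.comparison A x)) \<in> Arr S"
    and c_eq: "c (A, x) = ((A, V.ob A x), (A, Comp E (V.lax_cell A) (FAr V.inverse_image x)),
      (Idn F A, V.comparison A x))" if s: "(A, x) \<in> stack_objs E' F f'" for A x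
  proof -
    have A: "A \<in> Obj F" and x: "x \<in> Arr E'" "Cod E' x = FOb (inv_im f') A" using s by simp_all
    note o = V.FOb_T[OF s] and k = V.comparison[OF s] and l = V.lax_cell[OF A] and L = L.FAr_simps[OF x(1)]
    have "Comp E (Comp E (V.lax_cell A) (FAr V.inverse_image x)) (V.comparison A x) = V.ob A x"
      using V.ob_eq_lax_cell[OF s] f.target.assoc[OF k(1) L(1) l(1)] k l L x
      by (simp del: V.inverse_image_simps)
    then show "((A, V.ob A x), (A, Comp E (V.lax_cell A) (FAr V.inverse_image x)),
      (Idn F A, V.comparison A x)) \<in> Arr S"
      using A x o k l L by (simp del: V.inverse_image_simps)
    show "c (A, x) = ((A, V.ob A x), (A, Comp E (V.lax_cell A) (FAr V.inverse_image x)),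
      (Idn F A, V.comparison A x))"
      using s o induced_u[OF s] by (simp add: c_def)
  qed
  have "nat_trans S' S (snd v) (induced u) c"
  proof (rule nat_transI)
    show "cat_functor S' S (snd v)" by (rule V.cat_functor_axioms)
    show "cat_functor S' S (induced u)" by (rule induced_functor[OF u])
    show "c \<in> extensional (Obj S')" by (simp add: c_def)
    show "c s \<in> Arr S \<and> Dom S (c s) = FOb (snd v) s \<and> Cod S (c s) = FOb (induced u) s" if "s \<in> Obj S'" for s
    proof -
      obtain A x where s: "s = (A, x)" by (cases s)
      have Ax: "(A, x) \<in> stack_objs E' F f'" using that by (simp add: s)
      show ?thesis
        unfolding s c_eq[OF Ax] V.FOb_T(1)[OF Ax] induced_u[OF Ax] stack_simps(3,4) using c_mem[OF Ax] by blast
    qed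
    fix w assume w: "w \<in> Arr S'"
    obtain A x B y g h where w_eq: "w = ((A, x), (B, y), (g, h))" by (metis surj_pair)
    have w': "((A, x), (B, y), (g, h)) \<in> Arr S'" using w by (simp only: w_eq)
    then have s: "(A, x) \<in> stack_objs E' F f'" "(B, y) \<in> stack_objs E' F f'" and g: "g \<in> Arr F" "Dom F g = A" "Cod F g = B"
      by auto
    show "Comp S (c (Cod S' w)) (FAr (snd v) w) = Comp S (FAr (induced u) w) (c (Dom S' w))"
      unfolding w_eq stack_simps(3,4) c_eq[OF s(1)] c_eq[OF s(2)] V.FAr_T(1)[OF w'] induced_ar[OF u w']
        induced_u[OF s(1)] induced_u[OF s(2)] stack_simps(6)
      using V.comparison_natural[OF w'] g by (simp add: u_def a)
  qed
  moreover have "FAr (stack_proj E F f) (c s) = Idn F (fst s)" if "s \<in> stack_objs E' F f'" for s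
  proof -
    obtain A x where s: "s = (A, x)" by (cases s)
    have Ax: "(A, x) \<in> stack_objs E' F f'" using that by (simp add: s)
    show ?thesis unfolding s c_eq[OF Ax] stack_proj_simps(2)[OF c_mem[OF Ax]] by simp
  qed
  ultimately have c: "(v, (fibre_adjunctions u, induced u), c) \<in> Arr Opf"
    using v lax_to_opfib_obj[OF u] by simp
  have c_iso: "is_iso Opf (v, (fibre_adjunctions u, induced u), c)"
  proof (rule OpfibWeak_is_isoI[OF f.cat_functor_axioms f'.cat_functor_axioms c])
    fix s assume s0: "s \<in> stack_objs E' F f'"
    obtain A x where s: "s = (A, x)" by (cases s)
    have Ax: "(A, x) \<in> stack_objs E' F f'" using s0 by (simp add: s)
    show "is_iso S (c s)"
      unfolding s c_eq[OF Ax] by (rule stack_is_isoI[OF f.cat_functor_axioms c_mem[OF Ax] V.comparison(4)[OF Ax]])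
  qed
  show "\<exists>x\<in>Obj Lax. \<exists>e\<in>hom Opf (FOb lax_to_opfib x) v. is_iso Opf e"
    using u Opf.inverse_arr[OF c_iso] Opf.inverse_arr_is_iso[OF c_iso]
    by (intro bexI[of _ u] bexI[of _ "Opf.inverse_arr (v, (fibre_adjunctions u, induced u), c)"])
      (simp_all add: hom_iff lax_to_opfib_simps)
qed

theorem OpfibWeak_equivalent_LaxWmor: "equivalent_categories Opf Lax"
  by (rule equivalent_categories_sym)
    (rule equivalent_categories_if_fully_faithful[OF lax_to_opfib_functor lax_to_opfib_full lax_to_opfib_faithful lax_to_opfib_essentially_surjective])

end

theorem proposition6p2p2:
  fixes E :: "('o, 'a) cat" and E' :: "('p, 'b) cat" and F :: "('q, 'c) cat"
    and f :: "('o, 'a, 'q, 'c) wgm" and f' :: "('p, 'b, 'q, 'c) wgm"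
  assumes "universe TYPE('u)"
    and "grothendieck_topos TYPE('u) E"
    and "grothendieck_topos TYPE('u) E'"
    and "grothendieck_topos TYPE('u) F"
    and "geometric_morphism E F f"
    and "geometric_morphism E' F f'"
  shows "equivalent_categories (OpfibWeak E E' F f f') (LaxWmor E E' F f f')"
proof -
  have f: "cat_functor F E (inv_im f)" "preserves_finite_limits F E (inv_im f)"
    and f': "cat_functor F E' (inv_im f')" "preserves_finite_limits F E' (inv_im f')"
    using assms(5,6) by (simp_all add: geometric_morphism_def weak_geometric_morphism_def)
  obtain t where t: "terminal_object F t"
    using topos_finite_limits(3)[OF assms(1,4)] by blast
  interpret relative_toposes E E' F f f' t
    using f(1) f'(1) t topos_finite_limits(2)[OF assms(1,3)] preserves_terminal_object[OF f t]
      preserves_terminal_object[OF f' t]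
    by (simp add: relative_toposes_def relative_toposes_axioms_def)
  show ?thesis by (rule OpfibWeak_equivalent_LaxWmor)
qed

end
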